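(* Let $G$ be a subcubic graph without isolated vertices. Then $$\nu_{ac}(G) \geq \frac{1}{4}\left( n(G) - \kappa_G(K_{2,3}) - \kappa_G(K_4^+) - 2\kappa_G(K_{3,3}) \right).$$
   Context: All graphs are finite, simple, and undirected. A graph is subcubic if its maximum degree is at most $3$. A matching $M$ in a graph $G$ is acyclic if the subgraph of $G$ induced by the set of vertices incident to some edge of $M$ is a forest; the acyclic matching number $\nu_{ac}(G)$ is the maximum size of an acyclic matching in $G$. $n(G)$ denotes the number of vertices of $G$. For graphs $G$ and $H$, $\kappa_G(H)$ denotes the number of connected components of $G$ that are isomorphic to $H$. $K_4^+$ denotes the graph obtained from the complete graph $K_4$ by subdividing one edge once (i.e., replacing one edge by a path of length $2$ through a new vertex). *)

theory Defs
  imports "Graph_Theory.Graph_Theory"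
begin

text \<open>
  A finite simple undirected graph is a \<^locale>\<open>pair_graph\<close>: a finite symmetric loop-free
  digraph, in which an undirected edge \<open>uv\<close> is represented by the two arcs \<open>(u,v)\<close> and \<open>(v,u)\<close>.
  Consequently the degree of a vertex is its \<^const>\<open>out_degree\<close>, and the connected components
  are the strongly connected components \<^const>\<open>pre_digraph.sccs\<close>.
\<close>

definition uedges :: "'a pair_pre_digraph \<Rightarrow> 'a set set" where
  "uedges G = {{u, v} | u v. (u, v) \<in> parcs G}"

definition isolated :: "'a pair_pre_digraph \<Rightarrow> 'a \<Rightarrow> bool" where
  "isolated G v \<longleftrightarrow> v \<in> pverts G \<and> out_degree G v = 0"

definition subcubic :: "'a pair_pre_digraph \<Rightarrow> bool" where
  "subcubic G \<longleftrightarrow> (\<forall>v \<in> pverts G. out_degree G v \<le> 3)"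

text \<open>
  The library's \<^const>\<open>forest\<close> forbids all directed cycles, in particular the closed walk of
  length 2 that uses both arcs of one undirected edge. For a symmetric loop-free digraph without
  parallel arcs, the cycles of the underlying simple graph are the directed cycles of length at
  least 3.
\<close>

definition undirected_forest :: "('a, 'b) pre_digraph \<Rightarrow> bool" where
  "undirected_forest G \<longleftrightarrow> \<not> (\<exists>p. pre_digraph.cycle G p \<and> 3 \<le> length p)"

definition matching :: "'a pair_pre_digraph \<Rightarrow> 'a set set \<Rightarrow> bool" where
  "matching G M \<longleftrightarrow> M \<subseteq> uedges G \<and> (\<forall>e \<in> M. \<forall>f \<in> M. e \<noteq> f \<longrightarrow> e \<inter> f = {})"

definition acyclic_matching :: "'a pair_pre_digraph \<Rightarrow> 'a set set \<Rightarrow> bool" where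
  "acyclic_matching G M \<longleftrightarrow> matching G M \<and> undirected_forest (with_proj G \<restriction> \<Union>M)"

definition acyclic_matching_number :: "'a pair_pre_digraph \<Rightarrow> nat" (\<open>\<nu>\<^sub>a\<^sub>c\<close>) where
  "\<nu>\<^sub>a\<^sub>c G = Max (card ` {M. acyclic_matching G M})"

definition components_iso :: "'a pair_pre_digraph \<Rightarrow> 'b pair_pre_digraph \<Rightarrow> nat" (\<open>\<kappa>\<close>) where
  "\<kappa> G H = card {C \<in> pre_digraph.sccs (with_proj G). digraph_iso C (with_proj H)}"

definition complete_graph :: "nat \<Rightarrow> nat pair_pre_digraph" where
  "complete_graph n =
    \<lparr>pverts = {..<n}, parcs = {(u, v). u < n \<and> v < n \<and> u \<noteq> v}\<rparr>"

definition complete_bipartite_graph :: "nat \<Rightarrow> nat \<Rightarrow> (nat + nat) pair_pre_digraph" where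
  "complete_bipartite_graph m n =
    \<lparr>pverts = Inl ` {..<m} \<union> Inr ` {..<n},
     parcs = (Inl ` {..<m}) \<times> (Inr ` {..<n}) \<union> (Inr ` {..<n}) \<times> (Inl ` {..<m})\<rparr>"

definition K4_plus :: "nat pair_pre_digraph" where
  "K4_plus = subdivide (complete_graph 4) (0, 1) 4"

lemma complete_graph: "K\<^bsub>n\<^esub> (with_proj (complete_graph n))"
  by (auto simp: complete_digraph_pair_def complete_graph_def)

lemma complete_bipartite_graph: "K\<^bsub>m,n\<^esub> (with_proj (complete_bipartite_graph m n))"
  unfolding complete_bipartite_digraph_pair_def
  by (intro conjI exI[of _ "Inl ` {..<m}"] exI[of _ "Inr ` {..<n}"])
    (auto simp: complete_bipartite_graph_def card_image)

lemma pair_graph_K4_plus: "pair_graph K4_plus"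
proof -
  interpret pair_graph "complete_graph 4"
    by (rule pair_graphI_complete[OF complete_graph])
  show ?thesis
    unfolding K4_plus_def
    by (rule pair_graph_subdivide) (auto simp: complete_graph_def)
qed

text \<open>The maximum defining \<^const>\<open>acyclic_matching_number\<close> ranges over a nonempty finite set.\<close>

lemma acyclic_matching_empty: "acyclic_matching G {}"
proof -
  have "\<not> pre_digraph.cycle (with_proj G \<restriction> {}) p" for p
    by (auto simp: pre_digraph.cycle_def pre_digraph.awalk_def)
  then show ?thesis
    by (simp add: acyclic_matching_def matching_def undirected_forest_def)
qed

lemma finite_acyclic_matchings:
  assumes "pair_graph G"
  shows "finite {M. acyclic_matching G M}"
proof -
  interpret pair_graph G by fact
  have "uedges G = (\<lambda>(u, v). {u, v}) ` parcs G"
    by (auto simp: uedges_def)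
  then have "finite (uedges G)"
    using pair_finite_arcs by simp
  then have "finite (Pow (uedges G))"
    by simp
  then show ?thesis
    by (rule rev_finite_subset) (auto simp: acyclic_matching_def matching_def)
qed

end

theory Submission
  imports Defs
begin

text \<open>
  Suppose first that no two vertices of the subcubic graph have three common neighbours. Take a
  suitably extremal maximum acyclic matching \<open>M\<close>, let \<open>F\<close> be the set of matched vertices and let
  every vertex outside \<open>F\<close> collect charge from its neighbours in \<open>F\<close>. A forest component with
  \<open>2k\<close> vertices has at most \<open>2k + 2\<close> edges to the outside, so \<open>M\<close> would be large enough if two units
  were saved at each component. If a component saves less, some exchange of one matching edge for
  one or two others improves \<open>M\<close>. Hence at most as many vertices are outside \<open>F\<close> as inside, that
  is, \<open>n \<le> 4 |M|\<close>.

  If two vertices have the same three neighbours, the resulting copy of \<open>K\<^bsub>2,3\<^esub>\<close> is contracted to a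
  single vertex. This removes four vertices, and an acyclic matching of the contracted graph lifts to
  one with an additional edge. The exceptional components are those for which this fails; each of
  them contributes one matching edge.
\<close>

subsection \<open>Acyclic vertex sets\<close>

text \<open>The coefficients come from the reductions. A contraction gives up four vertices for one
  edge, exactly the required ratio. An exceptional component has 5 = 4 + 1 or 6 = 4 + 2 vertices for
  its one edge, hence the coefficients 1 and 2. A contraction may also create a new exceptional
  component; undoing it then gives at most ten vertices, which are deleted against three edges.
  Maximality of the matching excludes only adding an edge or trading one edge for two. Several
  obstructing configurations admit just a one-for-one trade, which leaves the size unchanged; the
  extremal choice is made so that such a trade still contradicts it. The absence of K_{2,3} matters
  for forest components that are a single matching edge. Up to four edges leave such a component and
  half of their maximal charge has to be saved; without shared neighbours, the adjacencies between
  the receivers at the two ends then form a partial matching, so a full charge at one end forces a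
  zero charge at the other.\<close>

text \<open>
  Every nonempty subset of \<open>F\<close> has a vertex of degree at most one in it: this degeneracy
  condition characterises induced forests without mentioning walks.
\<close>

definition acyc :: "('a \<Rightarrow> 'a set) \<Rightarrow> 'a set \<Rightarrow> bool" where
  "acyc N F \<longleftrightarrow> \<not> (\<exists>X\<subseteq>F. X \<noteq> {} \<and> (\<forall>x\<in>X. 2 \<le> card (N x \<inter> X)))"

definition fconn :: "('a \<Rightarrow> 'a set) \<Rightarrow> 'a set \<Rightarrow> 'a \<Rightarrow> 'a \<Rightarrow> bool" where
  "fconn N F x y \<longleftrightarrow> (x, y) \<in> {(p, q). p \<in> F \<and> q \<in> F \<and> q \<in> N p}\<^sup>*"

definition mat :: "('a \<Rightarrow> 'a set) \<Rightarrow> 'a set set \<Rightarrow> bool" where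
  "mat N M \<longleftrightarrow> (\<forall>e\<in>M. \<exists>u v. e = {u, v} \<and> v \<in> N u) \<and> (\<forall>e\<in>M. \<forall>f\<in>M. e \<noteq> f \<longrightarrow> e \<inter> f = {})"

locale sgraph =
  fixes V :: "'a set" and N :: "'a \<Rightarrow> 'a set"
  assumes finV: "finite V"
    and N_sub: "N x \<subseteq> V"
    and sym: "y \<in> N x \<Longrightarrow> x \<in> N y"
    and irrefl: "x \<notin> N x"
begin

lemma finN [simp]: "finite (N x)"
  using finV N_sub finite_subset by blast

lemma neq: "y \<in> N x \<Longrightarrow> x \<noteq> y"
  using irrefl by auto

lemma inV: "y \<in> N x \<Longrightarrow> y \<in> V \<and> x \<in> V"
  using N_sub sym by blast

end

lemma mat_edgeE:
  assumes "mat N M" "e \<in> M"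
  obtains u v where "e = {u, v}" "v \<in> N u"
proof -
  have "\<exists>u v. e = {u, v} \<and> v \<in> N u"
    using assms unfolding mat_def by (elim conjE) (drule (1) bspec)
  then show thesis using that by (elim exE conjE)
qed

lemma mat_disjoint: "mat N M \<Longrightarrow> e \<in> M \<Longrightarrow> f \<in> M \<Longrightarrow> e \<noteq> f \<Longrightarrow> e \<inter> f = {}"
  by (simp add: mat_def)

lemma mat_vertexE:
  assumes "mat N M" "x \<in> \<Union>M"
  obtains u v where "{u, v} \<in> M" "v \<in> N u" "x = u \<or> x = v"
proof -
  obtain e where e: "e \<in> M" "x \<in> e" using assms(2) by blast
  obtain u v where uv: "e = {u, v}" "v \<in> N u" using mat_edgeE[OF assms(1) e(1)] .
  show thesis using that[of u v] e uv by simp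
qed

lemma acycI:
  assumes "\<And>X. X \<subseteq> F \<Longrightarrow> X \<noteq> {} \<Longrightarrow> (\<And>x. x \<in> X \<Longrightarrow> 2 \<le> card (N x \<inter> X)) \<Longrightarrow> False"
  shows "acyc N F"
  using assms unfolding acyc_def by blast

lemma acyc_mono: "acyc N F \<Longrightarrow> F' \<subseteq> F \<Longrightarrow> acyc N F'"
  unfolding acyc_def by (meson order_trans)

lemma acyc_empty [simp]: "acyc N {}"
  by (auto simp: acyc_def)

lemma acycD:
  assumes "acyc N F" "X \<subseteq> F" "X \<noteq> {}"
  obtains x where "x \<in> X" "card (N x \<inter> X) \<le> 1"
proof -
  have "\<not> (\<forall>x\<in>X. 2 \<le> card (N x \<inter> X))"
    using assms unfolding acyc_def by blast
  then show thesis using that by force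
qed

lemma card_le_1_subset:
  assumes "A \<subseteq> {y}" shows "card A \<le> 1"
  using assms card_mono[of "{y}" A] by simp

lemma fconn_refl [simp]: "fconn N F x x"
  by (simp add: fconn_def)

lemma fconn_trans: "fconn N F x y \<Longrightarrow> fconn N F y z \<Longrightarrow> fconn N F x z"
  unfolding fconn_def by (rule rtrancl_trans)

lemma fconn_mono: "fconn N F x y \<Longrightarrow> F \<subseteq> F' \<Longrightarrow> fconn N F' x y"
  unfolding fconn_def by (erule rtrancl_mono[THEN subsetD, rotated]) auto

lemma fconn_edge: "p \<in> F \<Longrightarrow> q \<in> F \<Longrightarrow> q \<in> N p \<Longrightarrow> fconn N F p q"
  unfolding fconn_def by (rule r_into_rtrancl) auto

lemma fconn_in: "fconn N F x y \<Longrightarrow> x \<in> F \<Longrightarrow> y \<in> F"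
  unfolding fconn_def by (induction rule: rtrancl_induct) auto

context sgraph begin

lemma fconn_sym: "fconn N F x y \<Longrightarrow> fconn N F y x"
  unfolding fconn_def
proof (induction rule: rtrancl_induct)
  case (step y z)
  then have "(z, y) \<in> {(p, q). p \<in> F \<and> q \<in> F \<and> q \<in> N p}" by (auto intro: sym)
  then show ?case using step.IH by (rule converse_rtrancl_into_rtrancl)
qed simp

lemma acyc_insert_leaf:
  assumes "acyc N F" "card (N x \<inter> F) \<le> 1"
  shows "acyc N (insert x F)"
proof (cases "x \<in> F")
  case False
  show ?thesis
  proof (rule acycI)
    fix X assume X: "X \<subseteq> insert x F" "X \<noteq> {}" "\<And>x. x \<in> X \<Longrightarrow> 2 \<le> card (N x \<inter> X)"
    show False
    proof (cases "x \<in> X")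
      case True
      have "N x \<inter> X \<subseteq> N x \<inter> F" using X irrefl by auto
      then have "card (N x \<inter> X) \<le> card (N x \<inter> F)" by (intro card_mono) auto
      then show False using X(3)[OF True] assms(2) by linarith
    next
      case False
      then have "X \<subseteq> F" using X(1) by auto
      then show False using assms(1) X(2,3) unfolding acyc_def by blast
    qed
  qed
qed (use assms in \<open>simp add: insert_absorb\<close>)

lemma acyc_insert_leaf':
  assumes "acyc N F" "N x \<inter> F \<subseteq> {y}"
  shows "acyc N (insert x F)"
  using acyc_insert_leaf[OF assms(1) card_le_1_subset[OF assms(2)]] .

text \<open>Remove a vertex \<open>x\<close> of degree at most one. Of two such vertices in the
  rest, at least one is not adjacent to \<open>x\<close> and so keeps its degree when
  \<open>x\<close> returns.\<close>

lemma two_leaves: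
  assumes "acyc N X" "finite X" "2 \<le> card X"
  shows "\<exists>x\<in>X. \<exists>y\<in>X. x \<noteq> y \<and> card (N x \<inter> X) \<le> 1 \<and> card (N y \<inter> X) \<le> 1"
  using assms
proof (induction "card X" arbitrary: X)
  case (Suc n)
  have "X \<noteq> {}" using Suc.prems by auto
  then obtain x where x: "x \<in> X" "card (N x \<inter> X) \<le> 1"
    using acycD[OF Suc.prems(1) subset_refl] by blast
  let ?Y = "X - {x}"
  have Yn: "card ?Y = n" using x(1) Suc.hyps(2) Suc.prems(2) by simp
  have aY: "acyc N ?Y" using acyc_mono[OF Suc.prems(1)] by auto
  show ?case
  proof (cases "2 \<le> n")
    case True
    obtain y z where yz: "y \<in> ?Y" "z \<in> ?Y" "y \<noteq> z" "card (N y \<inter> ?Y) \<le> 1" "card (N z \<inter> ?Y) \<le> 1"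
      using Suc.hyps(1)[OF Yn[symmetric] aY] True Yn Suc.prems(2) by auto
    have "y \<notin> N x \<or> z \<notin> N x"
    proof (rule ccontr)
      assume "\<not> ?thesis"
      then have "{y, z} \<subseteq> N x \<inter> X" using yz by auto
      then have "card {y, z} \<le> card (N x \<inter> X)" by (intro card_mono) auto
      then show False using x(2) yz(3) by simp
    qed
    then obtain w where w: "w \<in> ?Y" "card (N w \<inter> ?Y) \<le> 1" "w \<notin> N x"
      using yz by blast
    have "N w \<inter> X = N w \<inter> ?Y" using w(3) sym by blast
    then show ?thesis using x w by (metis DiffE insertCI)
  next
    case False
    then have "card X = 2" using Suc.hyps(2) Suc.prems(3) by linarith
    then obtain p q where pq: "X = {p, q}" "p \<noteq> q" by (meson card_2_iff)
    have "N p \<inter> X \<subseteq> {q}" "N q \<inter> X \<subseteq> {p}" using pq irrefl by auto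
    then show ?thesis using pq card_le_1_subset by (metis insertCI)
  qed
qed simp

text \<open>A new vertex that joins different trees closes no cycle. In a violating set
  \<open>X\<close>, let \<open>Y\<close> be the part of \<open>X - {x}\<close> that is connected in
  \<open>F\<close> to a neighbour \<open>y\<close> of \<open>x\<close>. No other vertex of
  \<open>Y\<close> is adjacent to \<open>x\<close>, so only \<open>y\<close> can lose degree in
  passing to \<open>Y\<close>, against \<open>two_leaves\<close>.\<close>

lemma acyc_insert:
  assumes ac: "acyc N F" and fin: "finite F" and xF: "x \<notin> F"
    and sep: "\<And>y z. y \<in> N x \<inter> F \<Longrightarrow> z \<in> N x \<inter> F \<Longrightarrow> y \<noteq> z \<Longrightarrow> \<not> fconn N F y z"
  shows "acyc N (insert x F)"
proof (rule acycI)
  fix X assume X: "X \<subseteq> insert x F" "X \<noteq> {}" and deg: "\<And>x. x \<in> X \<Longrightarrow> 2 \<le> card (N x \<inter> X)"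
  have xX: "x \<in> X" using X deg ac unfolding acyc_def by blast
  then have "2 \<le> card (N x \<inter> X)" using deg by blast
  then obtain y where y: "y \<in> N x" "y \<in> X"
    by (metis Int_iff card.empty ex_in_conv not_numeral_le_zero)
  have yF: "y \<in> F" using y X irrefl by auto
  define Y where "Y = {z \<in> X - {x}. fconn N F y z}"
  have YF: "Y \<subseteq> F" using X by (auto simp: Y_def)
  have finY: "finite Y" using YF fin finite_subset by blast
  have yY: "y \<in> Y" using y irrefl by (auto simp: Y_def)
  have nbr: "N z \<inter> X - {x} \<subseteq> Y" if "z \<in> Y" for z
  proof
    fix t assume t: "t \<in> N z \<inter> X - {x}"
    have zF: "z \<in> F" using that YF by blast
    have tF: "t \<in> F" using t X by auto
    have "fconn N F z t" using zF tF t by (intro fconn_edge) auto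
    then show "t \<in> Y" using that t by (auto simp: Y_def intro: fconn_trans)
  qed
  have big: "2 \<le> card (N z \<inter> Y)" if "z \<in> Y" "z \<noteq> y" for z
  proof -
    have "x \<notin> N z"
    proof
      assume "x \<in> N z"
      then have "z \<in> N x \<inter> F" using sym that YF by blast
      then show False using sep[of y z] y yF that by (auto simp: Y_def)
    qed
    then have "N z \<inter> X \<subseteq> N z \<inter> Y" using nbr[OF that(1)] by blast
    then have "card (N z \<inter> X) \<le> card (N z \<inter> Y)" by (intro card_mono) auto
    moreover have "z \<in> X" using that by (auto simp: Y_def)
    ultimately show ?thesis using deg by fastforce
  qed
  \<comment> \<open>The exception \<open>y\<close> keeps a neighbour in \<open>Y\<close>, so
    \<open>Y\<close> has the two elements that \<open>two_leaves\<close> requires.\<close>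
  have "1 \<le> card (N y \<inter> X - {x})"
    using deg y(2) by (metis Diff_empty Diff_insert0 Nat.le_diff_conv2 add_leE card_Diff_singleton nat_1_add_1)
  moreover have "N y \<inter> X - {x} \<subseteq> Y - {y}" using nbr[OF yY] irrefl by blast
  ultimately have "1 \<le> card (Y - {y})"
    using card_mono[OF finite_Diff[OF finY]] le_trans by blast
  then have "2 \<le> card Y" using yY finY by (simp add: card_Diff_singleton)
  moreover have "acyc N Y" using acyc_mono[OF ac YF] .
  ultimately obtain p q where "p \<in> Y" "q \<in> Y" "p \<noteq> q" "card (N p \<inter> Y) \<le> 1" "card (N q \<inter> Y) \<le> 1"
    using two_leaves[of Y] finY by blast
  then show False using big[of p] big[of q] by force
qed

lemma acyc_Un:
  assumes "acyc N F" "acyc N F'" "\<And>x y. x \<in> F \<Longrightarrow> y \<in> F' \<Longrightarrow> y \<notin> N x"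
  shows "acyc N (F \<union> F')"
proof (rule acycI)
  fix X assume X: "X \<subseteq> F \<union> F'" "X \<noteq> {}" and deg: "\<And>x. x \<in> X \<Longrightarrow> 2 \<le> card (N x \<inter> X)"
  have "X \<inter> F \<noteq> {} \<or> X \<inter> F' \<noteq> {}" using X by blast
  then show False
  proof
    assume ne: "X \<inter> F \<noteq> {}"
    obtain x where x: "x \<in> X \<inter> F" "card (N x \<inter> (X \<inter> F)) \<le> 1"
      using acycD[OF assms(1) _ ne] by blast
    have "N x \<inter> X = N x \<inter> (X \<inter> F)" using assms(3) x X by blast
    then show False using x deg by fastforce
  next
    assume ne: "X \<inter> F' \<noteq> {}"
    obtain x where x: "x \<in> X \<inter> F'" "card (N x \<inter> (X \<inter> F')) \<le> 1"
      using acycD[OF assms(2) _ ne] by blast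
    have "N x \<inter> X = N x \<inter> (X \<inter> F')" using assms(3) x X sym by blast
    then show False using x deg by fastforce
  qed
qed

lemma mat_insert:
  assumes "mat N M" "v \<in> N u" "u \<notin> \<Union>M" "v \<notin> \<Union>M"
  shows "mat N (insert {u, v} M)"
proof -
  have "f \<inter> {u, v} = {}" if "f \<in> M" for f using assms(3,4) that by blast
  then have dj: "{u, v} \<inter> f = {}" "f \<inter> {u, v} = {}" if "f \<in> M" for f using that by blast+
  show ?thesis
    unfolding mat_def
  proof (intro conjI ballI impI)
    fix e assume "e \<in> insert {u, v} M"
    then consider "e = {u, v}" | "e \<in> M" by blast
    then show "\<exists>u v. e = {u, v} \<and> v \<in> N u"
    proof cases
      case 1
      then show ?thesis using assms(2) by (intro exI conjI)
    next
      case 2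
      obtain p q where "e = {p, q}" "q \<in> N p" using mat_edgeE[OF assms(1) 2] .
      then show ?thesis by (intro exI conjI)
    qed
  next
    fix e f assume "e \<in> insert {u, v} M" "f \<in> insert {u, v} M" "e \<noteq> f"
    then consider "e = {u, v}" "f \<in> M" | "e \<in> M" "f = {u, v}" | "e \<in> M" "f \<in> M" "e \<noteq> f"
      by blast
    then show "e \<inter> f = {}"
      using mat_disjoint[OF assms(1)] dj by cases simp_all
  qed
qed

lemma mat_subset: "mat N M \<Longrightarrow> M' \<subseteq> M \<Longrightarrow> mat N M'"
  by (simp add: mat_def subset_iff)

lemma mat_Union_V:
  assumes "mat N M" shows "\<Union>M \<subseteq> V"
proof
  fix x assume "x \<in> \<Union>M"
  then obtain u v where "v \<in> N u" "x = u \<or> x = v"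
    using mat_vertexE[OF assms] by metis
  then show "x \<in> V" using inV by blast
qed

lemma finite_mat:
  assumes "mat N M" shows "finite M"
proof -
  have "M \<subseteq> Pow V" using mat_Union_V[OF assms] by blast
  then show ?thesis using finV finite_subset by blast
qed

lemma finite_Union_mat: "mat N M \<Longrightarrow> finite (\<Union>M)"
  using mat_Union_V finV finite_subset by blast

lemma mat_edge_nbr:
  assumes "mat N M" "{u, v} \<in> M" shows "v \<in> N u"
proof -
  obtain p q where "{u, v} = {p, q}" "q \<in> N p" using mat_edgeE[OF assms] .
  then consider "u = p" "v = q" | "u = q" "v = p" unfolding doubleton_eq_iff by argo
  then show ?thesis using \<open>q \<in> N p\<close> sym by cases auto
qed

lemma Union_remove_edge:
  assumes "mat N M" "e \<in> M"
  shows "\<Union>(M - {e}) = \<Union>M - e"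
proof -
  have "f \<inter> e = {}" if "f \<in> M" "f \<noteq> e" for f
    using mat_disjoint[OF assms(1) that(1) assms(2) that(2)] .
  then show ?thesis by blast
qed

lemma card_Union_mat:
  assumes "mat N M" shows "card (\<Union>M) = 2 * card M"
proof -
  have "card (\<Union>M) = sum card M"
    using assms by (intro card_Union_disjoint) (auto simp: pairwise_def disjnt_def mat_def)
  also have "\<dots> = (\<Sum>e\<in>M. 2)"
  proof (rule sum.cong)
    fix e assume "e \<in> M"
    then obtain u v where "e = {u, v}" "v \<in> N u" using mat_edgeE[OF assms] by metis
    then show "card e = 2" using neq by simp
  qed simp
  finally show ?thesis by simp
qed

lemma partner:
  assumes "mat N M" "x \<in> \<Union>M"
  obtains y where "{x, y} \<in> M" "y \<in> N x" "y \<in> \<Union>M" "y \<noteq> x"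
proof -
  obtain u v where uv: "{u, v} \<in> M" "v \<in> N u" "x = u \<or> x = v"
    using mat_vertexE[OF assms] .
  have uM: "u \<in> \<Union>M" and vM: "v \<in> \<Union>M" and ne: "u \<noteq> v" using uv(1,2) irrefl by auto
  show thesis
  proof (cases "x = u")
    case True
    then show thesis using that[of v] uv vM ne by simp
  next
    case False
    then show thesis using that[of u] uv uM ne sym by (simp add: insert_commute)
  qed
qed

end

section \<open>Components and edge counts of the forest\<close>

definition fcomp :: "('a \<Rightarrow> 'a set) \<Rightarrow> 'a set \<Rightarrow> 'a \<Rightarrow> 'a set" where
  "fcomp N F x = {y. fconn N F x y}"

text \<open>Each induced edge is counted from both ends, so this is twice the number of edges inside
  \<open>F\<close>.\<close>

definition degsum :: "('a \<Rightarrow> 'a set) \<Rightarrow> 'a set \<Rightarrow> nat" where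
  "degsum N F = (\<Sum>x\<in>F. card (N x \<inter> F))"

context sgraph begin

lemma fcomp_subset: "x \<in> F \<Longrightarrow> fcomp N F x \<subseteq> F"
  by (auto simp: fcomp_def intro: fconn_in)

lemma fcomp_nbr:
  assumes "x \<in> F" "y \<in> fcomp N F x"
  shows "N y \<inter> F \<subseteq> fcomp N F x"
  using assms fcomp_subset[OF assms(1)] unfolding fcomp_def
  by (auto intro: fconn_trans fconn_edge)

lemma fcomp_eq:
  assumes "fconn N F x y" shows "fcomp N F x = fcomp N F y"
  using fconn_trans[OF assms] fconn_trans[OF fconn_sym[OF assms]] by (auto simp: fcomp_def)

lemma sum_over_components:
  fixes g h :: "'a \<Rightarrow> nat"
  assumes "finite F" "\<And>x. x \<in> F \<Longrightarrow> sum g (fcomp N F x) \<le> sum h (fcomp N F x)"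
  shows "sum g F \<le> sum h F"
proof -
  let ?C = "fcomp N F ` F"
  have self: "x \<in> fcomp N F x" for x by (simp add: fcomp_def)
  have U: "\<Union>?C = F"
  proof
    show "\<Union>?C \<subseteq> F" using fcomp_subset by (simp add: UN_least)
    show "F \<subseteq> \<Union>?C" using self by (auto intro!: UN_I)
  qed
  have fin: "\<forall>A\<in>?C. finite A"
    using assms(1) by (auto intro: finite_subset[OF fcomp_subset])
  have eq: "fcomp N F x = fcomp N F z" if "z \<in> fcomp N F x" for x z
    by (rule fcomp_eq) (use that in \<open>simp add: fcomp_def\<close>)
  have "A \<inter> B = {}" if AB: "A \<in> ?C" "B \<in> ?C" "A \<noteq> B" for A B
  proof (rule ccontr)
    assume "A \<inter> B \<noteq> {}"
    then obtain z where z: "z \<in> A" "z \<in> B" by blast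
    obtain x where "A = fcomp N F x" using AB(1) by auto
    moreover obtain y where "B = fcomp N F y" using AB(2) by auto
    ultimately show False using z eq[of z x] eq[of z y] AB(3) by simp
  qed
  then have dj: "\<forall>A\<in>?C. \<forall>B\<in>?C. A \<noteq> B \<longrightarrow> A \<inter> B = {}" by (intro ballI impI)
  have "sum g F = sum (sum g) ?C"
    using sum.Union_disjoint[OF fin dj, of g] U by simp
  also have "\<dots> \<le> sum (sum h) ?C" by (rule sum_mono) (use assms(2) in auto)
  also have "\<dots> = sum h F" using sum.Union_disjoint[OF fin dj, of h] U by simp
  finally show ?thesis .
qed

lemma degsum_insert:
  assumes "finite F" "x \<notin> F"
  shows "degsum N (insert x F) = degsum N F + 2 * card (N x \<inter> F)"
proof -
  have "card (N y \<inter> insert x F) = card (N y \<inter> F) + (if y \<in> N x then 1 else 0)" for y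
  proof (cases "y \<in> N x")
    case True
    then have "N y \<inter> insert x F = insert x (N y \<inter> F)" using sym by auto
    then show ?thesis using True assms by simp
  next
    case False
    then have "N y \<inter> insert x F = N y \<inter> F" using sym by auto
    then show ?thesis using False by simp
  qed
  then have "(\<Sum>y\<in>F. card (N y \<inter> insert x F)) = degsum N F + (\<Sum>y\<in>F. if y \<in> N x then 1 else 0)"
    by (simp add: degsum_def sum.distrib)
  also have "(\<Sum>y\<in>F. if y \<in> N x then 1 else 0) = card (N x \<inter> F)"
    using assms(1) by (simp add: Int_commute flip: sum.inter_restrict)
  finally have 1: "(\<Sum>y\<in>F. card (N y \<inter> insert x F)) = degsum N F + card (N x \<inter> F)" .
  have "N x \<inter> insert x F = N x \<inter> F" using irrefl by auto
  then show ?thesis using assms 1 by (simp add: degsum_def)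
qed

text \<open>A connected set has at least \<open>card T - 1\<close> edges: grow a subset from one
  vertex by always adding an adjacent vertex, which raises \<open>degsum\<close> by at least 2.
  Connectivity is stated as an edge leaving every proper nonempty subset.\<close>

lemma degsum_connected:
  assumes fin: "finite T" and ne: "T \<noteq> {}"
    and con: "\<And>S. S \<subset> T \<Longrightarrow> S \<noteq> {} \<Longrightarrow> \<exists>p\<in>S. \<exists>q\<in>T - S. q \<in> N p"
  shows "2 * card T \<le> degsum N T + 2"
proof -
  have "\<exists>S\<subseteq>T. card S = Suc n \<and> 2 * card S \<le> degsum N S + 2" if "Suc n \<le> card T" for n
    using that
  proof (induction n)
    case 0
    obtain x where "x \<in> T" using ne by blast
    then show ?case by (intro exI[of _ "{x}"]) auto
  next
    case (Suc n)
    then obtain S where S: "S \<subseteq> T" "card S = Suc n" "2 * card S \<le> degsum N S + 2" by auto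
    then have "S \<subset> T" "S \<noteq> {}" using Suc.prems by auto
    then obtain p q where pq: "p \<in> S" "q \<in> T" "q \<notin> S" "q \<in> N p" using con by blast
    have finS: "finite S" using S(1) fin finite_subset by blast
    have "p \<in> N q \<inter> S" using pq sym by blast
    then have "1 \<le> card (N q \<inter> S)" using finS by (metis One_nat_def Suc_leI card_gt_0_iff empty_iff finite_Int)
    then have "2 * card (insert q S) \<le> degsum N (insert q S) + 2"
      using degsum_insert[OF finS pq(3)] S pq finS by simp
    then show ?case using S pq finS by (intro exI[of _ "insert q S"]) auto
  qed
  from this[of "card T - 1"] obtain S where "S \<subseteq> T" "card S = card T" "2 * card S \<le> degsum N S + 2"
    using fin ne by (metis Suc_diff_1 card_gt_0_iff le_refl)
  then show ?thesis using card_subset_eq[OF fin] by metis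
qed

text \<open>This gives the bound on outgoing edges: of at most \<open>3n\<close> edge ends at a
  component with \<open>n\<close> vertices, at least \<open>2n - 2\<close> are inner, so at most
  \<open>n + 2\<close> leave.\<close>

lemma degsum_fcomp:
  assumes fin: "finite F" and x: "x \<in> F"
  shows "2 * card (fcomp N F x) \<le> (\<Sum>y\<in>fcomp N F x. card (N y \<inter> F)) + 2"
proof -
  let ?T = "fcomp N F x"
  have TF: "?T \<subseteq> F" using fcomp_subset[OF x] .
  have xT: "x \<in> ?T" by (simp add: fcomp_def)
  have "\<exists>p\<in>S. \<exists>q\<in>?T - S. q \<in> N p" if S: "S \<subset> ?T" "S \<noteq> {}" for S
  proof (rule ccontr)
    assume no: "\<not> ?thesis"
    obtain s where s: "s \<in> S" using S by blast
    have "z \<in> S" if "fconn N F s z" for z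
      using that unfolding fconn_def
    proof (induction rule: rtrancl_induct)
      case (step y z)
      have "y \<in> ?T" using step.IH S by blast
      then have "z \<in> ?T" using fcomp_nbr[OF x] step.hyps(2) by blast
      then show ?case using no step.IH step.hyps(2) by blast
    qed (rule s)
    moreover have "fcomp N F s = ?T" using fcomp_eq[of F x s] s S by (auto simp: fcomp_def)
    ultimately have "?T \<subseteq> S" by (auto simp: fcomp_def)
    then show False using S by blast
  qed
  then have "2 * card ?T \<le> degsum N ?T + 2"
    using degsum_connected[of ?T] finite_subset[OF TF fin] xT by blast
  also have "degsum N ?T = (\<Sum>y\<in>?T. card (N y \<inter> F))"
    unfolding degsum_def
  proof (rule sum.cong)
    fix y assume "y \<in> ?T"
    then have "N y \<inter> ?T = N y \<inter> F" using fcomp_nbr[OF x] TF by blast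
    then show "card (N y \<inter> ?T) = card (N y \<inter> F)" by simp
  qed simp
  finally show ?thesis .
qed

lemma partner_unique:
  assumes "mat N M" "{x, y} \<in> M" "{x, z} \<in> M" shows "y = z"
proof -
  have "{x, y} = {x, z}" using mat_disjoint[OF assms] by blast
  then show ?thesis unfolding doubleton_eq_iff by argo
qed

lemma card1_eq:
  assumes "card A \<le> 1" "y \<in> A" "finite A" shows "A = {y}"
  using assms card_le_Suc0_iff_eq[of A] by auto

text \<open>A leaf of the component is matched to its only neighbour, so no vertex of the set
  \<open>S\<close> of non-leaves has two leaf neighbours. Hence a vertex \<open>v\<close> with at
  most one neighbour in \<open>S\<close> has inner degree exactly 2, and one of its two neighbours
  is a leaf \<open>u\<close> matched to it. Two such \<open>v\<close> exist by
  \<open>two_leaves\<close>.\<close>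

lemma end_pairs:
  assumes m: "mat N M" and F: "F = \<Union>M" and ac: "acyc N F" and x: "x \<in> F"
    and big: "w \<in> fcomp N F x" "2 \<le> card (N w \<inter> F)"
  obtains u v u' v' where "{u, v} \<in> M" "{u', v'} \<in> M" "{u, v, u', v'} \<subseteq> fcomp N F x"
    "v \<noteq> v'" "u \<noteq> u'" "u \<noteq> v'" "v \<noteq> u'" "N u \<inter> F = {v}" "N u' \<inter> F = {v'}"
    "card (N v \<inter> F) = 2" "card (N v' \<inter> F) = 2"
proof -
  have fin: "finite F" using finite_Union_mat[OF m] F by simp
  let ?T = "fcomp N F x"
  have TF: "?T \<subseteq> F" using fcomp_subset[OF x] .
  define S where "S = {y \<in> ?T. 2 \<le> card (N y \<inter> F)}"
  have wS: "w \<in> S" using big by (simp add: S_def)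
  have SF: "S \<subseteq> F" using TF by (auto simp: S_def)
  have leaf: "N y \<inter> F = {v} \<and> {y, v} \<in> M"
    if y: "y \<in> ?T - S" "v \<in> N y" "v \<in> F" for y v
  proof -
    have le: "card (N y \<inter> F) \<le> 1" using y by (auto simp: S_def)
    obtain z where z: "{y, z} \<in> M" "z \<in> N y" "z \<in> \<Union>M" "z \<noteq> y"
      using partner[OF m, of y] y(1) TF F by blast
    have "N y \<inter> F = {v}" "N y \<inter> F = {z}" using card1_eq[OF le] y z F by auto
    then show ?thesis using z by auto
  qed
  have outer: "card (N v \<inter> (?T - S)) \<le> 1" if "v \<in> S" for v
  proof (cases "N v \<inter> (?T - S) = {}")
    case False
    then obtain y where y: "y \<in> N v" "y \<in> ?T - S" by blast
    have "N v \<inter> (?T - S) \<subseteq> {y}"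
    proof
      fix z assume z: "z \<in> N v \<inter> (?T - S)"
      have vF: "v \<in> F" using that SF by blast
      have "{y, v} \<in> M" "{z, v} \<in> M" using leaf[of y v] leaf[of z v] y z sym vF by blast+
      then have "{v, y} \<in> M" "{v, z} \<in> M" by (simp_all add: insert_commute)
      then show "z \<in> {y}" using partner_unique[OF m] by blast
    qed
    then show ?thesis by (rule card_le_1_subset)
  qed simp
  have split: "card (N v \<inter> F) = card (N v \<inter> S) + card (N v \<inter> (?T - S))" if "v \<in> S" for v
  proof -
    have "N v \<inter> F = (N v \<inter> S) \<union> (N v \<inter> (?T - S))"
      using fcomp_nbr[OF x, of v] that TF by (auto simp: S_def)
    moreover have "(N v \<inter> S) \<inter> (N v \<inter> (?T - S)) = {}" by blast
    ultimately show ?thesis by (metis card_Un_disjoint finN finite_Int)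
  qed
  \<comment> \<open>A unique non-leaf would have only leaf neighbours, hence at most one neighbour
    in \<open>F\<close>.\<close>
  have "card S \<noteq> 1"
  proof
    assume "card S = 1"
    then have "S = {w}" using wS by (auto simp: card_1_singleton_iff)
    then have "N w \<inter> S = {}" using irrefl by auto
    then show False using split[OF wS] outer[OF wS] big by simp
  qed
  moreover have fS: "finite S" using SF fin finite_subset by blast
  moreover have "card S \<noteq> 0" using wS fS by auto
  ultimately have "2 \<le> card S" by linarith
  then obtain v v' where v: "v \<in> S" "v' \<in> S" "v \<noteq> v'" "card (N v \<inter> S) \<le> 1" "card (N v' \<inter> S) \<le> 1"
    using two_leaves[OF acyc_mono[OF ac SF] fS] by blast
  have ends: "card (N v \<inter> F) = 2 \<and> (\<exists>u. u \<in> ?T - S \<and> {u, v} \<in> M \<and> N u \<inter> F = {v})"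
    if v: "v \<in> S" "card (N v \<inter> S) \<le> 1" for v
  proof -
    have "2 \<le> card (N v \<inter> F)" using v by (auto simp: S_def)
    then have *: "card (N v \<inter> F) = 2" "card (N v \<inter> (?T - S)) = 1"
      using split[OF v(1)] outer[OF v(1)] v(2) by linarith+
    then obtain u where "N v \<inter> (?T - S) = {u}" by (auto simp: card_1_singleton_iff)
    then have u: "u \<in> ?T - S" "v \<in> N u" using sym by blast+
    then show ?thesis using leaf[OF u] * v SF by blast
  qed
  obtain u where u: "u \<in> ?T - S" "{u, v} \<in> M" "N u \<inter> F = {v}"
    using ends[OF v(1) v(4)] by (elim conjE exE)
  obtain u' where u': "u' \<in> ?T - S" "{u', v'} \<in> M" "N u' \<inter> F = {v'}"
    using ends[OF v(2) v(5)] by (elim conjE exE)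
  show thesis
  proof (rule that[of u v u' v'])
    show "{u, v, u', v'} \<subseteq> ?T" using u u' v by (auto simp: S_def)
    show "u \<noteq> u'" using u(3) u'(3) v(3) by auto
    show "u \<noteq> v'" using u(1) v(2) by auto
    show "v \<noteq> u'" using u'(1) v(1) by auto
    show "card (N v \<inter> F) = 2" "card (N v' \<inter> F) = 2"
      using ends[OF v(1) v(4)] ends[OF v(2) v(5)] by simp_all
  qed (fact u(2) u'(2) v(3) u(3) u'(3))+
qed

end

subsection \<open>Extremal acyclic matchings\<close>

definition deg_total :: "('a \<Rightarrow> 'a set) \<Rightarrow> 'a set \<Rightarrow> nat" where
  "deg_total N F = (\<Sum>x\<in>F. card (N x))"

definition in_triangle :: "('a \<Rightarrow> 'a set) \<Rightarrow> 'a set \<Rightarrow> bool" where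
  "in_triangle N e \<longleftrightarrow> (\<exists>w. \<forall>x\<in>e. w \<in> N x)"

text \<open>
  Among the maximum acyclic matchings one minimises lexicographically the degrees in \<open>G\<close> of the
  matched vertices, the number of edges they induce, and the number of matching edges in triangles.
\<close>

locale extremal = sgraph +
  fixes M :: "'a set set" and F :: "'a set"
  defines F_def: "F \<equiv> \<Union>M"
  assumes deg3: "card (N x) \<le> 3"
    and nonisolated: "x \<in> V \<Longrightarrow> N x \<noteq> {}"
    and noK23: "x \<noteq> y \<Longrightarrow> card (N x \<inter> N y) \<le> 2"
    and mM: "mat N M" and acF: "acyc N F"
    and maximum: "mat N M' \<Longrightarrow> acyc N (\<Union>M') \<Longrightarrow> card M' \<le> card M"
    and optimal: "mat N M' \<Longrightarrow> acyc N (\<Union>M') \<Longrightarrow> card M' = card M \<Longrightarrow>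
      ((deg_total N (\<Union>M'), degsum N (\<Union>M'), card {e \<in> M'. in_triangle N e}),
       (deg_total N (\<Union>M), degsum N (\<Union>M), card {e \<in> M. in_triangle N e}))
      \<notin> less_than <*lex*> less_than <*lex*> less_than"
begin

lemma finF [simp]: "finite F"
  using finite_Union_mat[OF mM] by (simp add: F_def)

lemma FV: "F \<subseteq> V"
  using mat_Union_V[OF mM] by (simp add: F_def)

lemma edgeF: "{u, v} \<in> M \<Longrightarrow> u \<in> F \<and> v \<in> F \<and> v \<in> N u \<and> u \<in> N v"
  using mat_edge_nbr[OF mM] sym by (auto simp: F_def)

lemma Union_swap:
  assumes "e \<in> M" shows "\<Union>(insert {p, q} (M - {e})) = (F - e) \<union> {p, q}"
  using Union_remove_edge[OF mM assms] by (auto simp: F_def)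

lemma mat_swap:
  assumes e: "e \<in> M" and pq: "q \<in> N p" "p \<notin> F - e" "q \<notin> F - e"
  shows "mat N (insert {p, q} (M - {e}))" "card (insert {p, q} (M - {e})) = card M"
proof -
  have U: "\<Union>(M - {e}) = F - e" using Union_remove_edge[OF mM e] by (simp add: F_def)
  show "mat N (insert {p, q} (M - {e}))"
    using mat_insert[OF mat_subset[OF mM, of "M - {e}"] pq(1)] pq(2,3) U by simp
  have fin: "finite (M - {e})" using finite_mat[OF mM] by simp
  have "{p, q} \<notin> M - {e}" using pq(2) U by blast
  then have "card (insert {p, q} (M - {e})) = Suc (card (M - {e}))" using fin by simp
  also have "\<dots> = card M" using e finite_mat[OF mM] by (metis card.remove)
  finally show "card (insert {p, q} (M - {e})) = card M" .
qed

text \<open>Trading \<open>e\<close> for \<open>pq\<close> and \<open>rs\<close> would enlarge a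
  maximum matching. The new edges may reuse the ends of \<open>e\<close>, so only
  \<open>F - e\<close> has to be avoided.\<close>

lemma no_augment:
  assumes e: "e \<in> M" and pq: "q \<in> N p" "p \<notin> F - e" "q \<notin> F - e"
    and rs: "s \<in> N r" "r \<notin> F - e" "s \<notin> F - e" and dj: "{p, q} \<inter> {r, s} = {}"
  shows "\<not> acyc N ((F - e) \<union> {p, q, r, s})"
proof
  assume ac: "acyc N ((F - e) \<union> {p, q, r, s})"
  let ?M = "insert {p, q} (M - {e})"
  have U: "\<Union>?M = (F - e) \<union> {p, q}" using Union_swap[OF e] .
  have rsU: "r \<notin> \<Union>?M" "s \<notin> \<Union>?M" using rs dj unfolding U by auto
  have m: "mat N (insert {r, s} ?M)"
    using mat_insert[OF mat_swap(1)[OF e pq] rs(1) rsU] .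
  have "\<Union>(insert {r, s} ?M) = (F - e) \<union> {p, q, r, s}" using U by auto
  then have "card (insert {r, s} ?M) \<le> card M" using maximum[OF m] ac by simp
  moreover have "{r, s} \<notin> ?M" using rsU by blast
  moreover have "finite ?M" using finite_mat[OF mM] by simp
  ultimately show False using mat_swap(2)[OF e pq] by simp
qed

lemma no_extension:
  assumes pq: "q \<in> N p" "p \<notin> F" "q \<notin> F"
  shows "\<not> acyc N (insert p (insert q F))"
proof
  assume ac: "acyc N (insert p (insert q F))"
  have m: "mat N (insert {p, q} M)" using mat_insert[OF mM pq(1)] pq by (simp add: F_def)
  have "\<Union>(insert {p, q} M) = insert p (insert q F)" by (auto simp: F_def)
  then have "card (insert {p, q} M) \<le> card M" using maximum[OF m] ac by simp
  moreover have "{p, q} \<notin> M" using pq by (auto simp: F_def)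
  ultimately show False using finite_mat[OF mM] by simp
qed

context
  fixes u v p q
  assumes uv: "{u, v} \<in> M" and pq: "q \<in> N p" "p \<notin> F - {u, v}" "q \<notin> F - {u, v}"
    and ac: "acyc N ((F - {u, v}) \<union> {p, q})"
begin

private abbreviation "F' \<equiv> (F - {u, v}) \<union> {p, q}"

lemma swap_lex:
  "((deg_total N F', degsum N F', card {e \<in> insert {p, q} (M - {{u, v}}). in_triangle N e}),
       (deg_total N F, degsum N F, card {e \<in> M. in_triangle N e}))
      \<notin> less_than <*lex*> less_than <*lex*> less_than"
  using optimal[OF mat_swap(1)[OF uv pq] _ mat_swap(2)[OF uv pq]] ac
  unfolding Union_swap[OF uv] by (simp add: F_def)

lemma deg_total_swap:
  "deg_total N F' + card (N u) + card (N v) = deg_total N F + card (N p) + card (N q)"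
proof -
  have ne: "u \<noteq> v" "p \<noteq> q" and uvF: "u \<in> F" "v \<in> F" using edgeF[OF uv] neq pq(1) by blast+
  have "F = (F - {u, v}) \<union> {u, v}" using uvF by auto
  then have "deg_total N F = deg_total N (F - {u, v}) + deg_total N {u, v}"
    unfolding deg_total_def by (subst sum.union_disjoint[symmetric]) auto
  moreover have "deg_total N F' = deg_total N (F - {u, v}) + deg_total N {p, q}"
    unfolding deg_total_def using pq by (subst sum.union_disjoint) auto
  ultimately show ?thesis using ne by (simp add: deg_total_def)
qed

text \<open>This lemma, \<open>swap_edges\<close> and \<open>swap_triangle\<close> read off the
  three criteria of the lexicographic order for the trade of \<open>uv\<close> for
  \<open>pq\<close>; each later one applies when the earlier criteria do not increase.\<close>

lemma swap_deg: "card (N u) + card (N v) \<le> card (N p) + card (N q)"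
  using swap_lex deg_total_swap by (auto simp: in_lex_prod)

lemma swap_edges:
  assumes "card (N p) + card (N q) \<le> card (N u) + card (N v)"
  shows "degsum N F \<le> degsum N F'"
  using swap_lex deg_total_swap swap_deg assms by (auto simp: in_lex_prod)

lemma swap_triangle:
  assumes "card (N p) + card (N q) \<le> card (N u) + card (N v)" "degsum N F' \<le> degsum N F"
    and "N u \<inter> N v \<noteq> {}"
  shows "N p \<inter> N q \<noteq> {}"
proof
  assume no: "N p \<inter> N q = {}"
  have "{e \<in> insert {p, q} (M - {{u, v}}). in_triangle N e} \<subseteq> {e \<in> M. in_triangle N e} - {{u, v}}"
    using no by (auto simp: in_triangle_def)
  then have "card {e \<in> insert {p, q} (M - {{u, v}}). in_triangle N e}
      \<le> card ({e \<in> M. in_triangle N e} - {{u, v}})"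
    using finite_mat[OF mM] by (intro card_mono) auto
  also have "\<dots> < card {e \<in> M. in_triangle N e}"
    using finite_mat[OF mM] uv assms(3) by (intro card_Diff1_less) (auto simp: in_triangle_def)
  finally show False
    using swap_lex deg_total_swap swap_deg swap_edges assms by (auto simp: in_lex_prod)
qed

end

end

subsection \<open>Discharging\<close>

context extremal begin

definition free :: "'a \<Rightarrow> bool" where
  "free x \<longleftrightarrow> x \<in> V \<and> x \<notin> F \<and> N x \<inter> F = {}"

text \<open>Two neighbours of \<open>r\<close> lie in the same forest component, so inserting
  \<open>r\<close> into the forest would close a cycle.\<close>

definition dbl :: "'a \<Rightarrow> bool" where
  "dbl r \<longleftrightarrow> (\<exists>y\<in>N r \<inter> F. \<exists>z\<in>N r \<inter> F. y \<noteq> z \<and> fconn N F y z)"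

definition paired :: "'a \<Rightarrow> bool" where
  "paired r \<longleftrightarrow> (\<exists>x\<in>N r. free x)"

text \<open>
  A vertex \<open>r\<close> outside \<open>F\<close> has to collect \<open>6\<close> units from its neighbours in \<open>F\<close>; a
  \<open>paired\<close> vertex collects in addition for its \<open>free\<close> neighbour. Each component of the forest
  on \<open>F\<close> should pay at most \<open>6\<close> units per vertex; a component with \<open>n\<close> vertices sends up to
  \<open>n + 2\<close> edges out of \<open>F\<close>, so it has to save \<open>12\<close> units on them.
\<close>

definition wt :: "'a \<Rightarrow> 'a \<Rightarrow> nat" where
  "wt f r = (if card (N r \<inter> F) = 1 then 6
     else if paired r then (if \<exists>x\<in>N r. free x \<and> card (N x) = 3 then 4 else 6)
     else if \<exists>p q. N r \<inter> F = {f, p, q} \<and> p \<noteq> q \<and> p \<noteq> f \<and> q \<noteq> f \<and> fconn N F p q \<and> \<not> fconn N F f p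
       then 0 else 3)"

definition out :: "'a \<Rightarrow> nat" where
  "out f = (\<Sum>r\<in>N f - F. wt f r)"

lemma acyc_insert_not_dbl: "r \<notin> F \<Longrightarrow> \<not> dbl r \<Longrightarrow> acyc N (insert r F)"
  using acyc_insert[OF acF finF, of r] by (auto simp: dbl_def)

lemma nbrs3:
  assumes "{a, b, c} \<subseteq> N x" "a \<noteq> b" "a \<noteq> c" "b \<noteq> c"
  shows "N x = {a, b, c}"
proof -
  have "card {a, b, c} = 3" using assms by simp
  then show ?thesis using card_seteq[OF finN assms(1)] deg3[of x] by simp
qed

lemma nbrs3E:
  assumes "card (N x) = 3" "a \<in> N x"
  obtains b c where "N x = {a, b, c}" "a \<noteq> b" "a \<noteq> c" "b \<noteq> c"
proof -
  have "card (N x - {a}) = 2" using assms by simp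
  then obtain b c where bc: "N x - {a} = {b, c}" "b \<noteq> c" by (meson card_2_iff)
  then have "N x = {a, b, c}" using assms(2) by blast
  then show thesis using that bc by blast
qed

lemma K23_contra:
  assumes "{a, b, c} \<subseteq> N x" "{a, b, c} \<subseteq> N y" "a \<noteq> b" "a \<noteq> c" "b \<noteq> c" "x \<noteq> y"
  shows False
proof -
  have "card {a, b, c} \<le> card (N x \<inter> N y)" using assms by (intro card_mono) auto
  then show False using noK23[OF assms(6)] assms by simp
qed

text \<open>If inserting \<open>y\<close> closed no cycle, then \<open>x\<close> could be added as a
  leaf at \<open>y\<close>, and the edge \<open>xy\<close> would extend the matching.\<close>

lemma free_nbr_dbl:
  assumes x: "free x" and y: "y \<in> N x"
  shows "y \<notin> F" "dbl y"
proof -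
  show yF: "y \<notin> F" using x y by (auto simp: free_def)
  show "dbl y"
  proof (rule ccontr)
    assume "\<not> dbl y"
    then have "acyc N (insert y F)" using acyc_insert_not_dbl yF by simp
    moreover have "N x \<inter> insert y F \<subseteq> {y}" using x by (auto simp: free_def)
    ultimately have "acyc N (insert x (insert y F))" by (rule acyc_insert_leaf')
    then show False using no_extension[OF y] x yF by (simp add: free_def)
  qed
qed

text \<open>The free neighbour and the two connected neighbours provided by \<open>dbl\<close> use
  up the three places at \<open>r\<close>, so \<open>f\<close> is one of the latter two.\<close>

lemma pairedE:
  assumes r: "paired r" and f: "f \<in> N r" "f \<in> F"
  obtains x g where "free x" "x \<noteq> f" "x \<noteq> g" "f \<noteq> g" "N r = {x, f, g}" "r \<notin> F" "g \<in> F" "fconn N F f g"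
proof -
  obtain x where x: "x \<in> N r" "free x" using r by (auto simp: paired_def)
  have xF: "x \<notin> F" "r \<notin> F" "dbl r"
    using x free_nbr_dbl[OF x(2) sym[OF x(1)]] by (auto simp: free_def)
  then obtain y z where yz: "y \<in> N r" "y \<in> F" "z \<in> N r" "z \<in> F" "y \<noteq> z" "fconn N F y z"
    by (auto simp: dbl_def)
  have N: "N r = {x, y, z}" using yz x xF by (intro nbrs3) auto
  have ne: "x \<noteq> y" "x \<noteq> z" using xF(1) yz(2,4) by auto
  have "f = y \<or> f = z" using f N xF(1) by auto
  then show thesis
  proof
    assume "f = y"
    then show thesis using that[OF x(2) _ _ _ _ xF(2)] ne yz(4,5,6) N by simp
  next
    assume "f = z"
    then show thesis
      using that[OF x(2) _ _ _ _ xF(2), of y] ne yz(2,5) fconn_sym[OF yz(6)] N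
      by (simp add: insert_commute)
  qed
qed

lemma wt_le: "wt f r \<le> 6"
  by (simp add: wt_def)

lemma wt_le3: "card (N r \<inter> F) \<noteq> 1 \<Longrightarrow> \<not> paired r \<Longrightarrow> wt f r \<le> 3"
  by (simp add: wt_def)

lemma one_nbr:
  assumes "card (N r \<inter> F) = 1" "f \<in> N r" "f \<in> F" shows "N r \<inter> F = {f}"
  using card1_eq[of "N r \<inter> F" f] assms by simp

lemma one_nbr_not_paired:
  assumes "card (N r \<inter> F) = 1" shows "\<not> paired r"
proof
  assume p: "paired r"
  obtain f where f: "N r \<inter> F = {f}" using assms by (auto simp: card_1_singleton_iff)
  then have "f \<in> N r" "f \<in> F" by auto
  then show False
  proof (rule pairedE[OF p])
    fix x g assume "f \<noteq> g" "N r = {x, f, g}" "g \<in> F"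
    then show False using f by auto
  qed
qed

text \<open>Weight \<open>0\<close> is the case that the two other neighbours of \<open>r\<close> already close a cycle.\<close>

lemma wt_dbl:
  assumes r: "f \<in> N r" "f \<in> F" "r \<notin> F" "\<not> paired r" and d: "dbl r"
    and nf: "\<And>g. g \<in> N r \<inter> F \<Longrightarrow> fconn N F f g \<Longrightarrow> g = f"
  shows "wt f r = 0"
proof -
  obtain y z where yz: "y \<in> N r" "y \<in> F" "z \<in> N r" "z \<in> F" "y \<noteq> z" "fconn N F y z"
    using d by (auto simp: dbl_def)
  have ne: "y \<noteq> f" "z \<noteq> f" using nf[of y] nf[of z] yz fconn_sym by blast+
  have N: "N r = {f, y, z}" using ne yz r by (intro nbrs3) auto
  then have NF: "N r \<inter> F = {f, y, z}" using yz r by auto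
  have "\<not> fconn N F f y" using nf[of y] yz ne by blast
  then have "\<exists>p q. N r \<inter> F = {f, p, q} \<and> p \<noteq> q \<and> p \<noteq> f \<and> q \<noteq> f \<and> fconn N F p q \<and> \<not> fconn N F f p"
    using NF yz ne by (intro exI[of _ y] exI[of _ z]) simp
  moreover have "card (N r \<inter> F) \<noteq> 1" using NF yz ne by simp
  ultimately show ?thesis using r(4) by (simp add: wt_def)
qed

lemma out_le:
  assumes "f \<in> F" shows "out f + 6 * card (N f \<inter> F) \<le> 18"
proof -
  have "out f \<le> (\<Sum>r\<in>N f - F. 6)" unfolding out_def by (rule sum_mono) (rule wt_le)
  then have "out f \<le> 6 * card (N f - F)" by simp
  moreover have "card (N f - F) + card (N f \<inter> F) = card (N f)"
    using card_Diff_subset_Int[of "N f" F] card_mono[of "N f" "N f \<inter> F"] by simp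
  ultimately show ?thesis using deg3[of f] by linarith
qed

text \<open>The edge \<open>uv\<close> is replaced by \<open>ua\<close> and \<open>vc\<close>.\<close>

lemma exchange:
  assumes uv: "{u, v} \<in> M" and a: "a \<in> N u" "a \<notin> F" and c: "c \<in> N v" "c \<notin> F" and "a \<noteq> c"
    and a1: "card (N a \<inter> F) = 1" and cd: "\<not> dbl c"
  shows "c \<in> N a"
proof (rule ccontr)
  assume ca: "c \<notin> N a"
  have uF: "u \<in> F" "v \<in> F" "v \<in> N u" using edgeF[OF uv] by auto
  have ne: "u \<noteq> v" "u \<noteq> c" "a \<noteq> v" using uF a c neq by blast+
  have "N a \<inter> F = {u}" using one_nbr[OF a1 sym[OF a(1)] uF(1)] .
  then have "N a \<inter> insert c F \<subseteq> {u}" using ca by auto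
  then have "acyc N (insert a (insert c F))"
    using acyc_insert_leaf'[OF acyc_insert_not_dbl[OF c(2) cd]] by blast
  moreover have "(F - {u, v}) \<union> {u, a, v, c} = insert a (insert c F)" using uF by auto
  moreover have "\<not> acyc N ((F - {u, v}) \<union> {u, a, v, c})"
    using uF a c ne \<open>a \<noteq> c\<close> by (intro no_augment[OF uv]) auto
  ultimately show False by simp
qed

lemma out_deficit:
  assumes "{u, v} \<in> M" "card (N u \<inter> F) + card (N v \<inter> F) = k"
  shows "out u + out v + 6 * k \<le> 6 * (card (N u) + card (N v))"
proof -
  have "out f + 6 * card (N f \<inter> F) \<le> 6 * card (N f)" for f
  proof -
    have "out f \<le> (\<Sum>r\<in>N f - F. 6)" unfolding out_def by (rule sum_mono) (rule wt_le)
    moreover have "card (N f - F) + card (N f \<inter> F) = card (N f)"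
      using card_Diff_subset_Int[of "N f" F] card_mono[of "N f" "N f \<inter> F"] by simp
    ultimately show ?thesis by simp
  qed
  from this[of u] this[of v] show ?thesis using assms(2) by simp
qed

text \<open>Once \<open>u\<close> is gone, \<open>a\<close> has at most one forest neighbour left,
  and the free vertex \<open>x\<close> hangs on \<open>a\<close> as a leaf.\<close>

lemma paired_swap_acyc:
  assumes uv: "{u, v} \<in> M" and a: "a \<in> N u" "paired a" and x: "x \<in> N a" "free x"
  shows "acyc N ((F - {u, v}) \<union> {a, x})"
proof -
  have uF: "u \<in> F" using edgeF[OF uv] by auto
  obtain y g where N: "free y" "N a = {y, u, g}" "a \<notin> F" "g \<in> F"
    using pairedE[OF a(2) sym[OF a(1)] uF] by metis
  then have yF: "y \<notin> F" by (simp add: free_def)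
  have xy: "x = y" using N x uF by (auto simp: free_def)
  have "N a \<inter> (F - {u, v}) \<subseteq> {g}" using N yF by auto
  then have 1: "acyc N (insert a (F - {u, v}))"
    using acyc_insert_leaf'[OF acyc_mono[OF acF, of "F - {u, v}"]] by blast
  have "N x \<inter> insert a (F - {u, v}) \<subseteq> {a}" using x by (auto simp: free_def)
  from acyc_insert_leaf'[OF 1 this] show ?thesis by (simp add: insert_commute)
qed

text \<open>The trade of \<open>uv\<close> for \<open>ax\<close>, with \<open>x\<close> a free
  neighbour of \<open>a\<close>, cannot lower the total degree. So \<open>x\<close> has degree 3,
  the case in which a paired vertex asks each payer only for 4.\<close>

lemma wt_paired_le4:
  assumes uv: "{u, v} \<in> M" and d: "card (N u) = 3" "card (N v) = 3"
    and a: "a \<in> N u" "paired a"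
  shows "wt u a \<le> 4"
proof -
  obtain x where x: "x \<in> N a" "free x" using a(2) by (auto simp: paired_def)
  have xF: "x \<notin> F" "a \<notin> F" using free_nbr_dbl(1)[OF x(2) sym[OF x(1)]] x(2) by (auto simp: free_def)
  have "card (N u) + card (N v) \<le> card (N a) + card (N x)"
    using swap_deg[OF uv x(1) _ _ paired_swap_acyc[OF uv a x]] xF by blast
  then have "card (N x) = 3" using deg3[of a] deg3[of x] d by linarith
  then show ?thesis using x a(2) one_nbr_not_paired[of a] unfolding wt_def by auto
qed

end

section \<open>Pendant pairs at the ends of a forest component\<close>

context extremal begin

lemma degsum_remove:
  assumes "v \<in> F" shows "degsum N F = degsum N (F - {v}) + 2 * card (N v \<inter> (F - {v}))"
  using degsum_insert[of "F - {v}" v] assms by (simp add: insert_absorb)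

text \<open>Otherwise trading \<open>uv\<close> for \<open>ua\<close> replaces \<open>v\<close>,
  which has two inner edges, by \<open>a\<close>, which has one. The degrees do not rise because
  \<open>v\<close> already has degree 3, so the second criterion would decrease.\<close>

lemma end_nbr_not_single:
  assumes uv: "{u, v} \<in> M" "card (N v \<inter> F) = 2" and d: "card (N v) = 3"
    and a: "a \<in> N u" "a \<notin> F"
  shows "card (N a \<inter> F) \<noteq> 1"
proof
  assume 1: "card (N a \<inter> F) = 1"
  have uF: "u \<in> F" "v \<in> F" "u \<noteq> v" using edgeF[OF uv(1)] neq by auto
  have Na: "N a \<inter> F = {u}" using one_nbr[OF 1 sym[OF a(1)] uF(1)] .
  have eq: "(F - {u, v}) \<union> {u, a} = insert a (F - {v})" using uF by auto
  have "N a \<inter> (F - {v}) = {u}" using Na uF by blast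
  then have ds: "degsum N (insert a (F - {v})) = degsum N (F - {v}) + 2"
    using degsum_insert[of "F - {v}" a] a by simp
  have "acyc N (insert a (F - {v}))"
    by (rule acyc_insert_leaf'[OF acyc_mono[OF acF], where y = u]) (use Na in auto)
  then have "degsum N F \<le> degsum N (insert a (F - {v}))"
    using swap_edges[OF uv(1) a(1)] a deg3[of a] d eq by simp
  moreover have "N v \<inter> (F - {v}) = N v \<inter> F" using irrefl by auto
  ultimately show False using ds degsum_remove[OF uF(2)] uv(2) by simp
qed

text \<open>Otherwise trade \<open>uv\<close> for \<open>ax\<close> with \<open>x\<close> the free
  neighbour. Since \<open>N a = {x, u, v}\<close>, the edge \<open>ax\<close> is a component of its
  own in the new forest and adds one induced edge, whereas deleting \<open>v\<close> alone removes
  two.\<close>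

lemma end_shared_not_paired:
  assumes uv: "{u, v} \<in> M" "card (N v \<inter> F) = 2" and d: "card (N u) = 3" "card (N v) = 3"
    and a: "a \<in> N u" "a \<in> N v"
  shows "\<not> paired a"
proof
  assume p: "paired a"
  have uF: "u \<in> F" "v \<in> F" "u \<noteq> v" "v \<in> N u" using edgeF[OF uv(1)] neq by auto
  obtain x g where x: "free x" "N a = {x, u, g}" "a \<notin> F"
    using pairedE[OF p sym[OF a(1)] uF(1)] by metis
  have xF: "x \<notin> F" "x \<in> N a" using x by (auto simp: free_def)
  then have Na: "N a = {x, u, v}" using x sym[OF a(2)] uF by auto
  have ac: "acyc N ((F - {u, v}) \<union> {a, x})" using paired_swap_acyc[OF uv(1) a(1) p xF(2) x(1)] .
  have "card (N a) + card (N x) \<le> card (N u) + card (N v)" using d deg3[of a] deg3[of x] by simp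
  then have le: "degsum N F \<le> degsum N ((F - {u, v}) \<union> {a, x})"
    using swap_edges[OF uv(1) xF(2) _ _ ac] xF x(3) by blast
  have e: "(F - {u, v}) \<union> {a, x} = insert x (insert a (F - {u, v}))" by auto
  have "N a \<inter> (F - {u, v}) = {}" using Na xF by auto
  then have 1: "degsum N (insert a (F - {u, v})) = degsum N (F - {u, v})"
    using degsum_insert[of "F - {u, v}" a] x(3) by simp
  have "N x \<inter> insert a (F - {u, v}) = {a}" using x(1) sym[OF xF(2)] by (auto simp: free_def)
  then have "degsum N (insert x (insert a (F - {u, v}))) = degsum N (F - {u, v}) + 2"
    using degsum_insert[of "insert a (F - {u, v})" x] xF(1) neq[OF xF(2)] 1 by simp
  moreover have iu: "insert u (F - {u, v}) = F - {v}" using uF by auto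
  have "degsum N (F - {u, v}) \<le> degsum N (insert u (F - {u, v}))"
    using degsum_insert[of "F - {u, v}" u] by simp
  then have "degsum N (F - {u, v}) \<le> degsum N (F - {v})" unfolding iu .
  moreover have "N v \<inter> (F - {v}) = N v \<inter> F" using irrefl by auto
  ultimately show False using le e degsum_remove[OF uF(2)] uv(2) by simp
qed

text \<open>Otherwise \<open>uv\<close> could be traded for the two edges \<open>ax\<close> and
  \<open>vc\<close>, with \<open>x\<close> the free neighbour of \<open>a\<close>: after the removal
  of \<open>u\<close>, the vertices \<open>a\<close>, \<open>x\<close> and \<open>c\<close> are
  attached one by one as leaves at \<open>g\<close>, \<open>a\<close> and \<open>v\<close>.\<close>

lemma end_paired_other:
  assumes uv: "{u, v} \<in> M" and a: "a \<in> N u" "paired a" "a \<notin> N v"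
    and c: "c \<in> N v" "c \<notin> F" "c \<noteq> a"
  shows "card (N c \<inter> F) \<noteq> 1"
proof
  assume 1: "card (N c \<inter> F) = 1"
  have uF: "u \<in> F" "v \<in> F" "u \<noteq> v" "v \<in> N u" using edgeF[OF uv] neq by auto
  obtain x g where x: "free x" "N a = {x, u, g}" "a \<notin> F" "g \<in> F"
    using pairedE[OF a(2) sym[OF a(1)] uF(1)] by metis
  have xF: "x \<notin> F" "N x \<inter> F = {}" "x \<in> N a" using x by (auto simp: free_def)
  have Nc: "N c \<inter> F = {v}" using one_nbr[OF 1 sym[OF c(1)] uF(2)] .
  have cx: "c \<noteq> x" using xF(2) Nc by auto
  have xc: "x \<notin> N c" using one_nbr_not_paired[OF 1] x(1) by (auto simp: paired_def)
  have "c \<notin> N a" using x c uF cx by auto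
  then have ac: "a \<notin> N c" using sym by blast
  have s1: "N a \<inter> (F - {u}) \<subseteq> {g}" using x xF by auto
  have s2: "N x \<inter> insert a (F - {u}) \<subseteq> {a}" using xF by auto
  have s3: "N c \<inter> insert x (insert a (F - {u})) \<subseteq> {v}" using Nc xc ac by auto
  have "acyc N (insert c (insert x (insert a (F - {u}))))"
    by (intro acyc_insert_leaf'[OF _ s3] acyc_insert_leaf'[OF _ s2] acyc_insert_leaf'[OF _ s1]
        acyc_mono[OF acF]) auto
  moreover have "(F - {u, v}) \<union> {a, x, v, c} = insert c (insert x (insert a (F - {u})))"
    using uF by auto
  moreover have "\<not> acyc N ((F - {u, v}) \<union> {a, x, v, c})"
    using uF x xF c cx by (intro no_augment[OF uv]) auto
  ultimately show False by simp
qed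

text \<open>
  A component with more than two vertices has two disjoint such pendant pairs, and each of them
  saves \<open>6\<close> of the \<open>18\<close> units that its three outgoing edges could cost.
\<close>

lemma end_pair_out:
  assumes uv: "{u, v} \<in> M" and Nu: "N u \<inter> F = {v}" and Nv: "card (N v \<inter> F) = 2"
  shows "out u + out v \<le> 12"
proof (cases "card (N u) + card (N v) \<le> 5")
  case True
  \<comment> \<open>Three of at most five edge ends are inner, so at most two edges leave the
    pair.\<close>
  then show ?thesis using out_deficit[OF uv, of 3] Nu Nv by simp
next
  case False
  then have d: "card (N u) = 3" "card (N v) = 3" using deg3[of u] deg3[of v] by linarith+
  have uF: "u \<in> F" "v \<in> F" "v \<in> N u" "u \<in> N v" using edgeF[OF uv] by auto
  obtain a b where Nu': "N u = {v, a, b}" "v \<noteq> a" "v \<noteq> b" "a \<noteq> b" using nbrs3E[OF d(1) uF(3)] .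
  have abF: "a \<notin> F" "b \<notin> F" using Nu Nu' by auto
  have "card (N v - F) = 1"
    using d(2) Nv card_Diff_subset_Int[of "N v" F] by simp
  then obtain c where Nc: "N v - F = {c}" by (auto simp: card_1_singleton_iff)
  then have c: "c \<in> N v" "c \<notin> F" by auto
  have ou: "out u = wt u a + wt u b"
  proof -
    have "N u - F = {a, b}" using Nu' abF uF by auto
    then show ?thesis using Nu' by (simp add: out_def)
  qed
  have ov: "out v = wt v c" using Nc by (simp add: out_def)
  have inN: "a \<in> N u" "b \<in> N u" using Nu' by auto
  have n1: "card (N a \<inter> F) \<noteq> 1" "card (N b \<inter> F) \<noteq> 1"
    using end_nbr_not_single[OF uv Nv d(2)] inN abF by blast+
  have np: "\<not> paired c" if "c \<in> N u" using end_shared_not_paired[OF uv Nv d that c(1)] .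
  have p4: "wt u r \<le> 4" if "r \<in> N u" "card (N r \<inter> F) \<noteq> 1" for r
    using that wt_paired_le4[OF uv d, of r] wt_le3[of r u] by (cases "paired r") auto
  have "{v, u} \<in> M" using uv by (simp add: insert_commute)
  then have p4v: "wt v c \<le> 4" if "card (N c \<inter> F) \<noteq> 1"
    using that wt_paired_le4[of v u c] wt_le3[of c v] d c by (cases "paired c") auto
  \<comment> \<open>The three outgoing charges are bounded by 6 + 3 + 3, or by 4 + 4 + 4 if an
    unshared neighbour of \<open>u\<close> is paired.\<close>
  show ?thesis
  proof (cases "c \<in> N u")
    case True
    then have "c = a \<or> c = b" using Nu' c uF by auto
    then have "wt u c \<le> 3" "wt v c \<le> 3" using np[OF True] n1 by (auto intro: wt_le3)
    then show ?thesis using ou ov \<open>c = a \<or> c = b\<close> wt_le[of u a] wt_le[of u b] by auto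
  next
    case False
    have nv: "r \<notin> N v" if "r \<in> {a, b}" for r
    proof
      assume "r \<in> N v"
      then have "r = c" using Nc that abF by blast
      then show False using False that inN by blast
    qed
    show ?thesis
    proof (cases "paired a \<or> paired b")
      case True
      then have "card (N c \<inter> F) \<noteq> 1"
      proof
        assume p: "paired a"
        show ?thesis by (rule end_paired_other[OF uv inN(1) p nv c]) (use False inN in auto)
      next
        assume p: "paired b"
        show ?thesis by (rule end_paired_other[OF uv inN(2) p nv c]) (use False inN in auto)
      qed
      then show ?thesis using ou ov p4[OF inN(1) n1(1)] p4[OF inN(2) n1(2)] p4v by simp
    next
      case False
      then have "wt u a \<le> 3" "wt u b \<le> 3" using wt_le3 n1 by blast+
      then show ?thesis using ou ov wt_le[of v c] by simp
    qed
  qed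
qed

end

section \<open>Forest components that consist of one matching edge\<close>

text \<open>\<open>wa\<close>, \<open>wb\<close> are the weights sent from one end of a matching
  edge and \<open>wc\<close>, \<open>wd\<close> those from the other; \<open>ac\<close>,
  \<open>ad\<close>, \<open>bc\<close>, \<open>bd\<close> record adjacency of the receivers. A
  weight 6 facing two nonzero weights would need two adjacencies at one receiver, which the last
  assumptions exclude. So every 6 forces a 0 on the opposite side.\<close>

lemma single_edge_arith:
  fixes wa wb wc wd :: nat
  assumes "wa = 6 \<or> wa \<le> 3" "wb = 6 \<or> wb \<le> 3" "wc = 6 \<or> wc \<le> 3" "wd = 6 \<or> wd \<le> 3"
    and "wa = 6 \<or> wc = 6 \<Longrightarrow> wa = 0 \<or> wc = 0 \<or> ac"
    and "wa = 6 \<or> wd = 6 \<Longrightarrow> wa = 0 \<or> wd = 0 \<or> ad"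
    and "wb = 6 \<or> wc = 6 \<Longrightarrow> wb = 0 \<or> wc = 0 \<or> bc"
    and "wb = 6 \<or> wd = 6 \<Longrightarrow> wb = 0 \<or> wd = 0 \<or> bd"
    and "\<not> (ac \<and> ad)" "\<not> (bc \<and> bd)" "\<not> (ac \<and> bc)" "\<not> (ad \<and> bd)"
  shows "wa + wb + wc + wd \<le> 12"
proof -
  have "wa = 0 \<or> wa = 6 \<or> (0 < wa \<and> wa \<le> 3)" "wb = 0 \<or> wb = 6 \<or> (0 < wb \<and> wb \<le> 3)"
    "wc = 0 \<or> wc = 6 \<or> (0 < wc \<and> wc \<le> 3)" "wd = 0 \<or> wd = 6 \<or> (0 < wd \<and> wd \<le> 3)"
    using assms(1-4) by linarith+
  then show ?thesis using assms(5-) by (elim disjE) simp_all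
qed

locale single_edge = extremal +
  fixes u v
  assumes uv: "{u, v} \<in> M" and Nu: "N u \<inter> F = {v}" and Nv: "N v \<inter> F = {u}"
begin

lemma uvF: "u \<in> F" "v \<in> F" "v \<in> N u" "u \<in> N v" "u \<noteq> v"
  using edgeF[OF uv] neq by auto

text \<open>Makes every one-sided statement available at the other end through a second
  interpretation.\<close>

lemma flip: "single_edge V N M v u"
  by unfold_locales (use uv Nu Nv in \<open>simp_all add: insert_commute F_def\<close>)

lemma comp: "fconn N F u g \<Longrightarrow> g = u \<or> g = v"
  unfolding fconn_def
proof (induction rule: rtrancl_induct)
  case (step y z)
  then have "z \<in> N y \<inter> F" by auto
  then show ?case using step.IH Nu Nv by auto
qed simp

text \<open>The two forest neighbours of a paired vertex lie in one component, which here is just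
  \<open>{u, v}\<close>.\<close>

lemma not_paired:
  assumes "r \<in> N u" "r \<notin> N v" shows "\<not> paired r"
proof
  assume "paired r"
  then obtain g where "u \<noteq> g" "g \<in> N r" "fconn N F u g"
    by (rule pairedE[OF _ sym[OF assms(1)] uvF(1)]) auto
  then show False using comp[of g] assms sym by blast
qed

lemma wt_dbl_0:
  assumes r: "r \<in> N u" "r \<notin> F" "r \<notin> N v" "dbl r" shows "wt u r = 0"
proof (rule wt_dbl[OF sym[OF r(1)] uvF(1) r(2) not_paired[OF r(1,3)] r(4)])
  fix g assume "g \<in> N r \<inter> F" "fconn N F u g"
  then show "g = u" using comp[of g] r sym by blast
qed

lemma wt_cases:
  assumes "r \<in> N u" "r \<notin> F" "r \<notin> N v"
  shows "wt u r = 6 \<and> card (N r \<inter> F) = 1 \<or> wt u r \<le> 3"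
  using wt_le3[OF _ not_paired[OF assms(1,3)], of u] by (auto simp: wt_def)

text \<open>A nonzero weight certifies that inserting \<open>c\<close> closes no cycle, so only an
  edge between \<open>a\<close> and \<open>c\<close> can block the trade of \<open>uv\<close> for
  \<open>ua\<close> and \<open>vc\<close>.\<close>

lemma one_nbr_exchange:
  assumes a: "a \<in> N u" "a \<notin> F" "card (N a \<inter> F) = 1"
    and c: "c \<in> N v" "c \<notin> F" "c \<notin> N u" "wt v c \<noteq> 0" "a \<noteq> c"
  shows "c \<in> N a"
proof -
  have "\<not> dbl c" using single_edge.wt_dbl_0[OF flip, of c] c by (auto simp: F_def)
  then show ?thesis using exchange[OF uv a(1,2) c(1,2,5) a(3)] by blast
qed

text \<open>The third criterion serves this situation. With nonzero weight, \<open>c\<close> would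
  be adjacent to \<open>b\<close>. If \<open>a\<close> is adjacent to \<open>b\<close> too, then
  \<open>v\<close> and \<open>b\<close> share \<open>u\<close>, \<open>a\<close>, \<open>c\<close>.
  Otherwise trading \<open>uv\<close> for \<open>ub\<close> raises neither of the first two
  criteria, but replaces an edge lying in a triangle by one lying in none.\<close>

lemma triangle_one_nbr:
  assumes d: "card (N u) = 3" "card (N v) = 3" and a: "a \<in> N u" "a \<in> N v"
    and b: "b \<in> N u" "b \<notin> F" "b \<notin> N v" "a \<noteq> b" "card (N b \<inter> F) = 1"
    and c: "c \<in> N v" "c \<notin> F" "c \<notin> N u"
  shows "wt v c = 0"
proof (rule ccontr)
  assume w: "wt v c \<noteq> 0"
  have ne: "b \<noteq> c" using b c by blast
  have cb: "c \<in> N b" by (rule one_nbr_exchange[OF b(1,2,5) c w ne])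
  have ua: "u \<noteq> a" "v \<noteq> a" "a \<noteq> c" "u \<noteq> c" "v \<noteq> b" using a b c uvF neq by blast+
  have Nu': "N u = {v, a, b}" using a b ua uvF by (intro nbrs3) auto
  have Nb: "N b \<inter> F = {u}" using one_nbr[OF b(5) sym[OF b(1)] uvF(1)] .
  show False
  proof (cases "a \<in> N b")
    case True
    have "{u, a, c} \<subseteq> N v" "{u, a, c} \<subseteq> N b" using True a b c cb uvF sym by auto
    then show False using K23_contra[of u a c v b] ua by blast
  next
    case False
    have e: "(F - {u, v}) \<union> {u, b} = insert b (F - {v})" using uvF by auto
    have s: "N b \<inter> (F - {v}) \<subseteq> {u}" using Nb by auto
    have ac: "acyc N ((F - {u, v}) \<union> {u, b})"
      unfolding e by (rule acyc_insert_leaf'[OF acyc_mono[OF acF] s]) auto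
    have "card (N b \<inter> (F - {v})) \<le> 1" using s by (rule card_le_1_subset)
    moreover have "N v \<inter> (F - {v}) = {u}" using Nv uvF by auto
    ultimately have ds: "degsum N ((F - {u, v}) \<union> {u, b}) \<le> degsum N F"
      unfolding e using degsum_insert[of "F - {v}" b] b(2) degsum_remove[OF uvF(2)] by simp
    have "N u \<inter> N b \<noteq> {}"
      by (rule swap_triangle[OF uv b(1) _ _ ac _ ds]) (use b a d deg3[of b] in auto)
    moreover have "v \<notin> N b" using b(3) sym by blast
    ultimately show False using Nu' False irrefl by auto
  qed
qed

text \<open>Any other outgoing edge \<open>ub\<close> has weight 0: otherwise \<open>uv\<close>
  could be traded for \<open>ub\<close> and \<open>ax\<close> with \<open>x\<close> the free
  neighbour of \<open>a\<close>. The forest then loses \<open>v\<close>, takes in \<open>b\<close>,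
  and gets \<open>a\<close> and \<open>x\<close> as leaves at \<open>u\<close> and
  \<open>a\<close>.\<close>

lemma shared_paired_out:
  assumes a: "a \<in> N u" "a \<in> N v" "paired a"
  shows "out u \<le> 6"
proof -
  obtain x where x: "free x" "x \<noteq> u" "x \<noteq> v" "N a = {x, u, v}" "a \<notin> F"
  proof (rule pairedE[OF a(3) sym[OF a(1)] uvF(1)])
    fix x g assume "free x" "x \<noteq> u" "x \<noteq> g" "u \<noteq> g" "N a = {x, u, g}" "a \<notin> F" "g \<in> F" "fconn N F u g"
    moreover from this have "g = v" using comp[of g] by auto
    ultimately show thesis using that[of x] by simp
  qed
  have xF: "x \<notin> F" "N x \<inter> F = {}" "x \<in> N a" using x by (auto simp: free_def)
  have zero: "wt u b = 0" if b: "b \<in> N u" "b \<notin> F" "b \<noteq> a" for b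
  proof (rule ccontr)
    assume w: "wt u b \<noteq> 0"
    have bv: "b \<notin> N v" if "x \<in> N b"
    proof
      assume "b \<in> N v"
      then have "{x, u, v} \<subseteq> N b" "{x, u, v} \<subseteq> N a" using that b sym x by auto
      then show False using K23_contra[of x u v b a] x uvF b by blast
    qed
    have xb: "x \<notin> N b"
    proof
      assume "x \<in> N b"
      then have "paired b" using x(1) by (auto simp: paired_def)
      then show False using not_paired[OF b(1) bv] \<open>x \<in> N b\<close> by blast
    qed
    \<comment> \<open>If \<open>b\<close> is adjacent to \<open>v\<close>, any two neighbours in
      \<open>F - {v}\<close> include \<open>u\<close>, whose component has no other vertex there. If
      it is not, a connected pair would make the weight 0.\<close>
    have nb: "\<not> fconn N (F - {v}) y z"
      if y: "y \<in> N b \<inter> (F - {v})" and z: "z \<in> N b \<inter> (F - {v})" and yz: "y \<noteq> z" for y z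
    proof
      assume f: "fconn N (F - {v}) y z"
      then have F': "fconn N F y z" by (rule fconn_mono) auto
      show False
      proof (cases "b \<in> N v")
        case True
        have *: "N b = {u, v, t}" if "t \<in> N b" "t \<noteq> u" "t \<noteq> v" for t
          using that True b sym uvF by (intro nbrs3) auto
        have "y = u \<or> z = u"
        proof (rule ccontr)
          assume no: "\<not> ?thesis"
          then have "N b = {u, v, y}" using y by (intro *) auto
          then show False using no z yz by auto
        qed
        then have "fconn N F u y \<and> fconn N F u z" using F' fconn_sym[OF F'] by auto
        then show False using comp[of y] comp[of z] y z yz by blast
      next
        case False
        have "dbl b" unfolding dbl_def using y z yz F' by blast
        then show False using wt_dbl_0[OF b(1,2) False] w by simp
      qed
    qed
    have s1: "acyc N (insert b (F - {v}))"
      by (rule acyc_insert[OF acyc_mono[OF acF] _ _ nb]) (use b in auto)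
    have bx: "b \<noteq> x" using xF(2) sym[OF b(1)] uvF(1) by auto
    then have ab: "b \<notin> N a" using x(4) b(2) uvF(1,2) by auto
    then have ba: "a \<notin> N b" using sym by blast
    have s2: "N a \<inter> insert b (F - {v}) \<subseteq> {u}" using x(4) xF(1) bx ab by auto
    have "b \<notin> N x" using xb sym by blast
    then have s3: "N x \<inter> insert a (insert b (F - {v})) \<subseteq> {a}" using xF(2) by auto
    have "acyc N (insert x (insert a (insert b (F - {v}))))"
      using acyc_insert_leaf'[OF acyc_insert_leaf'[OF s1 s2] s3] .
    moreover have "(F - {u, v}) \<union> {a, x, u, b} = insert x (insert a (insert b (F - {v})))"
      using uvF by auto
    moreover have "\<not> acyc N ((F - {u, v}) \<union> {a, x, u, b})"
      using x xF b bx uvF by (intro no_augment[OF uv]) auto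
    ultimately show False by simp
  qed
  have "out u = (\<Sum>r\<in>N u - F. if r = a then wt u r else 0)"
    unfolding out_def by (rule sum.cong) (use zero in auto)
  also have "\<dots> \<le> wt u a" by (simp add: sum.delta)
  finally show ?thesis using wt_le[of u a] by simp
qed

lemma shared_out:
  assumes a: "a \<in> N u" "a \<in> N v" and np: "\<And>r. r \<in> N u \<Longrightarrow> \<not> paired r"
  shows "wt u a \<le> 3"
proof -
  have "card (N a \<inter> F) \<noteq> 1"
  proof
    assume "card (N a \<inter> F) = 1"
    then have "N a \<inter> F = {u}" by (rule one_nbr[OF _ sym[OF a(1)] uvF(1)])
    moreover have "v \<in> N a \<inter> F" using sym[OF a(2)] uvF(2) by simp
    ultimately show False using uvF(5) by simp
  qed
  then show ?thesis using wt_le3 np[OF a(1)] by blast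
qed

lemma degree_out: "card (N u - F) + 1 = card (N u)"
proof -
  have "card (N u - F) = card (N u) - 1" using card_Diff_subset_Int[of "N u" F] Nu by simp
  then show ?thesis using uvF(3) by (metis Suc_eq_plus1 Suc_pred' card_gt_0_iff empty_iff finN)
qed

lemma out_split:
  assumes "a \<in> N u - F"
  obtains "N u - F = {a}" "out u = wt u a"
  | b where "N u - F = {a, b}" "a \<noteq> b" "out u = wt u a + wt u b" "card (N u) = 3"
proof -
  have "card (N u - F) \<noteq> 0" using assms by (metis card_0_eq empty_iff finN finite_Diff)
  moreover have "card (N u - F) \<le> 2" using degree_out deg3[of u] by linarith
  ultimately consider "card (N u - F) = 1" | "card (N u - F) = 2" by linarith
  then show thesis
  proof cases
    case 1
    then have "N u - F = {a}" using card1_eq[of "N u - F" a] assms by simp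
    then show thesis using that(1) by (simp add: out_def)
  next
    case 2
    have "card (N u - F - {a}) = 1" using 2 assms by simp
    then obtain b where "N u - F - {a} = {b}" by (auto simp: card_1_singleton_iff)
    then have "N u - F = {a, b}" "a \<noteq> b" using assms by auto
    then show thesis using that(2)[of b] 2 degree_out by (simp add: out_def)
  qed
qed

lemma out_le12: "out u \<le> 12"
  using out_le[OF uvF(1)] Nu by simp

end

context single_edge begin

text \<open>At an unshared neighbour, weight 6 means a single neighbour in \<open>F\<close>, so
  \<open>one_nbr_exchange\<close> applies from that end. This supplies the adjacency assumptions of
  \<open>single_edge_arith\<close>.\<close>

lemma no_common_wt:
  assumes disj: "N u \<inter> N v = {}" and a: "a \<in> N u - F" and c: "c \<in> N v - F"
    and six: "wt u a = 6 \<or> wt v c = 6"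
  shows "wt u a = 0 \<or> wt v c = 0 \<or> c \<in> N a"
proof (rule ccontr)
  assume no: "\<not> ?thesis"
  interpret flipped: single_edge V N M F v u by (rule flip) (rule F_def)
  have a': "a \<in> N u" "a \<notin> F" "a \<notin> N v" and c': "c \<in> N v" "c \<notin> F" "c \<notin> N u" using a c disj by auto
  have ne: "a \<noteq> c" using a' c' by blast
  from six show False
  proof
    assume "wt u a = 6"
    then have "card (N a \<inter> F) = 1" using wt_cases[OF a'] by simp
    then show False using one_nbr_exchange[OF a'(1,2) _ c' _ ne] no by simp
  next
    assume "wt v c = 6"
    then have "card (N c \<inter> F) = 1" using flipped.wt_cases[OF c'] by simp
    then have "a \<in> N c"
      using flipped.one_nbr_exchange[OF c'(1,2) _ a' _ ne[symmetric]] no by simp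
    then show False using no sym by blast
  qed
qed

text \<open>Four outgoing edges could cost 24. A paired shared neighbour limits each end to 6, an
  unpaired one costs at most 3 from each end, and without shared neighbours the arithmetic of
  partial matchings applies.\<close>

lemma pair_out: "out u + out v \<le> 12"
proof -
  interpret flipped: single_edge V N M F v u by (rule flip) (rule F_def)
  note split_u = out_split and split_v = flipped.out_split
  show ?thesis
  proof (cases "\<exists>a \<in> N u \<inter> N v. paired a")
    case True
    then obtain a where "a \<in> N u" "a \<in> N v" "paired a" by blast
    then show ?thesis using shared_paired_out[of a] flipped.shared_paired_out[of a] by simp
  next
    case False
    have npF: "\<not> paired r" if "r \<in> F" for r
      using that free_nbr_dbl(1) sym unfolding paired_def by blast
    have npu: "\<not> paired r" if "r \<in> N u" for r using that False not_paired by blast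
    have npv: "\<not> paired r" if "r \<in> N v" for r using that False flipped.not_paired by blast
    consider "N u - F = {}" | "N v - F = {}" | a where "a \<in> N u \<inter> N v"
      | a c where "a \<in> N u - F" "c \<in> N v - F" "N u \<inter> N v = {}" by blast
    then show ?thesis
    proof cases
      case 1
      then have "out u = 0" unfolding out_def by (simp only: sum.empty)
      then show ?thesis using flipped.out_le12 by simp
    next
      case 2
      then have "out v = 0" unfolding out_def by (simp only: sum.empty)
      then show ?thesis using out_le12 by simp
    next
      case (3 a)
      then have a: "a \<in> N u" "a \<in> N v" by auto
      have aF: "a \<notin> F" using a Nu Nv uvF(5) by auto
      have wu: "wt u r \<le> 3" if "r \<in> N u" "r \<in> N v" for r
        by (rule shared_out[OF that]) (rule npu)
      have wv: "wt v r \<le> 3" if "r \<in> N u" "r \<in> N v" for r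
        by (rule flipped.shared_out[OF that(2,1)]) (rule npv)
      note w = wu[OF a] wv[OF a]
      have au: "a \<in> N u - F" and av: "a \<in> N v - F" using a aF by auto
      show ?thesis
      proof (rule split_u[OF au]; rule split_v[OF av])
        fix b c assume b: "N u - F = {a, b}" "a \<noteq> b" "out u = wt u a + wt u b" "card (N u) = 3"
          and c: "N v - F = {a, c}" "a \<noteq> c" "out v = wt v a + wt v c" "card (N v) = 3"
        have bu: "b \<in> N u" "b \<notin> F" and cv: "c \<in> N v" "c \<notin> F" using b(1) c(1) by auto
        show ?thesis
        proof (cases "b = c")
          case True
          then have bc: "b \<in> N v" "c \<in> N u" using bu cv by auto
          show ?thesis using b c w wu[OF bu(1) bc(1)] wv[OF bc(2) cv(1)] by simp
        next
          case False
          have "b \<notin> N v - F" unfolding c(1) using False b(2) by simp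
          then have bv: "b \<notin> N v" using bu(2) by simp
          have "c \<notin> N u - F" unfolding b(1) using False c(2) by simp
          then have cu: "c \<notin> N u" using cv(2) by simp
          have "card (N b \<inter> F) = 1 \<Longrightarrow> wt v c = 0"
            by (rule triangle_one_nbr[OF b(4) c(4) a bu bv b(2) _ cv cu])
          moreover have "card (N c \<inter> F) = 1 \<Longrightarrow> wt u b = 0"
            by (rule flipped.triangle_one_nbr[OF c(4) b(4) a(2,1) cv cu c(2) _ bu bv])
          \<comment> \<open>A weight above 3 means a single forest neighbour and forces the other
            weight to 0.\<close>
          ultimately have "wt u b + wt v c \<le> 6"
            using wt_cases[OF bu bv] flipped.wt_cases[OF cv cu] by auto
          then show ?thesis using b c w by simp
        qed
      next
        fix b assume "out u = wt u a + wt u b" "out v = wt v a"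
        then show ?thesis using w wt_le[of u b] by simp
      next
        fix c assume "out v = wt v a + wt v c" "out u = wt u a"
        then show ?thesis using w wt_le[of v c] by simp
      qed (use w in simp)
    next
      case (4 a c)
      have cu: "wt u r = 6 \<or> wt u r \<le> 3" if "r \<in> N u - F" for r
        using wt_cases[of r] that 4(3) by blast
      have cv: "wt v r = 6 \<or> wt v r \<le> 3" if "r \<in> N v - F" for r
        using flipped.wt_cases[of r] that 4(3) by blast
      note X = no_common_wt[OF 4(3)]
      \<comment> \<open>Otherwise \<open>v\<close> and \<open>r\<close> share the three neighbours
        \<open>u\<close>, \<open>p\<close>, \<open>q\<close>. Together with \<open>Kv\<close> this
        makes the adjacencies between the two sides a partial matching.\<close>
      have Ku: "\<not> (p \<in> N r \<and> q \<in> N r)" if "p \<in> N v - F" "q \<in> N v - F" "p \<noteq> q" "r \<in> N u - F" for p q r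
      proof
        assume h: "p \<in> N r \<and> q \<in> N r"
        have "{u, p, q} \<subseteq> N v" "{u, p, q} \<subseteq> N r" using that h uvF sym by auto
        then show False using K23_contra[of u p q v r] that uvF by blast
      qed
      have Kv: "\<not> (r \<in> N p \<and> r \<in> N q)" if "p \<in> N u - F" "q \<in> N u - F" "p \<noteq> q" "r \<in> N v - F" for p q r
      proof
        assume h: "r \<in> N p \<and> r \<in> N q"
        have "{v, p, q} \<subseteq> N u" "{v, p, q} \<subseteq> N r" using that h uvF sym by auto
        then show False using K23_contra[of v p q u r] that uvF by blast
      qed
      show ?thesis
      proof (rule split_u[OF 4(1)]; rule split_v[OF 4(2)])
        assume "out u = wt u a" "out v = wt v c"
        then show ?thesis using wt_le[of u a] wt_le[of v c] by simp
      next
        fix d assume h: "N v - F = {c, d}" "c \<noteq> d" "out v = wt v c + wt v d" "out u = wt u a"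
        then have d: "d \<in> N v - F" by auto
        \<comment> \<open>A missing outgoing edge enters as weight 0 without adjacencies.\<close>
        have "wt u a + 0 + wt v c + wt v d \<le> 12"
          by (rule single_edge_arith[where ac = "c \<in> N a" and ad = "d \<in> N a" and bc = False and bd = False])
            (use cu[OF 4(1)] cv[OF 4(2)] cv[OF d] X[OF 4(1,2)] X[OF 4(1) d] Ku[OF 4(2) d h(2) 4(1)] in auto)
        then show ?thesis using h by simp
      next
        fix b assume h: "N u - F = {a, b}" "a \<noteq> b" "out u = wt u a + wt u b" "out v = wt v c"
        then have b: "b \<in> N u - F" by auto
        have "wt u a + wt u b + wt v c + 0 \<le> 12"
          by (rule single_edge_arith[where ac = "c \<in> N a" and bc = "c \<in> N b" and ad = False and bd = False])
            (use cu[OF 4(1)] cv[OF 4(2)] cu[OF b] X[OF 4(1,2)] X[OF b 4(2)] Kv[OF 4(1) b h(2) 4(2)] in auto)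
        then show ?thesis using h by simp
      next
        fix b d assume h: "N u - F = {a, b}" "a \<noteq> b" "out u = wt u a + wt u b"
          "N v - F = {c, d}" "c \<noteq> d" "out v = wt v c + wt v d"
        then have b: "b \<in> N u - F" and d: "d \<in> N v - F" by auto
        have "wt u a + wt u b + wt v c + wt v d \<le> 12"
          by (rule single_edge_arith[OF cu[OF 4(1)] cu[OF b] cv[OF 4(2)] cv[OF d]
                X[OF 4(1,2)] X[OF 4(1) d] X[OF b 4(2)] X[OF b d]
                Ku[OF 4(2) d h(5) 4(1)] Ku[OF 4(2) d h(5) b] Kv[OF 4(1) b h(2) 4(2)] Kv[OF 4(1) b h(2) d]])
        then show ?thesis using h by simp
      qed
    qed
  qed
qed

end

context extremal begin

lemma component_out:
  assumes x: "x \<in> F" shows "sum out (fcomp N F x) \<le> (\<Sum>f\<in>fcomp N F x. 6)"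
proof -
  let ?T = "fcomp N F x"
  have TF: "?T \<subseteq> F" using fcomp_subset[OF x] .
  have finT: "finite ?T" using TF finF finite_subset by blast
  have xT: "x \<in> ?T" by (simp add: fcomp_def)
  obtain y where y: "{x, y} \<in> M" "y \<in> N x" "y \<in> F" "y \<noteq> x"
    using partner[OF mM, of x] x by (auto simp: F_def)
  show ?thesis
  proof (cases "\<exists>w\<in>?T. 2 \<le> card (N w \<inter> F)")
    case True
    then obtain w where w: "w \<in> ?T" "2 \<le> card (N w \<inter> F)" by blast
    obtain u v u' v' where p: "{u, v} \<in> M" "{u', v'} \<in> M" "{u, v, u', v'} \<subseteq> ?T"
      "v \<noteq> v'" "u \<noteq> u'" "u \<noteq> v'" "v \<noteq> u'" "N u \<inter> F = {v}" "N u' \<inter> F = {v'}"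
      "card (N v \<inter> F) = 2" "card (N v' \<inter> F) = 2"
      using end_pairs[OF mM F_def[THEN meta_eq_to_obj_eq] acF x w] .
    \<comment> \<open>\<open>?g\<close> prices every edge end at 6, whether inner or outgoing, so it
      is at most 18 per vertex; the inner part is subtracted at the end with the bound
      \<open>2n - 2\<close>.\<close>
    let ?g = "\<lambda>f. out f + 6 * card (N f \<inter> F)"
    let ?P = "{u, v, u', v'}"
    have ne: "u \<noteq> v" "u' \<noteq> v'" using edgeF[OF p(1)] edgeF[OF p(2)] neq by auto
    have "sum ?g ?P = ?g u + ?g v + (?g u' + ?g v')" using ne p by simp
    \<comment> \<open>A pendant pair contributes at most 12 + 6 * (1 + 2) = 30 instead of 36. Two
      pairs save the 12 units by which \<open>n + 2\<close> outgoing edges exceed the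
      budget.\<close>
    also have "\<dots> \<le> 60"
      using end_pair_out[OF p(1,8,10)] end_pair_out[OF p(2,9,11)] p by simp
    finally have P: "sum ?g ?P \<le> 60" .
    have "sum ?g (?T - ?P) \<le> (\<Sum>f\<in>?T - ?P. 18)"
      by (rule sum_mono) (use out_le TF in auto)
    moreover have "card ?P = 4" using ne p by simp
    then have "card (?T - ?P) = card ?T - 4" "4 \<le> card ?T"
      using p(3) finT card_Diff_subset[of ?P ?T] card_mono[OF finT p(3)] by auto
    moreover have "sum ?g ?T = sum ?g (?T - ?P) + sum ?g ?P"
      by (rule sum.subset_diff[OF p(3) finT])
    ultimately have "sum ?g ?T + 12 \<le> 18 * card ?T" using P by simp
    moreover have "sum ?g ?T = sum out ?T + 6 * (\<Sum>f\<in>?T. card (N f \<inter> F))"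
      by (simp add: sum.distrib sum_distrib_left)
    ultimately show ?thesis using degsum_fcomp[OF finF x] by simp
  next
    case False
    have one: "N f \<inter> F = {g}" if "f \<in> ?T" "g \<in> N f" "g \<in> F" for f g
      using card1_eq[of "N f \<inter> F" g] False that by force
    have yT: "y \<in> ?T" using fcomp_nbr[OF x xT] y by blast
    have Nx: "N x \<inter> F = {y}" and Ny: "N y \<inter> F = {x}"
      using one[OF xT y(2,3)] one[OF yT sym[OF y(2)] x] .
    interpret single_edge V N M F x y
      by unfold_locales (use y Nx Ny in \<open>simp_all add: F_def\<close>)
    have "?T = {x, y}" using comp xT yT by (auto simp: fcomp_def)
    then show ?thesis using pair_out y(4) by simp
  qed
qed

end

section \<open>Charge collected outside the forest\<close>

context extremal begin

text \<open>A neighbour of a free vertex has two neighbours in \<open>F\<close>, which leaves room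
  for only one free vertex.\<close>

lemma free_unique:
  assumes "free x" "free y" "r \<in> N x" "r \<in> N y" shows "x = y"
proof -
  obtain f where f: "f \<in> N r" "f \<in> F"
    using free_nbr_dbl(2)[OF assms(1,3)] by (auto simp: dbl_def)
  have p: "paired r" using assms(1) sym[OF assms(3)] by (auto simp: paired_def)
  obtain z g where zg: "N r = {z, f, g}" "g \<in> F" using pairedE[OF p f] by metis
  moreover have "x \<in> N r" "y \<in> N r" "x \<notin> F" "y \<notin> F" using assms sym by (auto simp: free_def)
  ultimately show ?thesis using f by auto
qed

definition income :: "'a \<Rightarrow> nat" where
  "income r = (\<Sum>f\<in>N r \<inter> F. wt f r)"

text \<open>Only three unpaired payers need care. Two zero weights among them are impossible, as the
  two connections they require would connect all three payers by transitivity. So the income is 3 +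
  3 + 0 or 3 + 3 + 3.\<close>

lemma income_ge:
  assumes "r \<in> V" "r \<notin> F" "\<not> free r" shows "6 \<le> income r"
proof -
  have ne: "N r \<inter> F \<noteq> {}" using assms by (auto simp: free_def)
  have le: "card (N r \<inter> F) \<le> 3" using deg3[of r] card_mono[of "N r" "N r \<inter> F"] by simp
  have const: "income r = card (N r \<inter> F) * k" if "\<And>f. f \<in> N r \<inter> F \<Longrightarrow> wt f r = k" for k
    using that unfolding income_def by simp
  have c0: "card (N r \<inter> F) \<noteq> 0" using ne by (metis card_0_eq finN finite_Int)
  consider "card (N r \<inter> F) = 1" | "paired r" | "card (N r \<inter> F) = 2" "\<not> paired r"
    | "card (N r \<inter> F) = 3" "\<not> paired r"
    using c0 le by linarith
  then show ?thesis
  proof cases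
    case 1
    then show ?thesis using const[of 6] by (simp add: wt_def)
  next
    case 2
    obtain f where f: "f \<in> N r" "f \<in> F" using ne by blast
    obtain g where g: "g \<in> N r" "g \<in> F" "g \<noteq> f" using pairedE[OF 2 f] by (metis insertI1 insert_commute)
    have "wt f r + wt g r = sum (\<lambda>f. wt f r) {f, g}" using g by simp
    also have "\<dots> \<le> income r" unfolding income_def by (rule sum_mono2) (use f g in auto)
    finally have "wt f r + wt g r \<le> income r" .
    moreover have "4 \<le> wt h r" for h using 2 one_nbr_not_paired[of r] by (auto simp: wt_def)
    from this[of f] this[of g] have "8 \<le> wt f r + wt g r" by linarith
    ultimately show ?thesis by linarith
  next
    case 3
    have "wt f r = 3" if f: "f \<in> N r \<inter> F" for f
    proof -
      have "N r \<inter> F \<noteq> {f, p, q}" if "p \<noteq> q" "p \<noteq> f" "q \<noteq> f" for p q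
      proof
        assume "N r \<inter> F = {f, p, q}"
        then have "card {f, p, q} = 2" using 3 by simp
        then show False using that by simp
      qed
      then show ?thesis using 3 by (auto simp: wt_def)
    qed
    then show ?thesis using const[of 3] 3 by simp
  next
    case 4
    then obtain f g h where N: "N r \<inter> F = {f, g, h}" "f \<noteq> g" "f \<noteq> h" "g \<noteq> h"
      by (auto simp: card_3_iff)
    have w: "wt p r = (if fconn N F q s \<and> \<not> fconn N F p q then 0 else 3)"
      if "N r \<inter> F = {p, q, s}" "p \<noteq> q" "p \<noteq> s" "q \<noteq> s" for p q s
    proof -
      have "fconn N F q s \<and> \<not> fconn N F p q"
        if h: "N r \<inter> F = {p, q', s'}" "q' \<noteq> s'" "q' \<noteq> p" "s' \<noteq> p" "fconn N F q' s'" "\<not> fconn N F p q'"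
        for q' s'
      proof -
        have "{q', s'} = {q, s}" using h \<open>N r \<inter> F = {p, q, s}\<close> \<open>p \<noteq> q\<close> \<open>p \<noteq> s\<close> by auto
        then consider "q' = q" "s' = s" | "q' = s" "s' = q" unfolding doubleton_eq_iff by argo
        then show ?thesis
        proof cases
          case 2
          then have qs: "fconn N F q s" using h(5) fconn_sym by blast
          moreover have "\<not> fconn N F p q" using fconn_trans[OF _ qs] h(6) 2 by blast
          ultimately show ?thesis by blast
        qed (use h in blast)
      qed
      moreover have "\<exists>q' s'. N r \<inter> F = {p, q', s'} \<and> q' \<noteq> s' \<and> q' \<noteq> p \<and> s' \<noteq> p \<and> fconn N F q' s' \<and> \<not> fconn N F p q'"
        if "fconn N F q s \<and> \<not> fconn N F p q"
        using that \<open>N r \<inter> F = {p, q, s}\<close> \<open>p \<noteq> q\<close> \<open>p \<noteq> s\<close> \<open>q \<noteq> s\<close>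
        by (intro exI[of _ q] exI[of _ s]) auto
      ultimately have "(\<exists>q' s'. N r \<inter> F = {p, q', s'} \<and> q' \<noteq> s' \<and> q' \<noteq> p \<and> s' \<noteq> p \<and> fconn N F q' s'
          \<and> \<not> fconn N F p q') \<longleftrightarrow> fconn N F q s \<and> \<not> fconn N F p q"
        by (intro iffI) (elim exE conjE, simp)+
      then show ?thesis using 4 unfolding wt_def by simp
    qed
    have "income r = wt f r + wt g r + wt h r" using N by (simp add: income_def)
    moreover have "N r \<inter> F = {g, f, h}" "N r \<inter> F = {h, f, g}" using N by auto
    then have "wt f r + wt g r + wt h r \<ge> 6"
      using w[of f g h] w[of g f h] w[of h f g] N fconn_sym fconn_trans[of N F f g h]
        fconn_trans[of N F g f h] fconn_trans[of N F f h g]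
      by (smt (verit, best) add_le_mono le_add1 le_add2 numeral_Bit0 numeral_code(3) order_refl)
    ultimately show ?thesis by simp
  qed
qed

text \<open>The weights of paired vertices are made for this. A free vertex of degree
  \<open>d\<close> and its neighbours need \<open>6d + 6\<close> units, and each neighbour has two
  payers: at weight 4 this gives exactly 24 for \<open>d = 3\<close>, and at weight 6 it gives
  \<open>12d\<close>, which suffices for \<open>d = 1\<close> and \<open>d = 2\<close>.\<close>

lemma income_free:
  assumes x: "free x" shows "6 * card (N x) + 6 \<le> sum income (N x)"
proof -
  have xV: "x \<in> V" using x by (simp add: free_def)
  have inc: "(if card (N x) = 3 then 8 else 12) \<le> income r" if r: "r \<in> N x" for r
  proof -
    have p: "paired r" using x sym[OF r] by (auto simp: paired_def)
    have d: "r \<notin> F" "dbl r" using free_nbr_dbl[OF x r] by auto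
    then obtain f where f: "f \<in> N r" "f \<in> F" by (auto simp: dbl_def)
    obtain g where g: "g \<in> N r" "g \<in> F" "g \<noteq> f" using pairedE[OF p f] by (metis insertI1 insert_commute)
    have "wt f r + wt g r = sum (\<lambda>f. wt f r) {f, g}" using g by simp
    also have "\<dots> \<le> income r" unfolding income_def by (rule sum_mono2) (use f g in auto)
    finally have le: "wt f r + wt g r \<le> income r" .
    have "(\<exists>y\<in>N r. free y \<and> card (N y) = 3) \<longleftrightarrow> card (N x) = 3"
      using x sym[OF r] free_unique[OF x _ r] sym by blast
    then have w: "wt h r = (if card (N x) = 3 then 4 else 6)" for h
      using p one_nbr_not_paired[of r] by (auto simp: wt_def)
    show ?thesis using le unfolding w by (simp split: if_splits)
  qed
  have "(\<Sum>r\<in>N x. if card (N x) = 3 then 8 else 12) \<le> sum income (N x)"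
    by (rule sum_mono) (rule inc)
  moreover have "card (N x) \<noteq> 0" using nonisolated[OF xV] by simp
  then have "card (N x) = 1 \<or> card (N x) = 2 \<or> card (N x) = 3" using deg3[of x] by linarith
  ultimately show ?thesis by auto
qed

lemma total_income: "6 * card (V - F) \<le> sum income (V - F)"
proof -
  let ?Fr = "{x. free x}" and ?Pa = "\<Union>x\<in>{x. free x}. N x"
  let ?Ot = "V - F - ?Fr - ?Pa"
  have sub: "?Fr \<subseteq> V - F" "?Pa \<subseteq> V - F"
    using free_nbr_dbl(1) N_sub by (auto simp: free_def)
  have fin: "finite (V - F)" "finite ?Fr" "finite ?Pa" "finite ?Ot"
    using finV finite_subset[OF sub(1)] finite_subset[OF sub(2)] by auto
  have dj: "?Fr \<inter> ?Pa = {}"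
  proof -
    have "\<not> free r" if "free x" "r \<in> N x" for x r
      using free_nbr_dbl(2)[OF that] by (auto simp: free_def dbl_def)
    then show ?thesis by blast
  qed
  have eq: "V - F = ?Ot \<union> (?Fr \<union> ?Pa)" using sub by blast
  have djN: "\<forall>x\<in>?Fr. \<forall>y\<in>?Fr. x \<noteq> y \<longrightarrow> N x \<inter> N y = {}" using free_unique by blast
  have cPa: "card ?Pa = (\<Sum>x\<in>?Fr. card (N x))"
    using card_UN_disjoint[OF fin(2) _ djN] by simp
  have sPa: "sum income ?Pa = (\<Sum>x\<in>?Fr. sum income (N x))"
    using sum.UNION_disjoint[OF fin(2) _ djN] by simp
  have "card (V - F) = card ?Ot + card (?Fr \<union> ?Pa)"
    by (subst eq, rule card_Un_disjoint) (use fin in auto)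
  also have "card (?Fr \<union> ?Pa) = card ?Fr + card ?Pa"
    by (rule card_Un_disjoint) (use fin dj in auto)
  finally have c: "6 * card (V - F) = 6 * card ?Ot + (\<Sum>x\<in>?Fr. 6 * card (N x) + 6)"
    using cPa by (simp add: sum.distrib sum_distrib_left)
  have "(\<Sum>x\<in>?Fr. 6 * card (N x) + 6) \<le> sum income ?Pa"
    unfolding sPa by (rule sum_mono) (use income_free in simp)
  moreover have "(\<Sum>r\<in>?Ot. 6) \<le> sum income ?Ot"
    by (rule sum_mono) (use income_ge in auto)
  moreover have "sum income ?Ot + sum income ?Pa = sum income (?Ot \<union> ?Pa)"
    by (rule sum.union_disjoint[symmetric]) (use fin in auto)
  moreover have "sum income (?Ot \<union> ?Pa) \<le> sum income (V - F)"
    by (rule sum_mono2) (use fin sub in auto)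
  ultimately show ?thesis using c by simp
qed

text \<open>Summing the charge once over receivers and once over senders compares
  \<open>V - F\<close> with \<open>F\<close>, and \<open>F\<close> has two vertices per matching
  edge.\<close>

lemma card_V_le: "card V \<le> 4 * card M"
proof -
  have "sum income (V - F) = (\<Sum>r\<in>V - F. \<Sum>f\<in>{f \<in> F. f \<in> N r}. wt f r)"
    unfolding income_def by (intro sum.cong) auto
  also have "\<dots> = (\<Sum>f\<in>F. \<Sum>r\<in>{r \<in> V - F. f \<in> N r}. wt f r)"
    by (rule sum.swap_restrict) (use finV in auto)
  also have "\<dots> = sum out F"
    unfolding out_def
  proof (rule sum.cong, rule refl)
    fix f assume "f \<in> F"
    have "{r \<in> V - F. f \<in> N r} = N f - F" using sym N_sub by blast
    then show "(\<Sum>r\<in>{r \<in> V - F. f \<in> N r}. wt f r) = (\<Sum>r\<in>N f - F. wt f r)" by simp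
  qed
  also have "\<dots> \<le> (\<Sum>f\<in>F. 6)" by (rule sum_over_components[OF finF component_out])
  finally have "card (V - F) \<le> card F" using total_income by simp
  moreover have "card F = 2 * card M" using card_Union_mat[OF mM] by (simp add: F_def)
  moreover have "card (V - F) = card V - card F" using card_Diff_subset[OF finF FV] .
  ultimately show ?thesis by linarith
qed

end

theorem (in sgraph) K23_free_bound:
  assumes deg3: "\<And>x. card (N x) \<le> 3"
    and nonisolated: "\<And>x. x \<in> V \<Longrightarrow> N x \<noteq> {}"
    and noK23: "\<And>x y. x \<noteq> y \<Longrightarrow> card (N x \<inter> N y) \<le> 2"
  shows "\<exists>M. mat N M \<and> acyc N (\<Union>M) \<and> card V \<le> 4 * card M"
proof -
  let ?S = "{M. mat N M \<and> acyc N (\<Union>M)}"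
  have "?S \<subseteq> Pow (Pow V)" using mat_Union_V by blast
  then have finS: "finite ?S" using finV finite_subset by blast
  have "{} \<in> ?S" by (simp add: mat_def)
  then have ne: "card ` ?S \<noteq> {}" by blast
  let ?k = "Max (card ` ?S)"
  have "?k \<in> card ` ?S" using Max_in[OF _ ne] finS by blast
  then obtain M0 where M0: "M0 \<in> {M \<in> ?S. card M = ?k}" by auto
  let ?key = "\<lambda>M. (deg_total N (\<Union>M), degsum N (\<Union>M), card {e \<in> M. in_triangle N e})"
  let ?r = "inv_image (less_than <*lex*> less_than <*lex*> less_than) ?key"
  have "wf ?r" by (intro wf_inv_image wf_lex_prod wf_less_than)
  then obtain M where M: "M \<in> {M \<in> ?S. card M = ?k}"
    and min: "\<And>M'. (M', M) \<in> ?r \<Longrightarrow> M' \<notin> {M \<in> ?S. card M = ?k}"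
    using wfE_min[OF _ M0] by blast
  interpret extremal V N M "\<Union>M"
  proof unfold_locales
    fix M' assume "mat N M'" "acyc N (\<Union>M')"
    then show "card M' \<le> card M" using M finS by (auto intro: Max_ge)
  next
    fix M' assume "mat N M'" "acyc N (\<Union>M')" "card M' = card M"
    then show "(?key M', ?key M) \<notin> less_than <*lex*> less_than <*lex*> less_than"
      using min[of M'] M by auto
  qed (use assms M in auto)
  show ?thesis using card_V_le mM acF by blast
qed

subsection \<open>Contracting a copy of \<open>K\<^bsub>2,3\<^esub>\<close>\<close>

definition closed_in :: "('a \<Rightarrow> 'a set) \<Rightarrow> 'a set \<Rightarrow> bool" where
  "closed_in N B \<longleftrightarrow> (\<forall>x\<in>B. N x \<subseteq> B)"

text \<open>
  In a subcubic graph the sets satisfying \<open>bad5\<close> are the components isomorphic to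
  \<open>K\<^bsub>2,3\<^esub>\<close> or \<open>K\<^sub>4\<^sup>+\<close>, and those satisfying \<open>bad6\<close> are the components isomorphic to
  \<open>K\<^bsub>3,3\<^esub>\<close>.
\<close>

definition bad5 :: "('a \<Rightarrow> 'a set) \<Rightarrow> 'a set \<Rightarrow> bool" where
  "bad5 N B \<longleftrightarrow> closed_in N B \<and> (\<exists>u c v a b. distinct [u, c, v, a, b] \<and> B = {u, c, v, a, b}
     \<and> {v, a, b} \<subseteq> N u \<and> {v, a, b} \<subseteq> N c)"

definition bad6 :: "('a \<Rightarrow> 'a set) \<Rightarrow> 'a set \<Rightarrow> bool" where
  "bad6 N B \<longleftrightarrow> closed_in N B \<and> (\<exists>u c y v a b. distinct [u, c, y, v, a, b] \<and> B = {u, c, y, v, a, b}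
     \<and> {v, a, b} \<subseteq> N u \<and> {v, a, b} \<subseteq> N c \<and> {v, a, b} \<subseteq> N y)"

text \<open>For a closed set \<open>C\<close> no other neighbourhood meets \<open>C\<close>, so
  emptying the neighbourhoods on \<open>C\<close> is all that deletion requires.\<close>

definition del :: "('a \<Rightarrow> 'a set) \<Rightarrow> 'a set \<Rightarrow> 'a \<Rightarrow> 'a set" where
  "del N C x = (if x \<in> C then {} else N x)"

lemma closed_cong: "(\<And>x. x \<in> B \<Longrightarrow> N' x = N x) \<Longrightarrow> closed_in N' B \<longleftrightarrow> closed_in N B"
  by (simp add: closed_in_def)

lemma bad5_cong:
  assumes "\<And>x. x \<in> B \<Longrightarrow> N' x = N x" shows "bad5 N' B \<longleftrightarrow> bad5 N B"
  unfolding bad5_def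
  by (intro conj_cong closed_cong refl iff_exI) (use assms in auto)

lemma bad6_cong:
  assumes "\<And>x. x \<in> B \<Longrightarrow> N' x = N x" shows "bad6 N' B \<longleftrightarrow> bad6 N B"
  unfolding bad6_def
  by (intro conj_cong closed_cong refl iff_exI) (use assms in auto)

lemma acyc_cong:
  assumes "acyc N' F" "\<And>x. x \<in> F \<Longrightarrow> N x \<inter> F = N' x \<inter> F"
  shows "acyc N F"
proof (rule acycI)
  fix X assume X: "X \<subseteq> F" "X \<noteq> {}" "\<And>x. x \<in> X \<Longrightarrow> 2 \<le> card (N x \<inter> X)"
  obtain x where x: "x \<in> X" "card (N' x \<inter> X) \<le> 1" using acycD[OF assms(1) X(1,2)] .
  have "N x \<inter> X = N' x \<inter> X" using assms(2)[of x] x(1) X(1) by auto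
  then show False using X(3)[OF x(1)] x(2) by simp
qed

lemma mat_mono:
  assumes "mat N' M" "\<And>x y. {x, y} \<in> M \<Longrightarrow> y \<in> N' x \<Longrightarrow> y \<in> N x"
  shows "mat N M"
  unfolding mat_def
proof (intro conjI ballI impI)
  fix e assume e: "e \<in> M"
  obtain x y where "e = {x, y}" "y \<in> N' x" using mat_edgeE[OF assms(1) e] .
  then show "\<exists>x y. e = {x, y} \<and> y \<in> N x" using assms(2) e by (intro exI conjI) auto
next
  fix e f assume "e \<in> M" "f \<in> M" "e \<noteq> f"
  then show "e \<inter> f = {}" by (rule mat_disjoint[OF assms(1)])
qed

context sgraph begin

lemma del_sgraph:
  assumes "closed_in N C" shows "sgraph (V - C) (del N C)"
proof unfold_locales
  have out: "y \<notin> C" if "x \<notin> C" "y \<in> N x" for x y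
    using assms that(1) sym[OF that(2)] unfolding closed_in_def by blast
  fix x y
  show "del N C x \<subseteq> V - C" using N_sub[of x] out[of x] by (auto simp: del_def)
  show "x \<in> del N C y" if "y \<in> del N C x"
    using that out[of x y] sym by (auto simp: del_def split: if_splits)
qed (use finV irrefl in \<open>auto simp: del_def\<close>)

lemma del_combine:
  assumes C: "closed_in N C" and M1: "mat (del N C) M1" "acyc (del N C) (\<Union>M1)"
    and M2: "mat N M2" "acyc N (\<Union>M2)" "\<Union>M2 \<subseteq> C"
  shows "mat N (M1 \<union> M2)" "acyc N (\<Union>(M1 \<union> M2))" "card (M1 \<union> M2) = card M1 + card M2"
proof -
  interpret d: sgraph "V - C" "del N C" by (rule del_sgraph[OF C])
  have U1: "\<Union>M1 \<inter> C = {}" using d.mat_Union_V[OF M1(1)] by blast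
  have m1: "mat N M1" by (rule mat_mono[OF M1(1)]) (auto simp: del_def split: if_splits)
  have a1: "acyc N (\<Union>M1)"
    by (rule acyc_cong[OF M1(2)]) (use U1 in \<open>auto simp: del_def\<close>)
  have dj: "e \<inter> f = {}" if "e \<in> M1" "f \<in> M2" for e f using that U1 M2(3) by blast
  show "mat N (M1 \<union> M2)"
    unfolding mat_def
  proof (intro conjI ballI impI)
    fix e assume "e \<in> M1 \<union> M2"
    then show "\<exists>u v. e = {u, v} \<and> v \<in> N u" using m1 M2(1) unfolding mat_def by (elim UnE) simp_all
  next
    fix e f assume "e \<in> M1 \<union> M2" "f \<in> M1 \<union> M2" "e \<noteq> f"
    then show "e \<inter> f = {}" using mat_disjoint[OF m1, of e f] mat_disjoint[OF M2(1), of e f] dj[of e f] dj[of f e]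
      by (elim UnE) (simp_all add: Int_commute)
  qed
  show "acyc N (\<Union>(M1 \<union> M2))"
    unfolding Union_Un_distrib
  proof (rule acyc_Un[OF a1 M2(2)])
    fix x y assume "x \<in> \<Union>M1" "y \<in> \<Union>M2"
    then show "y \<notin> N x" using U1 M2(3) C sym by (force simp: closed_in_def)
  qed
  have "M1 \<inter> M2 = {}"
  proof (rule ccontr)
    assume "M1 \<inter> M2 \<noteq> {}"
    then obtain e where e: "e \<in> M1" "e \<in> M2" by blast
    obtain u v where "e = {u, v}" using mat_edgeE[OF m1 e(1)] by metis
    then show False using dj[OF e] by simp
  qed
  then show "card (M1 \<union> M2) = card M1 + card M2"
    using finite_mat[OF m1] finite_mat[OF M2(1)] by (rule card_Un_disjoint[rotated 2])
qed

end

locale K23 = sgraph +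
  fixes u c :: 'a and P :: "'a set"
  assumes deg3: "card (N x) \<le> 3"
    and uc: "u \<noteq> c" and Nu: "N u = P" and Nc: "N c = P" and cardP: "card P = 3"
begin

abbreviation "Q \<equiv> insert u (insert c P)"

definition Rim where "Rim = (\<Union>p\<in>P. N p) - Q"

text \<open>The copy \<open>Q\<close> is contracted onto its vertex \<open>u\<close>.\<close>

definition N' where
  "N' x = (if x = u then Rim else if x \<in> Q then {}
     else (N x - P) \<union> (if x \<in> Rim then {u} else {}))"

lemma finP [simp]: "finite P"
  using cardP by (metis card.infinite zero_neq_numeral)

lemma notP: "u \<notin> P" "c \<notin> P"
  using Nu Nc irrefl by metis+

lemma P_nbrs: "p \<in> P \<Longrightarrow> u \<in> N p \<and> c \<in> N p"
  using Nu Nc sym by metis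

lemma P_out:
  assumes "p \<in> P" "y \<in> N p" "y \<noteq> u" "y \<noteq> c" shows "N p = {u, c, y}"
proof -
  have s: "{u, c, y} \<subseteq> N p" using P_nbrs[OF assms(1)] assms(2) by simp
  have "card {u, c, y} = 3" using uc assms by simp
  then show ?thesis using card_seteq[OF finN s] deg3[of p] by simp
qed

lemma outside_nbr: "x \<notin> Q \<Longrightarrow> u \<notin> N x \<and> c \<notin> N x"
  using Nu Nc sym by blast

lemma Rim_iff: "x \<in> Rim \<longleftrightarrow> x \<notin> Q \<and> (\<exists>p\<in>P. p \<in> N x)"
  unfolding Rim_def using sym by blast

lemma N'_u: "N' u = Rim"
  by (simp add: N'_def)

lemma N'_out: "x \<notin> Q \<Longrightarrow> N' x = (N x - P) \<union> (if x \<in> Rim then {u} else {})"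
  by (simp add: N'_def)

lemma N'_Q: "x \<in> Q \<Longrightarrow> x \<noteq> u \<Longrightarrow> N' x = {}"
  by (simp add: N'_def)

lemma QV: "Q \<subseteq> V"
proof -
  have "P \<noteq> {}" using cardP by auto
  then obtain p where "p \<in> P" by blast
  then have "u \<in> V" "c \<in> V" using P_nbrs inV by blast+
  then show ?thesis using N_sub[of u] Nu by blast
qed

lemma N'_sub: "N' x \<subseteq> V - (Q - {u})"
proof -
  have Rim: "Rim \<subseteq> V - Q" using N_sub unfolding Rim_def by blast
  have "u \<in> V" using QV by simp
  moreover have "N x - P \<subseteq> V - (Q - {u})" if "x \<notin> Q" using outside_nbr[OF that] N_sub by blast
  ultimately show ?thesis using Rim unfolding N'_def by (auto split: if_splits)
qed

lemma sgraph': "sgraph (V - (Q - {u})) N'"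
proof unfold_locales
  fix x y
  show "x \<in> N' y" if y: "y \<in> N' x"
  proof (cases "x = u")
    case True
    then have yO: "y \<in> Rim" using y by (simp add: N'_u)
    then have "y \<notin> Q" by (simp add: Rim_iff)
    then show ?thesis using N'_out True yO by simp
  next
    case False
    then have xQ: "x \<notin> Q" using y N'_Q by blast
    show ?thesis
    proof (cases "y = u")
      case True
      then have "x \<in> Rim" using y N'_out[OF xQ] outside_nbr[OF xQ] by (auto split: if_splits)
      then show ?thesis using True by (simp add: N'_u)
    next
      case yu: False
      then have yN: "y \<in> N x" "y \<notin> P" using y N'_out[OF xQ] by (auto split: if_splits)
      then have yQ: "y \<notin> Q" using outside_nbr[OF xQ] by blast
      have "x \<in> N y" "x \<notin> P" using yN xQ sym by auto
      then show ?thesis using N'_out[OF yQ] by simp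
    qed
  qed
  show "x \<notin> N' x"
  proof
    assume h: "x \<in> N' x"
    then consider "x = u" "x \<in> Rim" | "x \<notin> Q" "x \<in> N x" unfolding N'_def by (auto split: if_splits)
    then show False using irrefl by cases (auto simp: Rim_iff)
  qed
qed (use finV N'_sub in auto)

lemma card_V': "card (V - (Q - {u})) + 4 = card V"
proof -
  have "Q - {u} = insert c P" using uc notP by auto
  then have c: "card (Q - {u}) = 4" using notP cardP by simp
  moreover have "Q - {u} \<subseteq> V" using QV by blast
  moreover have "card (Q - {u}) \<le> card V" by (rule card_mono) (use finV QV in auto)
  ultimately show ?thesis using card_Diff_subset[of "Q - {u}" V] finV by simp
qed

text \<open>A vertex of \<open>P\<close> spends two places on \<open>u\<close> and \<open>c\<close>,
  so at most three edges leave the copy. A rim vertex gains \<open>u\<close> but loses at least one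
  neighbour in \<open>P\<close>.\<close>

lemma deg3': "card (N' x) \<le> 3"
proof -
  consider "x = u" | "x \<in> Q" "x \<noteq> u" | "x \<notin> Q" by blast
  then show ?thesis
  proof cases
    case 1
    have "Rim \<subseteq> (\<Union>p\<in>P. N p - {u, c})" unfolding Rim_def by blast
    then have "card Rim \<le> card (\<Union>p\<in>P. N p - {u, c})" by (intro card_mono) auto
    also have "\<dots> \<le> (\<Sum>p\<in>P. card (N p - {u, c}))" by (rule card_UN_le) simp
    also have "\<dots> \<le> (\<Sum>p\<in>P. 1)"
    proof (rule sum_mono)
      fix p assume p: "p \<in> P"
      have "card (N p - {u, c}) = card (N p) - 2"
        using P_nbrs[OF p] uc by (subst card_Diff_subset) auto
      then show "card (N p - {u, c}) \<le> 1" using deg3[of p] by simp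
    qed
    finally show ?thesis using 1 cardP by (simp add: N'_u)
  next
    case 2
    then show ?thesis by (simp add: N'_Q)
  next
    case 3
    show ?thesis
    proof (cases "x \<in> Rim")
      case True
      then obtain p where p: "p \<in> P" "p \<in> N x" using 3 by (auto simp: Rim_iff)
      have "N' x = insert u (N x - P)" using True N'_out[OF 3] by simp
      then have "card (N' x) \<le> Suc (card (N x - P))" by (simp add: card_insert_le_m1 card_insert_if)
      also have "card (N x - P) < card (N x)" using p by (intro psubset_card_mono) auto
      finally show ?thesis using deg3[of x] by simp
    next
      case False
      then have "card (N' x) \<le> card (N x)" using N'_out[OF 3] by (auto intro: card_mono)
      then show ?thesis using deg3[of x] by simp
    qed
  qed
qed

lemma nonisolated':
  assumes "\<And>x. x \<in> V \<Longrightarrow> N x \<noteq> {}" "Rim \<noteq> {}" "x \<in> V - (Q - {u})"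
  shows "N' x \<noteq> {}"
proof (cases "x = u")
  case True
  then show ?thesis using assms(2) by (simp add: N'_u)
next
  case False
  then have x: "x \<in> V" "x \<notin> Q" using assms(3) by auto
  then obtain y where y: "y \<in> N x" using assms(1) by blast
  show ?thesis
  proof (cases "y \<in> P")
    case True
    then have "x \<in> Rim" using x y by (auto simp: Rim_iff)
    then show ?thesis using N'_out[OF x(2)] by simp
  qed (use y N'_out[OF x(2)] in auto)
qed

lemma two_of_pair:
  assumes "2 \<le> card A" "A \<subseteq> {p, q}" shows "p \<in> A \<and> q \<in> A"
proof (rule ccontr)
  assume "\<not> ?thesis"
  then consider "A \<subseteq> {p}" | "A \<subseteq> {q}" using assms(2) by auto
  then have "card A \<le> 1" by cases (rule card_le_1_subset, assumption)+
  then show False using assms(1) by simp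
qed

text \<open>
  The path \<open>v u t\<close> takes the place of the contracted vertex, with \<open>uw\<close> becoming \<open>vw\<close>, so that
  a cycle through it would come from a cycle in the contracted graph.
\<close>

lemma lift_edge:
  assumes M: "mat N' M'" "acyc N' (\<Union>M')" and uw: "{u, w} \<in> M'"
    and v: "v \<in> P" "w \<in> N v" and t: "t \<in> P" "t \<noteq> v" "w \<notin> N t"
  shows "\<exists>M. mat N M \<and> acyc N (\<Union>M) \<and> card M = Suc (card M')"
proof -
  interpret c: sgraph "V - (Q - {u})" N' by (rule sgraph')
  define F' where "F' = \<Union>M'"
  have F'V: "F' \<subseteq> V - (Q - {u})" using c.mat_Union_V[OF M(1)] by (simp add: F'_def)
  have acF': "acyc N' F'" using M(2) by (simp add: F'_def)
  have wO: "w \<in> Rim" using c.mat_edge_nbr[OF M(1) uw] by (simp add: N'_u)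
  then have wQ: "w \<notin> Q" by (simp add: Rim_iff)
  let ?R = "M' - {{u, w}}"
  have U0: "\<Union>?R = F' - {u, w}" using c.Union_remove_edge[OF M(1) uw] by (simp add: F'_def)
  have m0: "mat N ?R"
  proof (rule mat_mono[OF c.mat_subset[OF M(1) Diff_subset]])
    fix x y assume xy: "{x, y} \<in> ?R" "y \<in> N' x"
    then have "x \<notin> {u, w}" "y \<notin> {u, w}" using U0 by blast+
    then show "y \<in> N x" using xy(2) unfolding N'_def by (auto split: if_splits)
  qed
  have PF: "p \<notin> F'" if "p \<in> P" for p using that F'V notP by auto
  have uF: "u \<in> F'" "w \<in> F'" using uw by (auto simp: F'_def)
  have ne: "v \<noteq> u" "v \<noteq> w" "t \<noteq> u" "t \<noteq> w" "w \<noteq> u" using v t notP wQ by auto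
  have m1: "mat N (insert {v, w} ?R)"
    by (rule mat_insert[OF m0]) (use v PF U0 in auto)
  have m2: "mat N (insert {u, t} (insert {v, w} ?R))"
    by (rule mat_insert[OF m1]) (use t ne Nu PF U0 in auto)
  let ?M = "insert {u, t} (insert {v, w} ?R)"
  have fin: "finite M'" using c.finite_mat[OF M(1)] .
  have notM: "{p, q} \<notin> M'" if "p \<in> P" for p q
    using PF[OF that] UnionI[of "{p, q}" M' p] unfolding F'_def by (meson insertI1)
  have "{v, w} \<notin> M'" by (rule notM[OF v(1)])
  then have "{v, w} \<notin> ?R" by blast
  moreover have "{u, t} \<notin> M'" using notM[OF t(1), of u] by (simp add: insert_commute)
  then have "{u, t} \<notin> insert {v, w} ?R" using ne t(2) by (simp add: doubleton_eq_iff)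
  moreover have "Suc (card ?R) = card M'" using card_Suc_Diff1[OF fin uw] .
  moreover have "finite ?R" using fin by simp
  ultimately have cM: "card ?M = Suc (card M')"
    by (metis card_insert_disjoint finite_insert)
  define F where "F = F' \<union> {v, t}"
  have UF: "\<Union>?M = F" using U0 uF by (auto simp: F_def)
  have Nv: "N v = {u, c, w}" using P_out[OF v] ne wQ by auto
  have cF: "c \<notin> F" using F'V uc notP v t unfolding F_def by auto
  have NuF: "N u \<inter> F \<subseteq> {v, t}" using Nu PF unfolding F_def by auto
  have "acyc N F"
  proof (rule acycI)
    fix X assume X: "X \<subseteq> F" "X \<noteq> {}" and deg: "\<And>x. x \<in> X \<Longrightarrow> 2 \<le> card (N x \<inter> X)"
    have cX: "c \<notin> X" using cF X(1) by blast
    have two: "p \<in> X \<and> q \<in> X" if "x \<in> X" "N x \<inter> X \<subseteq> {p, q}" for x p q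
      using two_of_pair[OF deg[OF that(1)] that(2)] by simp
    have v2: "u \<in> X \<and> w \<in> X" if "v \<in> X" by (rule two[OF that]) (use Nv cX in auto)
    have u2: "v \<in> X \<and> t \<in> X" if "u \<in> X" by (rule two[OF that]) (use NuF X in blast)
    have t2: "\<exists>s. s \<in> X \<and> u \<in> X \<and> N t = {u, c, s} \<and> s \<noteq> u \<and> s \<noteq> c" if "t \<in> X"
    proof -
      have "\<not> N t \<subseteq> {u, c}"
      proof
        assume "N t \<subseteq> {u, c}"
        then have "N t \<inter> X \<subseteq> {u}" using cX by auto
        then have "card (N t \<inter> X) \<le> 1" by (rule card_le_1_subset)
        then show False using deg[OF that] by simp
      qed
      then obtain s where s: "s \<in> N t" "s \<noteq> u" "s \<noteq> c" by blast
      then have Nt: "N t = {u, c, s}" using P_out[OF t(1)] by blast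
      have "s \<in> X \<and> u \<in> X" by (rule two[OF that]) (use Nt cX in auto)
      then show ?thesis using Nt s by blast
    qed
    show False
    proof (cases "X \<inter> {u, v, t} = {}")
      case True
      then have XF: "X \<subseteq> F' - {u}" using X(1) unfolding F_def by auto
      obtain x where x: "x \<in> X" "card (N' x \<inter> X) \<le> 1"
        using acycD[OF acF' _ X(2)] XF by blast
      have "x \<notin> Q" using x(1) XF F'V by blast
      then have "N x \<inter> X \<subseteq> N' x \<inter> X" using XF PF N'_out by blast
      then have "card (N x \<inter> X) \<le> card (N' x \<inter> X)" by (intro card_mono) (auto intro: c.finN)
      then show False using deg[OF x(1)] x(2) by simp
    next
      case False
      \<comment> \<open>The degree conditions propagate along the path: one of \<open>u\<close>,
        \<open>v\<close>, \<open>t\<close> in \<open>X\<close> brings in the others and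
        \<open>w\<close>.\<close>
      then have all: "u \<in> X" "v \<in> X" "t \<in> X" "w \<in> X" using v2 u2 t2 by blast+
      obtain s where s: "s \<in> X" "N t = {u, c, s}" "s \<noteq> u" "s \<noteq> c" using t2[OF all(3)] by blast
      have sP: "s \<notin> P"
      proof
        assume sP: "s \<in> P"
        then have "s = v \<or> s = t" using s(1) X(1) PF unfolding F_def by blast
        moreover have "t \<notin> N v" using Nv ne t(1) notP by auto
        ultimately show False using s(2) irrefl sym by blast
      qed
      have sw: "s \<noteq> w" using t(3) s(2) by blast
      have sO: "s \<in> Rim" using sP s t(1) sym[of s t] by (auto simp: Rim_iff)
      \<comment> \<open>\<open>?X\<close> violates acyclicity in the contracted graph:
        \<open>u\<close> has the neighbours \<open>w\<close> and \<open>s\<close>, distinct because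
        \<open>t\<close> is not adjacent to \<open>w\<close>, and any other vertex loses at most one
        of \<open>v\<close>, \<open>t\<close> and then gains \<open>u\<close>.\<close>
      let ?X = "X - {v, t}"
      have XF: "?X \<subseteq> F'" using X(1) unfolding F_def by blast
      have "?X \<noteq> {}" using all ne by blast
      then obtain x where x: "x \<in> ?X" "card (N' x \<inter> ?X) \<le> 1"
        using acycD[OF acF' XF] by blast
      have sX: "s \<in> ?X" "w \<in> ?X" using s all sP v t ne by auto
      show False
      proof (cases "x = u")
        case True
        have "{w, s} \<subseteq> N' x \<inter> ?X" using True N'_u wO sO sX by auto
        then have "card {w, s} \<le> card (N' x \<inter> ?X)" by (intro card_mono) auto
        then show False using x(2) sw by simp
      next
        case xu: False
        have xQ: "x \<notin> Q" using x(1) XF F'V xu by blast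
        have sub: "N x \<inter> X - {v, t} \<subseteq> N' x \<inter> ?X - {u}"
        proof
          fix y assume y: "y \<in> N x \<inter> X - {v, t}"
          have "y \<notin> P" using y X(1) PF unfolding F_def by blast
          moreover have "y \<noteq> u" using y outside_nbr[OF xQ] by blast
          ultimately show "y \<in> N' x \<inter> ?X - {u}" using y N'_out[OF xQ] by auto
        qed
        show False
        proof (cases "v \<in> N x \<or> t \<in> N x")
          case True
          have vx: "x = w" if "v \<in> N x" using sym[OF that] Nv xQ by auto
          have tx: "x = s" if "t \<in> N x" using sym[OF that] s(2) xQ by auto
          have "card (N x \<inter> {v, t}) \<le> 1"
          proof (rule ccontr)
            assume "\<not> ?thesis"
            then have "2 \<le> card (N x \<inter> {v, t})" by linarith
            then have "v \<in> N x \<inter> {v, t} \<and> t \<in> N x \<inter> {v, t}" by (rule two_of_pair) (rule Int_lower2)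
            then have "v \<in> N x" and "t \<in> N x" by simp_all
            from vx[OF this(1)] tx[OF this(2)] sw show False by simp
          qed
          moreover have "card (N x \<inter> X) \<le> card (N x \<inter> X - {v, t}) + card (N x \<inter> {v, t})"
          proof -
            have "N x \<inter> X \<subseteq> (N x \<inter> X - {v, t}) \<union> (N x \<inter> {v, t})" by blast
            then have "card (N x \<inter> X) \<le> card ((N x \<inter> X - {v, t}) \<union> (N x \<inter> {v, t}))"
              by (intro card_mono) auto
            also have "\<dots> \<le> card (N x \<inter> X - {v, t}) + card (N x \<inter> {v, t})" by (rule card_Un_le)
            finally show ?thesis .
          qed
          moreover have "card (N x \<inter> X - {v, t}) \<le> card (N' x \<inter> ?X - {u})"
            using sub by (intro card_mono) auto
          moreover have "u \<in> N' x \<inter> ?X"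
            using True v(1) t(1) xQ all ne N'_out[OF xQ] by (auto simp: Rim_iff)
          then have "card (N' x \<inter> ?X - {u}) + 1 = card (N' x \<inter> ?X)"
            by (metis Suc_eq_plus1 c.finN card_Suc_Diff1 finite_Int)
          ultimately show False using deg[of x] x by simp
        next
          case False
          then have "N x \<inter> X \<subseteq> N' x \<inter> ?X" using sub by blast
          then have "card (N x \<inter> X) \<le> card (N' x \<inter> ?X)" by (intro card_mono) auto
          then show False using deg[of x] x by simp
        qed
      qed
    qed
  qed
  then show ?thesis using m2 cM UF by (intro exI[of _ ?M]) simp
qed

text \<open>The whole copy is available. A vertex \<open>a\<close> of \<open>P\<close> has at most
  one neighbour outside the copy, so \<open>a\<close> is added as a leaf to the old forest and then
  \<open>u\<close> as a leaf at \<open>a\<close>.\<close>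

lemma lift_unused:
  assumes M: "mat N' M'" "acyc N' (\<Union>M')" and u: "u \<notin> \<Union>M'"
  shows "\<exists>M. mat N M \<and> acyc N (\<Union>M) \<and> card M = Suc (card M')"
proof -
  interpret c: sgraph "V - (Q - {u})" N' by (rule sgraph')
  define F' where "F' = \<Union>M'"
  have uF: "u \<notin> F'" using u by (simp add: F'_def)
  have F'V: "F' \<inter> Q = {}" using c.mat_Union_V[OF M(1)] uF unfolding F'_def by blast
  have m: "mat N M'"
  proof (rule mat_mono[OF M(1)])
    fix x y assume "{x, y} \<in> M'" "y \<in> N' x"
    moreover from this have "x \<noteq> u" "y \<noteq> u" using u by auto
    ultimately show "y \<in> N x" unfolding N'_def by (auto split: if_splits)
  qed
  have ac: "acyc N F'"
  proof (rule acyc_cong[of N'])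
    show "acyc N' F'" using M(2) by (simp add: F'_def)
  next
    fix x assume x: "x \<in> F'"
    then have xQ: "x \<notin> Q" using F'V by blast
    show "N x \<inter> F' = N' x \<inter> F'" unfolding N'_out[OF xQ] using F'V by auto
  qed
  have "P \<noteq> {}" using cardP by auto
  then obtain a where a: "a \<in> P" by blast
  have ua: "u \<noteq> a" using a notP by auto
  have m2: "mat N (insert {u, a} M')"
    by (rule mat_insert[OF m]) (use Nu a F'V uF in \<open>auto simp: F'_def\<close>)
  have "{u, a} \<notin> M'" using u by auto
  then have "card (insert {u, a} M') = Suc (card M')" using c.finite_mat[OF M(1)] by simp
  moreover have "\<exists>y. N a \<inter> F' \<subseteq> {y}"
  proof (cases "N a \<inter> F' = {}")
    case False
    then obtain y where y: "y \<in> N a" "y \<in> F'" by blast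
    then have "N a = {u, c, y}" using P_out[OF a, of y] F'V by blast
    then show ?thesis using F'V by blast
  qed simp
  then have "acyc N (insert a F')" using acyc_insert_leaf'[OF ac] by blast
  then have "acyc N (insert u (insert a F'))"
    by (rule acyc_insert_leaf'[where y = a]) (use Nu F'V in auto)
  then have "acyc N (\<Union>(insert {u, a} M'))" by (simp add: F'_def)
  ultimately show ?thesis using m2 by blast
qed

text \<open>A suitable \<open>t\<close> for \<open>lift_edge\<close> is missing only if all of
  \<open>P\<close> is adjacent to \<open>w\<close>; then \<open>u\<close>, \<open>c\<close>,
  \<open>w\<close> and \<open>P\<close> form a component K_{3,3}.\<close>

lemma lift:
  assumes M: "mat N' M'" "acyc N' (\<Union>M')" and no6: "\<And>B. \<not> bad6 N B"
  shows "\<exists>M. mat N M \<and> acyc N (\<Union>M) \<and> card M = Suc (card M')"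
proof (cases "u \<in> \<Union>M'")
  case False
  then show ?thesis using lift_unused[OF M] by blast
next
  case True
  interpret c: sgraph "V - (Q - {u})" N' by (rule sgraph')
  obtain w where w: "{u, w} \<in> M'" "w \<in> N' u" using c.partner[OF M(1) True] .
  have wO: "w \<in> Rim" using w by (simp add: N'_u)
  then obtain v where v: "v \<in> P" "w \<in> N v" using sym by (auto simp: Rim_iff)
  have wQ: "w \<notin> Q" using wO by (simp add: Rim_iff)
  have "\<exists>t\<in>P - {v}. w \<notin> N t"
  proof (rule ccontr)
    assume "\<not> ?thesis"
    then have all: "w \<in> N t" if "t \<in> P" for t using that v by blast
    then have "P \<subseteq> N w" using sym by blast
    then have Nw: "N w = P" using card_seteq[of "N w" P] deg3[of w] cardP by simp
    obtain a b d where P: "P = {a, b, d}" "a \<noteq> b" "a \<noteq> d" "b \<noteq> d" using cardP by (auto simp: card_3_iff)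
    have "N p = {u, c, w}" if "p \<in> P" for p using P_out[OF that all[OF that]] wQ by blast
    then have "closed_in N {u, c, w, a, b, d}"
      using P Nu Nc Nw by (auto simp: closed_in_def)
    moreover have "distinct [u, c, w, a, b, d]" using P uc notP wQ by auto
    ultimately have "bad6 N {u, c, w, a, b, d}"
      unfolding bad6_def using Nu Nc Nw P by blast
    then show False using no6 by blast
  qed
  then obtain t where "t \<in> P" "t \<noteq> v" "w \<notin> N t" by blast
  then show ?thesis using lift_edge[OF M w(1) v] by blast
qed

end

section \<open>Exceptional components, and matchings for those created by contraction\<close>

lemma bad5E:
  assumes "bad5 N B"
  obtains u c v a b where "distinct [u, c, v, a, b]" "B = {u, c, v, a, b}"
    "{v, a, b} \<subseteq> N u" "{v, a, b} \<subseteq> N c"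
  using assms unfolding bad5_def by (elim conjE exE) (rule that; assumption)

lemma bad6E:
  assumes "bad6 N B"
  obtains u c y v a b where "distinct [u, c, y, v, a, b]" "B = {u, c, y, v, a, b}"
    "{v, a, b} \<subseteq> N u" "{v, a, b} \<subseteq> N c" "{v, a, b} \<subseteq> N y"
  using assms unfolding bad6_def by (elim conjE exE) (rule that; assumption)

lemma bad_closed: "bad5 N B \<or> bad6 N B \<Longrightarrow> closed_in N B"
  by (auto simp: bad5_def bad6_def)

context sgraph begin

lemma bad_nbr:
  assumes "bad5 N B \<or> bad6 N B" "x \<in> B" shows "N x \<noteq> {}"
  using assms(1)
proof
  assume "bad5 N B"
  then obtain u c v a b where B: "distinct [u, c, v, a, b]" "B = {u, c, v, a, b}"
    "{v, a, b} \<subseteq> N u" "{v, a, b} \<subseteq> N c" by (rule bad5E)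
  have "u \<in> N v" "u \<in> N a" "u \<in> N b" by (rule sym, use B(3) in simp)+
  then show ?thesis using B assms(2) by auto
next
  assume "bad6 N B"
  then obtain u c y v a b where B: "distinct [u, c, y, v, a, b]" "B = {u, c, y, v, a, b}"
    "{v, a, b} \<subseteq> N u" "{v, a, b} \<subseteq> N c" "{v, a, b} \<subseteq> N y" by (rule bad6E)
  have "u \<in> N v" "u \<in> N a" "u \<in> N b" by (rule sym, use B(3) in simp)+
  then show ?thesis using B assms(2) by auto
qed

text \<open>Vertices of a bad set have neighbours, so the set avoids \<open>C\<close>, and outside
  \<open>C\<close> the neighbourhoods are unchanged.\<close>

lemma del_bad:
  assumes C: "closed_in N C" and bad: "bad5 (del N C) B \<or> bad6 (del N C) B"
  shows "bad5 (del N C) B \<longleftrightarrow> bad5 N B" "bad6 (del N C) B \<longleftrightarrow> bad6 N B" "B \<inter> C = {}"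
proof -
  interpret d: sgraph "V - C" "del N C" by (rule del_sgraph[OF C])
  show dj: "B \<inter> C = {}"
  proof (rule ccontr)
    assume "B \<inter> C \<noteq> {}"
    then obtain x where "x \<in> B" "x \<in> C" by blast
    then show False using d.bad_nbr[OF bad \<open>x \<in> B\<close>] by (simp add: del_def)
  qed
  have "del N C x = N x" if "x \<in> B" for x using that dj by (auto simp: del_def)
  then show "bad5 (del N C) B \<longleftrightarrow> bad5 N B" "bad6 (del N C) B \<longleftrightarrow> bad6 N B"
    by (rule bad5_cong bad6_cong, simp)+
qed

text \<open>The vertices are inserted in the given order, each as a leaf: it may be adjacent only to
  its immediate predecessor among those before it. The first, third and fifth links form the
  matching.\<close>

lemma path6:
  assumes d: "distinct [p, q, r, s, t, w]" and e: "q \<in> N p" "s \<in> N r" "w \<in> N t"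
    and i: "N r \<inter> {p, q} \<subseteq> {q}" "N s \<inter> {p, q, r} \<subseteq> {r}" "N t \<inter> {p, q, r, s} \<subseteq> {s}"
      "N w \<inter> {p, q, r, s, t} \<subseteq> {t}"
  shows "\<exists>M. mat N M \<and> acyc N (\<Union>M) \<and> card M = 3 \<and> \<Union>M = {p, q, r, s, t, w}"
proof -
  let ?M = "{{p, q}, {r, s}, {t, w}}"
  have U: "\<Union>?M = {p, q, r, s, t, w}" by auto
  have "mat N {}" by (simp add: mat_def)
  then have "mat N {{t, w}}" using mat_insert[OF _ e(3)] by simp
  then have "mat N {{r, s}, {t, w}}" using mat_insert[OF _ e(2), of "{{t, w}}"] d by simp
  then have m: "mat N ?M" using mat_insert[OF _ e(1), of "{{r, s}, {t, w}}"] d by simp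
  have "acyc N {p}" using acyc_insert_leaf'[OF acyc_empty, of p p] by simp
  then have "acyc N {q, p}" by (rule acyc_insert_leaf'[where y = p]) auto
  then have "acyc N {r, q, p}" by (rule acyc_insert_leaf'[where y = q]) (use i in auto)
  then have "acyc N {s, r, q, p}" by (rule acyc_insert_leaf'[where y = r]) (use i in auto)
  then have "acyc N {t, s, r, q, p}" by (rule acyc_insert_leaf'[where y = s]) (use i in auto)
  then have "acyc N {w, t, s, r, q, p}" by (rule acyc_insert_leaf'[where y = t]) (use i in auto)
  moreover have "{w, t, s, r, q, p} = {p, q, r, s, t, w}" by auto
  ultimately have ac: "acyc N (\<Union>?M)" unfolding U by simp
  have "card {p, q, r, s, t, w} = 6" using d by simp
  then have "card ?M = 3" using card_Union_mat[OF m] unfolding U by simp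
  then show ?thesis using m ac U by (intro exI[of _ ?M]) blast
qed

end

context K23 begin

lemma N'_sym: "y \<in> N' x \<Longrightarrow> x \<in> N' y"
  using sgraph.sym[OF sgraph'] .

lemma N'_neq: "y \<in> N' x \<Longrightarrow> x \<noteq> y"
  using sgraph.neq[OF sgraph'] .

lemma N'_notQ: "y \<in> N' x \<Longrightarrow> x \<noteq> u \<Longrightarrow> x \<notin> Q"
  using N'_Q by blast

lemma N'_N: "y \<in> N' x \<Longrightarrow> x \<noteq> u \<Longrightarrow> y \<noteq> u \<Longrightarrow> y \<in> N x"
  unfolding N'_def by (auto split: if_splits)

text \<open>A set closed under \<open>N'\<close> that misses \<open>u\<close> contains no rim
  vertex, and away from the rim and the copy the contraction changes no neighbourhood.\<close>

lemma bad_outside: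
  assumes "bad5 N' B \<or> bad6 N' B" "u \<notin> B" shows "bad5 N B \<or> bad6 N B"
proof -
  interpret c: sgraph "V - (Q - {u})" N' by (rule sgraph')
  have "closed_in N' B" using bad_closed[OF assms(1)] .
  have "N' x = N x" if x: "x \<in> B" for x
  proof -
    have xu: "x \<noteq> u" using x assms(2) by blast
    have xQ: "x \<notin> Q" using c.bad_nbr[OF assms(1) x] N'_Q xu by blast
    have "u \<notin> N' x" using \<open>closed_in N' B\<close> x assms(2) by (auto simp: closed_in_def)
    then have nR: "x \<notin> Rim" unfolding N'_out[OF xQ] by (simp split: if_splits)
    then have "N x - P = N x" unfolding Rim_iff using xQ by blast
    then show ?thesis unfolding N'_out[OF xQ] using nR by simp
  qed
  then show ?thesis using assms(1) bad5_cong[of B N' N] bad6_cong[of B N' N] by blast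
qed

lemma rim_P:
  assumes "t \<in> N' u" obtains p where "p \<in> P" "t \<in> N p" "N p = {u, c, t}" "t \<notin> Q"
proof -
  have R: "t \<in> Rim" using assms N'_u by simp
  then obtain p where p: "p \<in> P" "p \<in> N t" "t \<notin> Q" by (auto simp: Rim_iff)
  have "N p = {u, c, t}" using P_out[OF p(1) sym[OF p(2)]] p(3) by auto
  then show thesis using that[OF p(1) sym[OF p(2)]] p(3) by blast
qed

text \<open>The contracted vertex is one of two vertices with three common neighbours. Let
  \<open>p\<close> and \<open>q\<close> be the vertices of \<open>P\<close> adjacent to
  \<open>t3\<close> and \<open>t1\<close>; then \<open>p u q t1 y t2\<close> is an induced
  path.\<close>

lemma three_edges_hub_aux:
  assumes t: "{t1, t2, t3} \<subseteq> N' u" "t1 \<noteq> t2" "t1 \<noteq> t3" "t2 \<noteq> t3"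
    and y: "{t1, t2, t3} \<subseteq> N' y" "y \<noteq> u" and na: "t2 \<notin> N t1"
  shows "\<exists>M. mat N M \<and> acyc N (\<Union>M) \<and> card M = 3 \<and> \<Union>M \<subseteq> Q \<union> {t1, t2, t3, y}"
proof -
  have tu: "t1 \<noteq> u" "t2 \<noteq> u" "t3 \<noteq> u" using t(1) N'_neq by auto
  have yQ: "y \<notin> Q" using N'_notQ[of t1 y] y by simp
  have yN: "t1 \<in> N y" "t2 \<in> N y" "t3 \<in> N y" using y tu N'_N by auto
  have Ny: "N y = {t1, t2, t3}"
  proof -
    have "card {t1, t2, t3} = 3" using t by simp
    then show ?thesis using card_seteq[of "N y" "{t1, t2, t3}"] deg3[of y] yN by simp
  qed
  have tn: "t1 \<in> N' u" "t2 \<in> N' u" "t3 \<in> N' u" using t by auto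
  obtain q where q: "q \<in> P" "t1 \<in> N q" "N q = {u, c, t1}" "t1 \<notin> Q" using rim_P[OF tn(1)] .
  have t2Q: "t2 \<notin> Q" using tn(2) unfolding N'_u Rim_iff by blast
  obtain p where p: "p \<in> P" "t3 \<in> N p" "N p = {u, c, t3}" "t3 \<notin> Q" using rim_P[OF tn(3)] .
  have pq: "p \<noteq> q" using p q t t2Q by auto
  have yt: "y \<noteq> t1" "y \<noteq> t2" using yN neq by auto
  have not: "p \<notin> N t1" "p \<notin> N t2" "q \<notin> N t2" "t1 \<notin> N t2" "u \<notin> N t1" "u \<notin> N t2"
  proof -
    show "p \<notin> N t1" "p \<notin> N t2" using sym[of p t1] sym[of p t2] p q(4) t2Q t by auto
    show "q \<notin> N t2" using sym[of q t2] q t2Q t by auto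
    show "t1 \<notin> N t2" using na sym by blast
    show "u \<notin> N t1" "u \<notin> N t2" using outside_nbr q(4) t2Q by blast+
  qed
  have "\<exists>M. mat N M \<and> acyc N (\<Union>M) \<and> card M = 3 \<and> \<Union>M = {p, u, q, t1, y, t2}"
  proof (rule path6)
    show "distinct [p, u, q, t1, y, t2]" using p q pq yQ yt t t2Q notP by auto
    show "u \<in> N p" "t1 \<in> N q" "t2 \<in> N y" using p q yN by auto
    show "N q \<inter> {p, u} \<subseteq> {u}" using q(3,4) p(1) notP by auto
    show "N t1 \<inter> {p, u, q} \<subseteq> {q}" using not by auto
    show "N y \<inter> {p, u, q, t1} \<subseteq> {t1}" using Ny p(1) q t2Q p(4) notP by auto
    show "N t2 \<inter> {p, u, q, t1, y} \<subseteq> {y}" using not by auto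
  qed
  then obtain M where "mat N M" "acyc N (\<Union>M)" "card M = 3" "\<Union>M = {p, u, q, t1, y, t2}" by blast
  then show ?thesis using p(1) q(1) by (intro exI[of _ M]) auto
qed

text \<open>If \<open>t1\<close> is adjacent to \<open>t2\<close>, its three places are taken by
  \<open>t2\<close>, \<open>y\<close> and a vertex of \<open>P\<close>. Hence it is not adjacent to
  \<open>t3\<close>, and \<open>t2\<close> and \<open>t3\<close> can be interchanged.\<close>

lemma three_edges_hub:
  assumes t: "{t1, t2, t3} \<subseteq> N' u" "t1 \<noteq> t2" "t1 \<noteq> t3" "t2 \<noteq> t3"
    and y: "{t1, t2, t3} \<subseteq> N' y" "y \<noteq> u"
  shows "\<exists>M. mat N M \<and> acyc N (\<Union>M) \<and> card M = 3 \<and> \<Union>M \<subseteq> Q \<union> {t1, t2, t3, y}"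
proof (cases "t2 \<in> N t1")
  case False
  then show ?thesis using three_edges_hub_aux[OF assms] by blast
next
  case True
  have tu: "t1 \<noteq> u" "t1 \<in> N' u" using t(1) N'_neq by auto
  have yQ: "y \<notin> Q" using N'_notQ[of t1 y] y by simp
  obtain q where q: "q \<in> P" "t1 \<in> N q" using rim_P[OF tu(2)] .
  have "t2 \<in> N' u" "t3 \<in> N' u" using t(1) by auto
  then have t3Q: "t3 \<notin> Q" "t2 \<notin> Q" unfolding N'_u Rim_iff by blast+
  have yt: "y \<in> N t1" "y \<noteq> t2" "y \<noteq> t3"
    using y tu sym[OF N'_N[of t1 y]] N'_neq[of t2 y] N'_neq[of t3 y] by auto
  have na: "t3 \<notin> N t1"
  proof
    assume "t3 \<in> N t1"
    then have "{q, y, t2, t3} \<subseteq> N t1" using True sym[OF q(2)] yt by simp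
    then have "card {q, y, t2, t3} \<le> card (N t1)" by (intro card_mono) auto
    moreover have "q \<noteq> y" "q \<noteq> t2" "q \<noteq> t3" using yQ q(1) t3Q by auto
    then have "card {q, y, t2, t3} = 4" using t(4) yt(2,3) by simp
    ultimately show False using deg3[of t1] by simp
  qed
  have "{t1, t3, t2} = {t1, t2, t3}" by auto
  then show ?thesis
    using three_edges_hub_aux[of t1 t3 t2 y] t y na by (simp add: insert_commute)
qed

text \<open>The contracted vertex is a common neighbour of \<open>p\<close> and \<open>q\<close>.
  With \<open>\<alpha>\<close>, \<open>\<beta>\<close> in \<open>P\<close> adjacent to
  \<open>p\<close>, \<open>q\<close> and \<open>\<gamma>\<close> the third vertex of
  \<open>P\<close>, the path is \<open>\<gamma> u \<alpha> p r q\<close>. As \<open>\<gamma>\<close>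
  has at most one neighbour outside the copy, one of \<open>r1\<close>, \<open>r2\<close> is not
  adjacent to it and serves as \<open>r\<close>.\<close>

lemma three_edges_spoke:
  assumes p: "{u, r1, r2} \<subseteq> N' p" and q: "{u, r1, r2} \<subseteq> N' q"
    and d: "distinct [p, q, u, r1, r2]"
  shows "\<exists>M. mat N M \<and> acyc N (\<Union>M) \<and> card M = 3 \<and> \<Union>M \<subseteq> Q \<union> {p, q, r1, r2}"
proof -
  have pq: "p \<in> N' u" "q \<in> N' u" using p q N'_sym[of u p] N'_sym[of u q] by simp_all
  obtain \<alpha> where a: "\<alpha> \<in> P" "p \<in> N \<alpha>" "N \<alpha> = {u, c, p}" "p \<notin> Q" using rim_P[OF pq(1)] .
  obtain \<beta> where b: "\<beta> \<in> P" "q \<in> N \<beta>" "N \<beta> = {u, c, q}" "q \<notin> Q" using rim_P[OF pq(2)] .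
  have ab: "\<alpha> \<noteq> \<beta>" using a b d by auto
  have rN: "r1 \<in> N p" "r2 \<in> N p" "r1 \<in> N q" "r2 \<in> N q" using p q d N'_N by auto
  have "r1 \<in> N' p" "r2 \<in> N' p" using p by auto
  then have rQ: "r1 \<notin> Q" "r2 \<notin> Q"
    using N'_notQ[OF N'_sym[of r1 p]] N'_notQ[OF N'_sym[of r2 p]] d by auto
  have Np: "N p = {\<alpha>, r1, r2}"
  proof -
    have "\<alpha> \<in> N p" using a sym by blast
    moreover have "\<alpha> \<noteq> r1" "\<alpha> \<noteq> r2" "r1 \<noteq> r2" using a(1) rQ d by auto
    then have "card {\<alpha>, r1, r2} = 3" by simp
    ultimately show ?thesis using card_seteq[of "N p" "{\<alpha>, r1, r2}"] deg3[of p] rN by simp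
  qed
  have Nq: "N q = {\<beta>, r1, r2}"
  proof -
    have "\<beta> \<in> N q" using b sym by blast
    moreover have "\<beta> \<noteq> r1" "\<beta> \<noteq> r2" "r1 \<noteq> r2" using b(1) rQ d by auto
    then have "card {\<beta>, r1, r2} = 3" by simp
    ultimately show ?thesis using card_seteq[of "N q" "{\<beta>, r1, r2}"] deg3[of q] rN by simp
  qed
  have "card (P - {\<alpha>, \<beta>}) = 1" using cardP a b ab by simp
  then obtain \<gamma> where "P - {\<alpha>, \<beta>} = {\<gamma>}" by (auto simp: card_1_singleton_iff)
  then have g: "\<gamma> \<in> P" "\<gamma> \<noteq> \<alpha>" "\<gamma> \<noteq> \<beta>" by auto
  obtain r where r: "r = r1 \<or> r = r2" "r \<notin> N \<gamma>"
  proof (cases "r1 \<in> N \<gamma>")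
    case True
    then have "N \<gamma> = {u, c, r1}" using P_out[OF g(1), of r1] rQ by auto
    then have "r2 \<notin> N \<gamma>" using rQ d by auto
    then show thesis using that by blast
  qed (use that in blast)
  have rr: "r \<notin> Q" "r \<in> N p" "r \<in> N q" "r \<noteq> p" "r \<noteq> q" using r rQ rN d by auto
  have pQ: "p \<noteq> q" "p \<notin> P" "q \<notin> P" "r \<notin> P" "p \<noteq> u" "q \<noteq> u" "r \<noteq> u" using a b rr d by auto
  have "\<exists>M. mat N M \<and> acyc N (\<Union>M) \<and> card M = 3 \<and> \<Union>M = {\<gamma>, u, \<alpha>, p, r, q}"
  proof (rule path6)
    show "distinct [\<gamma>, u, \<alpha>, p, r, q]" using g a(1) pQ rr notP by auto
    show "u \<in> N \<gamma>" "p \<in> N \<alpha>" "q \<in> N r" using P_nbrs[OF g(1)] a(2) sym[OF rr(3)] by simp_all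
    show "N \<alpha> \<inter> {\<gamma>, u} \<subseteq> {u}" using a(3) g(1) pQ notP by auto
    show "N p \<inter> {\<gamma>, u, \<alpha>} \<subseteq> {\<alpha>}" using Np g rQ notP a(1) by auto
    show "N r \<inter> {\<gamma>, u, \<alpha>, p} \<subseteq> {p}"
    proof -
      have "\<gamma> \<notin> N r" "\<alpha> \<notin> N r" "u \<notin> N r"
        using r(2) sym[of \<gamma> r] sym[of \<alpha> r] a(3) rr outside_nbr[OF rr(1)] by auto
      then show ?thesis by auto
    qed
    show "N q \<inter> {\<gamma>, u, \<alpha>, p, r} \<subseteq> {r}"
    proof -
      have "\<gamma> \<notin> N q" "\<alpha> \<notin> N q" "u \<notin> N q" using Nq g rQ ab a(1) b(1) notP by auto
      moreover have "p \<notin> N q" using Nq b(1) pQ d by auto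
      ultimately show ?thesis by auto
    qed
  qed
  then obtain M where "mat N M" "acyc N (\<Union>M)" "card M = 3" "\<Union>M = {\<gamma>, u, \<alpha>, p, r, q}" by blast
  then show ?thesis using g(1) a(1) r(1) by (intro exI[of _ M]) auto
qed

text \<open>
  Contraction may create an exceptional component; its preimage has at most ten vertices, and it has
  an acyclic matching of size three that spans an induced path.
\<close>

lemma bad_hub:
  assumes bad: "bad5 N' B \<or> bad6 N' B" and u: "u \<in> B"
  shows "\<exists>M. mat N M \<and> acyc N (\<Union>M) \<and> card M = 3 \<and> \<Union>M \<subseteq> B \<union> Q"
  using bad
proof
  assume "bad5 N' B"
  then obtain x1 x2 y1 y2 y3 where d: "distinct [x1, x2, y1, y2, y3]" and B: "B = {x1, x2, y1, y2, y3}"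
    and x: "{y1, y2, y3} \<subseteq> N' x1" "{y1, y2, y3} \<subseteq> N' x2"
    by (rule bad5E)
  have sub: "\<exists>M. mat N M \<and> acyc N (\<Union>M) \<and> card M = 3 \<and> \<Union>M \<subseteq> B \<union> Q"
    if h: "\<exists>M. mat N M \<and> acyc N (\<Union>M) \<and> card M = 3 \<and> \<Union>M \<subseteq> Q \<union> C" "C \<subseteq> B" for C
  proof -
    obtain M where M: "mat N M" "acyc N (\<Union>M)" "card M = 3" "\<Union>M \<subseteq> Q \<union> C"
      using h(1) by (elim conjE exE)
    have "\<Union>M \<subseteq> B \<union> Q" using M(4) h(2) by (auto dest!: subsetD)
    then show ?thesis using M(1-3) by (intro exI[of _ M] conjI)
  qed
  consider "u = x1" | "u = x2" | "u = y1" | "u = y2" | "u = y3" using u B by blast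
  then show ?thesis
  proof cases
    case 1
    show ?thesis by (rule sub[OF three_edges_hub[of y1 y2 y3 x2]]) (use x d B 1 in auto)
  next
    case 2
    show ?thesis by (rule sub[OF three_edges_hub[of y1 y2 y3 x1]]) (use x d B 2 in auto)
  next
    case 3
    show ?thesis by (rule sub[OF three_edges_spoke[of y2 y3 x1 x2]]) (use x d B 3 in auto)
  next
    case 4
    show ?thesis by (rule sub[OF three_edges_spoke[of y1 y3 x1 x2]]) (use x d B 4 in auto)
  next
    case 5
    show ?thesis by (rule sub[OF three_edges_spoke[of y1 y2 x1 x2]]) (use x d B 5 in auto)
  qed
next
  assume "bad6 N' B"
  then obtain x1 x2 x3 y1 y2 y3 where d: "distinct [x1, x2, x3, y1, y2, y3]"
    and B: "B = {x1, x2, x3, y1, y2, y3}"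
    and x: "{y1, y2, y3} \<subseteq> N' x1" "{y1, y2, y3} \<subseteq> N' x2" "{y1, y2, y3} \<subseteq> N' x3"
    by (rule bad6E)
  \<comment> \<open>The two sides of K_{3,3} are interchangeable, so \<open>three_edges_hub\<close>
    covers every position of \<open>u\<close>.\<close>
  have y: "{x1, x2, x3} \<subseteq> N' y1" "{x1, x2, x3} \<subseteq> N' y2" "{x1, x2, x3} \<subseteq> N' y3"
    using x N'_sym[of _ x1] N'_sym[of _ x2] N'_sym[of _ x3] by simp_all
  have sub: "\<exists>M. mat N M \<and> acyc N (\<Union>M) \<and> card M = 3 \<and> \<Union>M \<subseteq> B \<union> Q"
    if h: "\<exists>M. mat N M \<and> acyc N (\<Union>M) \<and> card M = 3 \<and> \<Union>M \<subseteq> Q \<union> C" "C \<subseteq> B" for C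
  proof -
    obtain M where M: "mat N M" "acyc N (\<Union>M)" "card M = 3" "\<Union>M \<subseteq> Q \<union> C"
      using h(1) by (elim conjE exE)
    have "\<Union>M \<subseteq> B \<union> Q" using M(4) h(2) by (auto dest!: subsetD)
    then show ?thesis using M(1-3) by (intro exI[of _ M] conjI)
  qed
  consider "u = x1" | "u = x2" | "u = x3" | "u = y1" | "u = y2" | "u = y3" using u B by blast
  then show ?thesis
  proof cases
    case 1
    show ?thesis by (rule sub[OF three_edges_hub[of y1 y2 y3 x2]]) (use x d B 1 in auto)
  next
    case 2
    show ?thesis by (rule sub[OF three_edges_hub[of y1 y2 y3 x1]]) (use x d B 2 in auto)
  next
    case 3
    show ?thesis by (rule sub[OF three_edges_hub[of y1 y2 y3 x1]]) (use x d B 3 in auto)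
  next
    case 4
    show ?thesis by (rule sub[OF three_edges_hub[of x1 x2 x3 y2]]) (use y d B 4 in auto)
  next
    case 5
    show ?thesis by (rule sub[OF three_edges_hub[of x1 x2 x3 y1]]) (use y d B 5 in auto)
  next
    case 6
    show ?thesis by (rule sub[OF three_edges_hub[of x1 x2 x3 y1]]) (use y d B 6 in auto)
  qed
qed

text \<open>The bound is 6 + 4: undoing the contraction adds \<open>c\<close> and \<open>P\<close>
  to a set of at most six vertices. Three edges pay for twelve.\<close>

lemma bad_hub_closed:
  assumes bad: "bad5 N' B \<or> bad6 N' B" and u: "u \<in> B"
  shows "closed_in N (B \<union> Q)" "finite (B \<union> Q)" "card (B \<union> Q) \<le> 10"
proof -
  interpret c: sgraph "V - (Q - {u})" N' by (rule sgraph')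
  have cl: "closed_in N' B" using bad_closed[OF bad] .
  have R: "Rim \<subseteq> B" using cl u N'_u by (auto simp: closed_in_def)
  show "closed_in N (B \<union> Q)"
    unfolding closed_in_def
  proof
    fix x assume x: "x \<in> B \<union> Q"
    show "N x \<subseteq> B \<union> Q"
    proof (cases "x \<in> Q")
      case True
      then consider "x = u" | "x = c" | "x \<in> P" by blast
      then show ?thesis
      proof cases
        case 3
        then have "N x \<subseteq> Rim \<union> Q" unfolding Rim_def by blast
        then show ?thesis using R by blast
      qed (use Nu Nc in auto)
    next
      case False
      then have "N' x \<subseteq> B" using x cl by (auto simp: closed_in_def)
      moreover have "N x \<subseteq> N' x \<union> P" using N'_out[OF False] by auto
      ultimately show ?thesis by blast
    qed
  qed
  have B: "finite B \<and> card B \<le> 6"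
    using bad
  proof
    assume "bad5 N' B"
    then show ?thesis by (rule bad5E) simp
  next
    assume "bad6 N' B"
    then show ?thesis by (rule bad6E) simp
  qed
  then show "finite (B \<union> Q)" by simp
  have eq: "B \<union> Q = B \<union> insert c P" using u by auto
  have "card (B \<union> Q) \<le> card B + card (insert c P)" unfolding eq by (rule card_Un_le)
  then show "card (B \<union> Q) \<le> 10" using B notP cardP by simp
qed

end

section \<open>Induction by contraction and deletion\<close>

theorem no_bad_bound:
  assumes "sgraph V N"
    and deg3: "\<And>x. card (N x) \<le> 3"
    and nonisolated: "\<And>x. x \<in> V \<Longrightarrow> N x \<noteq> {}"
    and nobad: "\<And>B. \<not> (bad5 N B \<or> bad6 N B)"
  shows "\<exists>M. mat N M \<and> acyc N (\<Union>M) \<and> card V \<le> 4 * card M"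
  using assms
proof (induction "card V" arbitrary: V N rule: less_induct)
  case less
  interpret sgraph V N by (rule less.prems(1))
  show ?case
  proof (cases "\<exists>x y. x \<noteq> y \<and> 3 \<le> card (N x \<inter> N y)")
    case False
    have "card (N x \<inter> N y) \<le> 2" if "x \<noteq> y" for x y
      using False that by (metis not_less_eq_eq numeral_3_eq_3 numeral_2_eq_2)
    then show ?thesis using K23_free_bound[OF less.prems(2,3)] by blast
  next
    case True
    then obtain u c where uc: "u \<noteq> c" "3 \<le> card (N u \<inter> N c)" by blast
    have N: "N u \<inter> N c = N u" "N u \<inter> N c = N c"
      using card_seteq[of "N u" "N u \<inter> N c"] card_seteq[of "N c" "N u \<inter> N c"]
        less.prems(2)[of u] less.prems(2)[of c] uc(2) by auto
    have c3: "card (N u) = 3" using uc(2) N less.prems(2)[of u] by simp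
    interpret K: K23 V N u c "N u"
      by unfold_locales (use less.prems(2) uc N c3 in auto)
    \<comment> \<open>An empty rim would make the copy an exceptional component on five vertices. A
      nonempty one keeps the contracted vertex from being isolated.\<close>
    have R: "K.Rim \<noteq> {}"
    proof
      assume R: "K.Rim = {}"
      obtain v a b where vab: "N u = {v, a, b}" "v \<noteq> a" "v \<noteq> b" "a \<noteq> b"
        using c3 by (auto simp: card_3_iff)
      have "N p \<subseteq> K.Q" if "p \<in> N u" for p using R that unfolding K.Rim_def by blast
      then have "closed_in N {u, c, v, a, b}"
        using vab K.Nc unfolding closed_in_def by auto
      moreover have "distinct [u, c, v, a, b]" using vab uc(1) K.notP by auto
      ultimately have "bad5 N {u, c, v, a, b}"
        unfolding bad5_def using vab(1) K.Nc by blast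
      then show False using less.prems(4) by blast
    qed
    show ?thesis
    proof (cases "\<exists>B. bad5 K.N' B \<or> bad6 K.N' B")
      case False
      have lt: "card (V - (K.Q - {u})) < card V" using K.card_V' by simp
      have "\<exists>M. mat K.N' M \<and> acyc K.N' (\<Union>M) \<and> card (V - (K.Q - {u})) \<le> 4 * card M"
      proof (rule less.hyps[OF lt K.sgraph' K.deg3'])
        show "K.N' x \<noteq> {}" if "x \<in> V - (K.Q - {u})" for x
          by (rule K.nonisolated'[OF less.prems(3) R that])
      qed (use False in blast)
      then obtain M' where M': "mat K.N' M'" "acyc K.N' (\<Union>M')"
        "card (V - (K.Q - {u})) \<le> 4 * card M'" by blast
      obtain M where "mat N M" "acyc N (\<Union>M)" "card M = Suc (card M')"
        using K.lift[OF M'(1,2)] less.prems(4) by blast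
      then show ?thesis using M'(3) K.card_V' by (intro exI[of _ M]) simp
    next
      case True
      then obtain B where B: "bad5 K.N' B \<or> bad6 K.N' B" by blast
      \<comment> \<open>An exceptional component away from \<open>u\<close> would already exist
        before the contraction.\<close>
      have uB: "u \<in> B" using K.bad_outside[OF B] less.prems(4) by blast
      define C where "C = B \<union> K.Q"
      have C: "closed_in N C" "finite C" "card C \<le> 10"
        using K.bad_hub_closed[OF B uB] by (simp_all add: C_def)
      obtain M2 where M2: "mat N M2" "acyc N (\<Union>M2)" "card M2 = 3" "\<Union>M2 \<subseteq> C"
        using K.bad_hub[OF B uB] unfolding C_def by blast
      have "u \<in> V - (V - C)" "V - C \<subseteq> V" using K.QV by (auto simp: C_def)
      then have lt: "card (V - C) < card V" using finV by (intro psubset_card_mono) auto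
      have "\<exists>M. mat (del N C) M \<and> acyc (del N C) (\<Union>M) \<and> card (V - C) \<le> 4 * card M"
      proof (rule less.hyps[OF lt del_sgraph[OF C(1)]])
        show "card (del N C x) \<le> 3" for x using less.prems(2)[of x] by (simp add: del_def)
        show "del N C x \<noteq> {}" if "x \<in> V - C" for x using less.prems(3) that by (simp add: del_def)
        show "\<not> (bad5 (del N C) B \<or> bad6 (del N C) B)" for B
          using del_bad(1,2)[OF C(1), of B] less.prems(4)[of B] by blast
      qed
      then obtain M1 where M1: "mat (del N C) M1" "acyc (del N C) (\<Union>M1)"
        "card (V - C) \<le> 4 * card M1" by blast
      have "card V \<le> card (V - C) + card C"
        using diff_card_le_card_Diff[OF C(2), of V] by simp
      then show ?thesis
        using del_combine[OF C(1) M1(1,2) M2(1,2,4)] M1(3) M2(3) C(3)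
        by (intro exI[of _ "M1 \<union> M2"]) simp
    qed
  qed
qed

context sgraph begin

lemma bad_subset_V:
  assumes "bad5 N B \<or> bad6 N B" shows "B \<subseteq> V"
proof
  fix x assume "x \<in> B"
  then obtain y where "y \<in> N x" using bad_nbr[OF assms] by blast
  then show "x \<in> V" using inV by blast
qed

lemma finite_bad: "finite {B. bad5 N B}" "finite {B. bad6 N B}"
proof -
  have "{B. bad5 N B} \<subseteq> Pow V" "{B. bad6 N B} \<subseteq> Pow V" using bad_subset_V by auto
  then show "finite {B. bad5 N B}" "finite {B. bad6 N B}" using finV finite_subset by blast+
qed

lemma bad_edge:
  assumes "bad5 N B \<or> bad6 N B"
  obtains u v where "u \<in> B" "v \<in> B" "v \<in> N u"
  using assms
proof
  assume "bad5 N B"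
  then show thesis by (rule bad5E) (use that in auto)
next
  assume "bad6 N B"
  then show thesis by (rule bad6E) (use that in auto)
qed

text \<open>Deleting \<open>B\<close> lowers the correction by 1 for five vertices and by 2 for six.
  Either way four vertices remain to be paid for by one edge.\<close>

lemma bad_cost:
  assumes "bad5 N B \<or> bad6 N B"
  shows "B \<noteq> {}" "card B + card {B'. bad5 (del N B) B'} + 2 * card {B'. bad6 (del N B) B'}
    \<le> 4 + card {B'. bad5 N B'} + 2 * card {B'. bad6 N B'}"
proof -
  have cl: "closed_in N B" using bad_closed[OF assms] .
  obtain u v where "u \<in> B" using bad_edge[OF assms] .
  then show ne: "B \<noteq> {}" by blast
  have sub5: "{B'. bad5 (del N B) B'} \<subseteq> {B'. bad5 N B'} - {B}"
  proof
    fix B' assume "B' \<in> {B'. bad5 (del N B) B'}"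
    then show "B' \<in> {B'. bad5 N B'} - {B}" using del_bad[OF cl, of B'] ne by auto
  qed
  have sub6: "{B'. bad6 (del N B) B'} \<subseteq> {B'. bad6 N B'} - {B}"
  proof
    fix B' assume "B' \<in> {B'. bad6 (del N B) B'}"
    then show "B' \<in> {B'. bad6 N B'} - {B}" using del_bad[OF cl, of B'] ne by auto
  qed
  have c5: "card {B'. bad5 (del N B) B'} \<le> card ({B'. bad5 N B'} - {B})"
    and c6: "card {B'. bad6 (del N B) B'} \<le> card ({B'. bad6 N B'} - {B})"
    using finite_bad sub5 sub6 by (auto intro: card_mono)
  have l5: "card ({B'. bad5 N B'} - {B}) \<le> card {B'. bad5 N B'}"
    and l6: "card ({B'. bad6 N B'} - {B}) \<le> card {B'. bad6 N B'}"
    using finite_bad by (auto intro: card_mono)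
  show "card B + card {B'. bad5 (del N B) B'} + 2 * card {B'. bad6 (del N B) B'}
    \<le> 4 + card {B'. bad5 N B'} + 2 * card {B'. bad6 N B'}"
    using assms
  proof
    assume b: "bad5 N B"
    then have "card B = 5" by (rule bad5E) simp
    moreover have "Suc (card ({B'. bad5 N B'} - {B})) = card {B'. bad5 N B'}"
      by (rule card_Suc_Diff1) (use finite_bad b in auto)
    ultimately show ?thesis using c5 c6 l6 by simp
  next
    assume b: "bad6 N B"
    then have "card B = 6" by (rule bad6E) simp
    moreover have "Suc (card ({B'. bad6 N B'} - {B})) = card {B'. bad6 N B'}"
      by (rule card_Suc_Diff1) (use finite_bad b in auto)
    ultimately show ?thesis using c5 c6 l5 by simp
  qed
qed

end

theorem acyclic_matching_bound:
  assumes "sgraph V N"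
    and "\<And>x. card (N x) \<le> 3"
    and "\<And>x. x \<in> V \<Longrightarrow> N x \<noteq> {}"
  shows "\<exists>M. mat N M \<and> acyc N (\<Union>M) \<and>
    card V \<le> 4 * card M + card {B. bad5 N B} + 2 * card {B. bad6 N B}"
  using assms
proof (induction "card V" arbitrary: V N rule: less_induct)
  case less
  interpret sgraph V N by (rule less.prems(1))
  show ?case
  proof (cases "\<exists>B. bad5 N B \<or> bad6 N B")
    case False
    then have "\<And>B. \<not> (bad5 N B \<or> bad6 N B)" by blast
    from no_bad_bound[OF less.prems this] show ?thesis by (meson trans_le_add1)
  next
    case True
    then obtain B where B: "bad5 N B \<or> bad6 N B" by blast
    have cl: "closed_in N B" using bad_closed[OF B] .
    have BV: "B \<subseteq> V" "finite B" using bad_subset_V[OF B] finV finite_subset by blast+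
    have lt: "card (V - B) < card V"
      using finV BV bad_cost(1)[OF B] by (intro psubset_card_mono) auto
    have "\<exists>M. mat (del N B) M \<and> acyc (del N B) (\<Union>M) \<and>
      card (V - B) \<le> 4 * card M + card {B'. bad5 (del N B) B'} + 2 * card {B'. bad6 (del N B) B'}"
    proof (rule less.hyps[OF lt del_sgraph[OF cl]])
      show "card (del N B x) \<le> 3" for x using less.prems(2)[of x] by (simp add: del_def)
      show "del N B x \<noteq> {}" if "x \<in> V - B" for x using less.prems(3) that by (simp add: del_def)
    qed
    then obtain M1 where M1: "mat (del N B) M1" "acyc (del N B) (\<Union>M1)"
      and c1: "card (V - B) \<le> 4 * card M1 + card {B'. bad5 (del N B) B'} + 2 * card {B'. bad6 (del N B) B'}"
      by blast
    obtain u v where uv: "u \<in> B" "v \<in> B" "v \<in> N u" using bad_edge[OF B] .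
    have "mat N {}" by (simp add: mat_def)
    then have m: "mat N {{u, v}}" using mat_insert[OF _ uv(3)] by simp
    have "acyc N {u}" using acyc_insert_leaf'[OF acyc_empty, of u u] by simp
    then have "acyc N {v, u}" by (rule acyc_insert_leaf'[where y = u]) auto
    then have a: "acyc N (\<Union>{{u, v}})" by (simp add: insert_commute)
    have s: "\<Union>{{u, v}} \<subseteq> B" using uv by auto
    have "card V = card (V - B) + card B"
      using card_Diff_subset[OF BV(2,1)] card_mono[OF finV BV(1)] by simp
    then have "card V \<le> 4 * card (M1 \<union> {{u, v}}) + card {B. bad5 N B} + 2 * card {B. bad6 N B}"
      using del_combine(3)[OF cl M1 m a s] c1 bad_cost(2)[OF B] by simp
    then show ?thesis using del_combine(1,2)[OF cl M1 m a s] by blast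
  qed
qed

subsection \<open>Digraphs\<close>

definition nbrs :: "'a pair_pre_digraph \<Rightarrow> 'a \<Rightarrow> 'a set" where
  "nbrs G x = {y. (x, y) \<in> parcs G}"

context pre_digraph begin

lemma cas_nth:
  assumes "cas u p v" "i < length p"
  shows "tail G (p ! i) = awalk_verts u p ! i" "head G (p ! i) = awalk_verts u p ! Suc i"
proof -
  have first: "awalk_verts u p ! 0 = u" if "cas u p v" for u p using that by (cases p) auto
  have "tail G (p ! i) = awalk_verts u p ! i \<and> head G (p ! i) = awalk_verts u p ! Suc i"
    using assms
  proof (induction p arbitrary: u i)
    case (Cons e p)
    then show ?case using first[of "head G e" p] by (cases i) auto
  qed simp
  then show "tail G (p ! i) = awalk_verts u p ! i" "head G (p ! i) = awalk_verts u p ! Suc i" by auto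
qed

lemma cas_ends:
  assumes "cas u p v"
  shows "awalk_verts u p ! 0 = u" "awalk_verts u p ! length p = v" "length (awalk_verts u p) = Suc (length p)"
proof -
  have "awalk_verts u p ! 0 = u \<and> awalk_verts u p ! length p = v \<and> length (awalk_verts u p) = Suc (length p)"
    using assms by (induction p arbitrary: u) auto
  then show "awalk_verts u p ! 0 = u" "awalk_verts u p ! length p = v"
    "length (awalk_verts u p) = Suc (length p)" by auto
qed

end

context pair_graph begin

lemma sgraph: "sgraph (pverts G) (nbrs G)"
proof unfold_locales
  fix x y
  show "nbrs G x \<subseteq> pverts G" using in_arcsD2 by (auto simp: nbrs_def)
  show "x \<in> nbrs G y" if "y \<in> nbrs G x" using that arcs_symmetric by (simp add: nbrs_def)
  show "x \<notin> nbrs G x" using pair_no_loops[of "(x, x)"] by (auto simp: nbrs_def)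
qed (rule pair_finite_verts)

lemma out_degree_nbrs: "out_degree G x = card (nbrs G x)"
proof -
  have "out_arcs G x = Pair x ` nbrs G x" by (auto simp: out_arcs_def nbrs_def)
  then show ?thesis by (simp add: out_degree_def card_image inj_on_def)
qed

lemma matching_mat:
  assumes "mat (nbrs G) M" shows "matching G M"
proof -
  have "M \<subseteq> uedges G"
  proof
    fix e assume "e \<in> M"
    then obtain u v where "e = {u, v}" "v \<in> nbrs G u" using mat_edgeE[OF assms] by metis
    then show "e \<in> uedges G" by (auto simp: uedges_def nbrs_def)
  qed
  then show ?thesis using mat_disjoint[OF assms] by (simp add: matching_def)
qed

text \<open>On the vertex set of a cycle every vertex has its predecessor and its successor as
  neighbours, contradicting \<open>acyc\<close>. Length at least 3 makes these two
  different.\<close>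

lemma forest_acyc:
  assumes ac: "acyc (nbrs G) F" shows "undirected_forest (with_proj G \<restriction> F)"
proof -
  let ?H = "with_proj G \<restriction> F"
  have False if c: "pre_digraph.cycle ?H p" and len: "3 \<le> length p" for p
  proof -
    interpret H: pre_digraph ?H .
    obtain u where aw: "H.awalk u p u" and dist: "distinct (tl (H.awalk_verts u p))"
      using c by (auto simp: H.cycle_def)
    have cas: "H.cas u p u" and arcs: "set p \<subseteq> arcs ?H" using aw by (auto simp: H.awalk_def)
    define n where "n = length p"
    define f where "f i = H.awalk_verts u p ! i" for i
    note ends = H.cas_ends[OF cas]
    have f0: "f 0 = f n" using ends by (simp add: f_def n_def)
    have arc: "f (Suc i) \<in> nbrs G (f i) \<and> f i \<in> F \<and> f (Suc i) \<in> F" if "i < n" for i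
    proof -
      have "p ! i \<in> arcs ?H" using arcs nth_mem[of i p] that unfolding n_def by blast
      then show ?thesis
        using H.cas_nth[OF cas, of i] that
        by (cases "p ! i") (simp add: induce_subgraph_def nbrs_def f_def n_def)
    qed
    \<comment> \<open>Distinctness holds for the tail of the vertex list, hence for positions 1 to
      \<open>n\<close>; position 0 repeats position \<open>n\<close>.\<close>
    have inj: "i = j" if "0 < i" "i \<le> n" "0 < j" "j \<le> n" "f i = f j" for i j
    proof -
      have t: "tl (H.awalk_verts u p) ! (k - 1) = f k" if "0 < k" "k \<le> n" for k
        using that ends by (simp add: nth_tl f_def n_def)
      have "i - 1 = j - 1"
        using nth_eq_iff_index_eq[OF dist, of "i - 1" "j - 1"] t[of i] t[of j] that ends
        by (simp add: n_def)
      then show ?thesis using that by simp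
    qed
    define X where "X = f ` {1..n}"
    have XF: "X \<subseteq> F"
    proof
      fix x assume "x \<in> X"
      then obtain i where "x = f i" "1 \<le> i" "i \<le> n" by (auto simp: X_def)
      then show "x \<in> F" using arc[of "i - 1"] by simp
    qed
    have fX: "f i \<in> X" if "i \<le> n" for i
      using that f0 len by (cases "i = 0") (auto simp: X_def n_def)
    have n3: "3 \<le> n" using len by (simp add: n_def)
    have "2 \<le> card (nbrs G x \<inter> X)" if x: "x \<in> X" for x
    proof -
      obtain i where i: "x = f i" "1 \<le> i" "i \<le> n" using x by (auto simp: X_def)
      have prev: "f (i - 1) \<in> nbrs G x"
        using arc[of "i - 1"] i arcs_symmetric by (simp add: nbrs_def)
      have "\<exists>j. 0 < j \<and> j \<le> n \<and> f j \<in> nbrs G x \<and> f j \<noteq> f (i - 1)"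
      proof (cases "i = n")
        case True
        have "f 1 \<in> nbrs G x" using arc[of 0] f0 True i n3 by simp
        moreover have "f 1 \<noteq> f (i - 1)" using inj[of 1 "i - 1"] True n3 by auto
        ultimately show ?thesis using n3 by (intro exI[of _ 1]) simp
      next
        case False
        have "f (Suc i) \<in> nbrs G x" using arc[of i] i False by simp
        moreover have "f (Suc i) \<noteq> f (i - 1)"
        proof (cases "i = 1")
          case True
          then show ?thesis using inj[of "Suc i" n] f0 n3 by auto
        next
          case i1: False
          show ?thesis
          proof
            assume "f (Suc i) = f (i - 1)"
            then have "Suc i = i - 1" by (rule inj[rotated 4]) (use i i1 False in auto)
            then show False by simp
          qed
        qed
        ultimately show ?thesis using i False by (intro exI[of _ "Suc i"]) simp
      qed
      then obtain j where j: "j \<le> n" "f j \<in> nbrs G x" "f j \<noteq> f (i - 1)" by blast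
      have "{f j, f (i - 1)} \<subseteq> nbrs G x \<inter> X" using j prev fX[of j] fX[of "i - 1"] i by auto
      moreover have "finite (nbrs G x \<inter> X)" by (simp add: X_def)
      ultimately have "card {f j, f (i - 1)} \<le> card (nbrs G x \<inter> X)" by (intro card_mono)
      then show ?thesis using j(3) by simp
    qed
    moreover have "X \<noteq> {}" using n3 by (auto simp: X_def)
    ultimately show False using ac XF unfolding acyc_def by blast
  qed
  then show ?thesis by (auto simp: undirected_forest_def)
qed

lemma card_le_acyclic_matching_number:
  assumes "mat (nbrs G) M" "acyc (nbrs G) (\<Union>M)"
  shows "card M \<le> \<nu>\<^sub>a\<^sub>c G"
proof -
  have "acyclic_matching G M"
    using matching_mat[OF assms(1)] forest_acyc[OF assms(2)] by (simp add: acyclic_matching_def)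
  then show ?thesis
    unfolding acyclic_matching_number_def
    using finite_acyclic_matchings[OF pair_graph_axioms] by (intro Max_ge) auto
qed

lemma closed_scc:
  assumes cl: "closed_in (nbrs G) B" and u: "u \<in> B" "u \<in> pverts G"
    and reach: "\<And>x. x \<in> B \<Longrightarrow> u \<rightarrow>\<^sup>*\<^bsub>with_proj G\<^esub> x"
  shows "with_proj G \<restriction> B \<in> sccs"
proof -
  have "x \<in> B" if "u \<rightarrow>\<^sup>*\<^bsub>with_proj G\<^esub> x" for x
    using that u(1)
  proof (induction rule: reachable_induct)
    case (step x y)
    then show ?case using cl by (auto simp: closed_in_def nbrs_def)
  qed
  then have "{x. u \<rightarrow>\<^sup>*\<^bsub>with_proj G\<^esub> x} = B" using reach by blast
  then show ?thesis using induce_reachable_is_in_sccs[OF u(2)] by simp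
qed

text \<open>The arcs of \<open>H\<close> are given as a union over neighbourhoods so that, once
  these are known, the condition becomes an equality of explicit finite sets.\<close>

lemma induced_iso:
  assumes cl: "closed_in (nbrs G) B" and B: "B \<subseteq> pverts G" and inj: "inj_on f B" and v: "pverts H = f ` B"
    and a: "parcs H = (\<Union>x\<in>B. \<Union>y\<in>nbrs G x. {(f x, f y)})"
  shows "digraph_iso (with_proj G \<restriction> B) (with_proj H)"
proof -
  let ?A = "{e \<in> parcs G. fst e \<in> B \<and> snd e \<in> B}"
  let ?h = "\<lparr>iso_verts = f, iso_arcs = map_prod f f, iso_head = snd, iso_tail = fst\<rparr>"
  have wf: "wf_digraph (with_proj G \<restriction> B)" using wellformed_induce_subgraph B by simp
  have "inj_on (map_prod f f) ?A"
    using inj by (auto simp: inj_on_def)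
  then have "pre_digraph.digraph_isomorphism (with_proj G \<restriction> B) ?h"
    unfolding pre_digraph.digraph_isomorphism_def using wf inj by (simp add: induce_subgraph_def)
  moreover have "parcs H = map_prod f f ` ?A"
  proof
    show "parcs H \<subseteq> map_prod f f ` ?A"
    proof
      fix e assume "e \<in> parcs H"
      then obtain x y where xy: "x \<in> B" "y \<in> nbrs G x" "e = (f x, f y)" unfolding a by blast
      then have xyA: "(x, y) \<in> ?A" using cl by (auto simp: closed_in_def nbrs_def)
      show "e \<in> map_prod f f ` ?A" by (rule image_eqI[OF _ xyA]) (simp add: xy(3))
    qed
    show "map_prod f f ` ?A \<subseteq> parcs H" unfolding a by (auto simp: nbrs_def)
  qed
  then have "with_proj H = app_iso ?h (with_proj G \<restriction> B)"
    using v by (simp add: app_iso_def induce_subgraph_def)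
  ultimately show ?thesis unfolding digraph_iso_def by (intro exI[of _ ?h] conjI)
qed

lemma finite_sccs: "finite sccs"
  unfolding sccs_conv_sccs_verts using finite_sccs_verts by simp

end

section \<open>Isomorphism types of the exceptional components\<close>

lemma K4_plus_explicit:
  "pverts K4_plus = {0, 1, 2, 3, 4}"
  "parcs K4_plus = {(0, 2), (2, 0), (0, 3), (3, 0), (1, 2), (2, 1), (1, 3), (3, 1),
     (2, 3), (3, 2), (0, 4), (4, 0), (1, 4), (4, 1)}"
proof -
  have s: "{..<4::nat} = {0, 1, 2, 3}" by auto
  have "{(u, v). u < 4 \<and> v < 4 \<and> u \<noteq> v} = {..<4::nat} \<times> {..<4} - Id" by auto
  then have e: "{(u, v). u < 4 \<and> v < 4 \<and> u \<noteq> v} = {0, 1, 2, 3::nat} \<times> {0, 1, 2, 3} - Id"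
    unfolding s .
  show "pverts K4_plus = {0, 1, 2, 3, 4}"
    using s by (auto simp: K4_plus_def subdivide.simps complete_graph_def)
  show "parcs K4_plus = {(0, 2), (2, 0), (0, 3), (3, 0), (1, 2), (2, 1), (1, 3), (3, 1),
     (2, 3), (3, 2), (0, 4), (4, 0), (1, 4), (4, 1)}"
    unfolding K4_plus_def subdivide.simps complete_graph_def pair_pre_digraph.simps e by auto
qed

locale subcubic_graph = pair_graph G for G :: "'a pair_pre_digraph" +
  assumes subcubic: "subcubic G"
begin

abbreviation "N \<equiv> nbrs G"

sublocale sgraph "pverts G" "nbrs G" by (rule sgraph)

lemma card_nbrs: "card (N x) \<le> 3"
proof (cases "x \<in> pverts G")
  case True
  then show ?thesis using subcubic by (simp add: subcubic_def out_degree_nbrs)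
next
  case False
  then have "N x = {}" using inV by blast
  then show ?thesis by simp
qed

lemma nbrs_eq: "{a, b, c} \<subseteq> N x \<Longrightarrow> a \<noteq> b \<Longrightarrow> a \<noteq> c \<Longrightarrow> b \<noteq> c \<Longrightarrow> N x = {a, b, c}"
  using card_seteq[of "N x" "{a, b, c}"] card_nbrs[of x] by simp

lemma reach: "y \<in> N x \<Longrightarrow> x \<rightarrow>\<^sup>*\<^bsub>with_proj G\<^esub> y"
  by (rule reachable_adjI) (simp add: nbrs_def)

lemma bad_scc:
  assumes bad: "bad5 N B \<or> bad6 N B" shows "with_proj G \<restriction> B \<in> sccs"
proof -
  have "\<exists>u\<in>B. \<forall>x\<in>B. u \<rightarrow>\<^sup>*\<^bsub>with_proj G\<^esub> x"
    using bad
  proof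
    assume "bad5 N B"
    then obtain u c v a b where B: "distinct [u, c, v, a, b]" "B = {u, c, v, a, b}"
      "{v, a, b} \<subseteq> N u" "{v, a, b} \<subseteq> N c" by (rule bad5E)
    have "c \<in> N v" by (rule sym) (use B(4) in simp)
    then have c: "u \<rightarrow>\<^sup>*\<^bsub>with_proj G\<^esub> c"
      using reachable_trans[OF reach[of v u] reach[of c v]] B(3) by simp
    have "u \<rightarrow>\<^sup>*\<^bsub>with_proj G\<^esub> v" "u \<rightarrow>\<^sup>*\<^bsub>with_proj G\<^esub> a" "u \<rightarrow>\<^sup>*\<^bsub>with_proj G\<^esub> b"
      by (rule reach, use B(3) in simp)+
    moreover have "u \<in> pverts G" using B(3) inV[of v u] by simp
    then have "u \<rightarrow>\<^sup>*\<^bsub>with_proj G\<^esub> u" by (rule reachable_refl)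
    ultimately show ?thesis unfolding B(2) using c by simp
  next
    assume "bad6 N B"
    then obtain u c y v a b where B: "distinct [u, c, y, v, a, b]" "B = {u, c, y, v, a, b}"
      "{v, a, b} \<subseteq> N u" "{v, a, b} \<subseteq> N c" "{v, a, b} \<subseteq> N y" by (rule bad6E)
    have "c \<in> N v" by (rule sym) (use B(4) in simp)
    then have c: "u \<rightarrow>\<^sup>*\<^bsub>with_proj G\<^esub> c"
      using reachable_trans[OF reach[of v u] reach[of c v]] B(3) by simp
    have "y \<in> N v" by (rule sym) (use B(5) in simp)
    then have y: "u \<rightarrow>\<^sup>*\<^bsub>with_proj G\<^esub> y"
      using reachable_trans[OF reach[of v u] reach[of y v]] B(3) by simp
    have "u \<rightarrow>\<^sup>*\<^bsub>with_proj G\<^esub> v" "u \<rightarrow>\<^sup>*\<^bsub>with_proj G\<^esub> a" "u \<rightarrow>\<^sup>*\<^bsub>with_proj G\<^esub> b"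
      by (rule reach, use B(3) in simp)+
    moreover have "u \<in> pverts G" using B(3) inV[of v u] by simp
    then have "u \<rightarrow>\<^sup>*\<^bsub>with_proj G\<^esub> u" by (rule reachable_refl)
    ultimately show ?thesis unfolding B(2) using c y by simp
  qed
  then obtain u where u: "u \<in> B" "\<And>x. x \<in> B \<Longrightarrow> u \<rightarrow>\<^sup>*\<^bsub>with_proj G\<^esub> x" by blast
  show ?thesis
    using closed_scc[OF bad_closed[OF bad] u(1) _ u(2)] bad_subset_V[OF bad] u(1) by blast
qed

text \<open>The edge \<open>ab\<close> exhausts the degrees of \<open>a\<close> and
  \<open>b\<close>, so \<open>v\<close> has only the neighbours \<open>u\<close> and
  \<open>c\<close>. Thus \<open>v\<close> is the subdividing vertex 4 between \<open>u\<close> and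
  \<open>c\<close>, the ends 0 and 1 of the subdivided edge.\<close>

lemma iso_K4_plus:
  assumes cl: "closed_in N {u, c, v, a, b}" and d: "distinct [u, c, v, a, b]"
    and N: "{v, a, b} \<subseteq> N u" "{v, a, b} \<subseteq> N c" and ab: "a \<in> N b"
  shows "digraph_iso (with_proj G \<restriction> {u, c, v, a, b}) (with_proj K4_plus)"
proof -
  have Nu: "N u = {v, a, b}" and Nc: "N c = {v, a, b}"
    by (rule nbrs_eq; use N d in simp)+
  have Np: "u \<in> N p \<and> c \<in> N p" if "p \<in> {v, a, b}" for p
    using sym[of p u] sym[of p c] Nu Nc that by blast
  have Na: "N a = {u, c, b}" by (rule nbrs_eq) (use Np[of a] sym[OF ab] d in auto)
  have Nb: "N b = {u, c, a}" by (rule nbrs_eq) (use Np[of b] ab d in auto)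
  have "v \<notin> N a" "v \<notin> N b" using Na Nb d by auto
  then have "a \<notin> N v" "b \<notin> N v" "v \<notin> N v" using sym irrefl by blast+
  moreover have "N v \<subseteq> {u, c, v, a, b}" using cl by (simp add: closed_in_def)
  ultimately have Nv: "N v = {u, c}" using Np[of v] by auto
  define f where "f = (\<lambda>_. 0)(c := 1, v := 4, a := 2, b := 3 :: nat)"
  have f: "f u = 0" "f c = 1" "f v = 4" "f a = 2" "f b = 3" using d by (auto simp: f_def)
  show ?thesis
  proof (rule induced_iso[OF cl, where f = f])
    show "{u, c, v, a, b} \<subseteq> pverts G" using inV[of v u] inV[of v c] N_sub[of u] Nu Nc by auto
    show "inj_on f {u, c, v, a, b}" using f by (simp add: inj_on_def)
    show "pverts K4_plus = f ` {u, c, v, a, b}" unfolding K4_plus_explicit using f by auto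
    show "parcs K4_plus = (\<Union>x\<in>{u, c, v, a, b}. \<Union>y\<in>N x. {(f x, f y)})"
      unfolding K4_plus_explicit by (simp add: Nu Nc Nv Na Nb f) auto
  qed
qed

lemma iso_K23:
  assumes cl: "closed_in N {u, c, v, a, b}" and d: "distinct [u, c, v, a, b]"
    and N: "{v, a, b} \<subseteq> N u" "{v, a, b} \<subseteq> N c"
    and no: "a \<notin> N b" "v \<notin> N a" "v \<notin> N b"
  shows "digraph_iso (with_proj G \<restriction> {u, c, v, a, b}) (with_proj (complete_bipartite_graph 2 3))"
proof -
  have Nu: "N u = {v, a, b}" and Nc: "N c = {v, a, b}"
    by (rule nbrs_eq; use N d in simp)+
  have Np: "u \<in> N p \<and> c \<in> N p" if "p \<in> {v, a, b}" for p
    using sym[of p u] sym[of p c] Nu Nc that by blast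
  have no': "b \<notin> N a" "a \<notin> N v" "b \<notin> N v" using no sym by blast+
  have sub: "N p \<subseteq> {u, c, v, a, b}" if "p \<in> {v, a, b}" for p
    using cl that by (auto simp: closed_in_def)
  have Nv: "N v = {u, c}" and Na: "N a = {u, c}" and Nb: "N b = {u, c}"
    using Np[of v] sub[of v] Np[of a] sub[of a] Np[of b] sub[of b] no no' irrefl[of v] irrefl[of a] irrefl[of b]
    by auto
  define f :: "'a \<Rightarrow> nat + nat"
    where "f = (\<lambda>_. Inl 0)(c := Inl 1, v := Inr 0, a := Inr 1, b := Inr 2)"
  have f: "f u = Inl 0" "f c = Inl 1" "f v = Inr 0" "f a = Inr 1" "f b = Inr 2"
    using d by (auto simp: f_def)
  have l: "{..<2::nat} = {0, 1}" "{..<3::nat} = {0, 1, 2}" by auto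
  show ?thesis
  proof (rule induced_iso[OF cl, where f = f])
    show "{u, c, v, a, b} \<subseteq> pverts G" using inV[of v u] inV[of v c] N_sub[of u] Nu Nc by auto
    show "inj_on f {u, c, v, a, b}" using f by (simp add: inj_on_def)
    show "pverts (complete_bipartite_graph 2 3) = f ` {u, c, v, a, b}"
      unfolding complete_bipartite_graph_def l using f by auto
    show "parcs (complete_bipartite_graph 2 3) = (\<Union>x\<in>{u, c, v, a, b}. \<Union>y\<in>N x. {(f x, f y)})"
      unfolding complete_bipartite_graph_def l by (simp add: Nu Nc Nv Na Nb f) auto
  qed
qed

lemma iso_K33:
  assumes cl: "closed_in N {u, c, y, v, a, b}" and d: "distinct [u, c, y, v, a, b]"
    and N: "{v, a, b} \<subseteq> N u" "{v, a, b} \<subseteq> N c" "{v, a, b} \<subseteq> N y"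
  shows "digraph_iso (with_proj G \<restriction> {u, c, y, v, a, b}) (with_proj (complete_bipartite_graph 3 3))"
proof -
  have Nu: "N u = {v, a, b}" and Nc: "N c = {v, a, b}" and Ny: "N y = {v, a, b}"
    by (rule nbrs_eq; use N d in simp)+
  have Np: "N p = {u, c, y}" if "p \<in> {v, a, b}" for p
    by (rule nbrs_eq) (use sym[of p u] sym[of p c] sym[of p y] Nu Nc Ny that d in auto)
  have Nv: "N v = {u, c, y}" and Na: "N a = {u, c, y}" and Nb: "N b = {u, c, y}"
    using Np by simp_all
  define f :: "'a \<Rightarrow> nat + nat"
    where "f = (\<lambda>_. Inl 0)(c := Inl 1, y := Inl 2, v := Inr 0, a := Inr 1, b := Inr 2)"
  have f: "f u = Inl 0" "f c = Inl 1" "f y = Inl 2" "f v = Inr 0" "f a = Inr 1" "f b = Inr 2"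
    using d by (auto simp: f_def)
  have l: "{..<3::nat} = {0, 1, 2}" by auto
  show ?thesis
  proof (rule induced_iso[OF cl, where f = f])
    show "{u, c, y, v, a, b} \<subseteq> pverts G"
      using inV[of v u] inV[of v c] inV[of v y] N_sub[of u] Nu Nc Ny by auto
    show "inj_on f {u, c, y, v, a, b}" using f by (simp add: inj_on_def)
    show "pverts (complete_bipartite_graph 3 3) = f ` {u, c, y, v, a, b}"
      unfolding complete_bipartite_graph_def l using f by auto
    show "parcs (complete_bipartite_graph 3 3) = (\<Union>x\<in>{u, c, y, v, a, b}. \<Union>z\<in>N x. {(f x, f z)})"
      unfolding complete_bipartite_graph_def l by (simp add: Nu Nc Ny Nv Na Nb f) auto
  qed
qed

text \<open>Each of \<open>v\<close>, \<open>a\<close>, \<open>b\<close> has one place left beside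
  \<open>u\<close> and \<open>c\<close>, so at most one edge joins two of them. Without it the
  component is K_{2,3}, with it K_4^+.\<close>

lemma bad5_iso:
  assumes "bad5 N B"
  shows "digraph_iso (with_proj G \<restriction> B) (with_proj (complete_bipartite_graph 2 3))
    \<or> digraph_iso (with_proj G \<restriction> B) (with_proj K4_plus)"
proof -
  have cl: "closed_in N B" using assms bad_closed by blast
  obtain u c v a b where d: "distinct [u, c, v, a, b]" and B: "B = {u, c, v, a, b}"
    and N: "{v, a, b} \<subseteq> N u" "{v, a, b} \<subseteq> N c" using assms by (rule bad5E)
  note cl' = cl[unfolded B]
  have p1: "{u, c, v, a, b} = {u, c, a, v, b}" and p2: "{u, c, v, a, b} = {u, c, b, v, a}" by auto
  consider "a \<notin> N b" "v \<notin> N a" "v \<notin> N b" | "a \<in> N b" | "v \<in> N a" | "v \<in> N b" by blast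
  then show ?thesis
  proof cases
    case 1
    then show ?thesis unfolding B using iso_K23[OF cl' d N] by blast
  next
    case 2
    then show ?thesis unfolding B using iso_K4_plus[OF cl' d N] by blast
  next
    case 3
    have "digraph_iso (with_proj G \<restriction> {u, c, b, v, a}) (with_proj K4_plus)"
      by (rule iso_K4_plus) (use cl' p2 d N 3 in auto)
    then show ?thesis unfolding B p2 by blast
  next
    case 4
    have "digraph_iso (with_proj G \<restriction> {u, c, a, v, b}) (with_proj K4_plus)"
      by (rule iso_K4_plus) (use cl' p1 d N 4 in auto)
    then show ?thesis unfolding B p1 by blast
  qed
qed

lemma bad6_iso:
  assumes "bad6 N B"
  shows "digraph_iso (with_proj G \<restriction> B) (with_proj (complete_bipartite_graph 3 3))"
proof -
  have cl: "closed_in N B" using assms bad_closed by blast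
  obtain u c y v a b where d: "distinct [u, c, y, v, a, b]" and B: "B = {u, c, y, v, a, b}"
    and N: "{v, a, b} \<subseteq> N u" "{v, a, b} \<subseteq> N c" "{v, a, b} \<subseteq> N y" using assms by (rule bad6E)
  show ?thesis using iso_K33[OF cl[unfolded B] d N] unfolding B .
qed

lemma inj_induce: "inj_on (\<lambda>B. with_proj G \<restriction> B) X"
  by (rule inj_onI) (drule arg_cong[where f = verts], simp)

text \<open>An upper bound suffices: different bad sets induce different components, each of one of
  the two types.\<close>

lemma card_bad5: "card {B. bad5 N B} \<le> \<kappa> G (complete_bipartite_graph 2 3) + \<kappa> G K4_plus"
proof -
  let ?S = "\<lambda>H. {C \<in> sccs. digraph_iso C (with_proj H)}"
  have "card {B. bad5 N B} = card ((\<lambda>B. with_proj G \<restriction> B) ` {B. bad5 N B})"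
    by (rule card_image[symmetric]) (rule inj_induce)
  also have "\<dots> \<le> card (?S (complete_bipartite_graph 2 3) \<union> ?S K4_plus)"
    by (rule card_mono) (use finite_sccs bad_scc bad5_iso in auto)
  also have "\<dots> \<le> card (?S (complete_bipartite_graph 2 3)) + card (?S K4_plus)" by (rule card_Un_le)
  finally show ?thesis by (simp add: components_iso_def)
qed

lemma card_bad6: "card {B. bad6 N B} \<le> \<kappa> G (complete_bipartite_graph 3 3)"
proof -
  have "card {B. bad6 N B} = card ((\<lambda>B. with_proj G \<restriction> B) ` {B. bad6 N B})"
    by (rule card_image[symmetric]) (rule inj_induce)
  also have "\<dots> \<le> card {C \<in> sccs. digraph_iso C (with_proj (complete_bipartite_graph 3 3))}"
    by (rule card_mono) (use finite_sccs bad_scc bad6_iso in auto)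
  finally show ?thesis by (simp add: components_iso_def)
qed

end

theorem theorem2:
  fixes G :: "'a pair_pre_digraph"
  assumes "pair_graph G"
    and "subcubic G"
    and "\<not> (\<exists>v. isolated G v)"
  shows "real (\<nu>\<^sub>a\<^sub>c G) \<ge> 1 / 4 *
    (real (card (pverts G))
      - real (\<kappa> G (complete_bipartite_graph 2 3))
      - real (\<kappa> G K4_plus)
      - 2 * real (\<kappa> G (complete_bipartite_graph 3 3)))"
proof -
  interpret subcubic_graph G
    using assms(1,2) by (simp add: subcubic_graph_def subcubic_graph_axioms_def)
  have "N x \<noteq> {}" if "x \<in> pverts G" for x
    using assms(3) that by (auto simp: isolated_def out_degree_nbrs)
  then obtain M where M: "mat N M" "acyc N (\<Union>M)"
    "card (pverts G) \<le> 4 * card M + card {B. bad5 N B} + 2 * card {B. bad6 N B}"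
    using acyclic_matching_bound[OF sgraph card_nbrs] by blast
  have "card (pverts G) \<le> 4 * \<nu>\<^sub>a\<^sub>c G + (\<kappa> G (complete_bipartite_graph 2 3) + \<kappa> G K4_plus)
      + 2 * \<kappa> G (complete_bipartite_graph 3 3)"
    using M(3) card_le_acyclic_matching_number[OF M(1,2)] card_bad5 card_bad6 by linarith
  then have "real (card (pverts G)) \<le> real (4 * \<nu>\<^sub>a\<^sub>c G
      + (\<kappa> G (complete_bipartite_graph 2 3) + \<kappa> G K4_plus) + 2 * \<kappa> G (complete_bipartite_graph 3 3))"
    by (simp only: of_nat_le_iff)
  then show ?thesis by simp
qed

end
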